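(* Let $p,q$ be positive integers, $n=p+q$, and let $K = GL(p,\mathbb{C})\times GL(q,\mathbb{C})$ be embedded block-diagonally in $G=GL(n,\mathbb{C})$. Suppose $\gamma$ is a $(p,q)$-clan avoiding the pattern $(1,2,1,2)$, and let $Q_\gamma$ be the corresponding $K$-orbit on the flag variety $G/B\cong Fl(\mathbb{C}^n)$. Then the closure $\overline{Q_{\gamma}}$ is the Richardson variety $X_{u(\gamma)}^{v(\gamma)}$.
   Context: **Flags.** $B, B^-\subseteq G=GL(n,\mathbb{C})$ are the upper- and lower-triangular Borel subgroups. $Fl(\mathbb{C}^n)\cong G/B$ is the variety of complete flags $F_\bullet=(F_0\subset F_1\subset\cdots\subset F_n=\mathbb{C}^n)$, $\dim F_i=i$; the coset $gB$ corresponds to the flag with $F_i$ spanned by the first $i$ columns of $g$. $E_j=\mathbb{C}\langle e_1,\dots,e_j\rangle$ and $\widetilde{E_j}=\mathbb{C}\langle e_n,e_{n-1},\dots,e_{n-j+1}\rangle$ are the spans of the first $j$, respectively last $j$, standard basis vectors. $\pi:\mathbb{C}^n\to E_p$ is the projection with kernel $\widetilde{E_q}$. **Clans.** A $(p,q)$-clan is a string $\gamma=(c_1,\dots,c_n)$ of $n=p+q$ symbols, each a $+$, a $-$, or a natural number, such that every natural number which appears does so exactly twice, and (number of $+$ signs) $-$ (number of $-$ signs) $=p-q$. Clans are considered only up to renaming of the natural numbers (only the positions of matching numbers matter). $\gamma$ avoids the pattern $(1,2,1,2)$ if there are no indices $i<j<k<l$ with $c_i=c_k$ and $c_j=c_l$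 distinct natural numbers. **Orbits.** For $1\le i<j\le n$ (respectively $1 \le i \le n$) let: $\gamma(i;+)$ = number of plus signs plus number of pairs of equal natural numbers among $(c_1,\dots,c_i)$; $\gamma(i;-)$ = number of minus signs plus number of pairs of equal natural numbers among $(c_1,\dots,c_i)$; $\gamma(i;j)$ = number of pairs of equal natural numbers $c_s=c_t$ with $s\le i<j<t$. $Q_\gamma$ is the set of flags $F_\bullet$ such that for all $i<j$ (and, for the first two conditions, all $i$): $\dim(F_i\cap E_p)=\gamma(i;+)$, $\dim(F_i\cap\widetilde{E_q})=\gamma(i;-)$, and $\dim(\pi(F_i)+F_j)=j+\gamma(i;j)$. It is known that each $Q_\gamma$ is a single $K$-orbit and that $\gamma\mapsto Q_\gamma$ is a bijection from $(p,q)$-clans to $K$-orbits on $G/B$. **The permutations $u(\gamma),v(\gamma)\in S_n$.** Let $\gamma_+=\{i: c_i=+$ or $c_i$ is the second occurrence of a natural number$\}$, $\gamma_-=[n]\setminus\gamma_+$, $\widetilde{\gamma_+}=\{i: c_i=+$ or $c_i$ is the first occurrence of a natural number$\}$, $\widetilde{\gamma_-}=[n]\setminus\widetilde{\gamma_+}$. (The sets $\gamma_+,\widetilde{\gamma_+}$ have $p$ elements each.) $u(\gamma)$ takes the values $p,p-1,\dots,1$ on the elements of $\gamma_+$ listed from left to right (in increasing order of position), and the values $n,n-1,\dots,p+1$ on the elements of $\gamma_-$ listed from left to right. $v(\gamma)$ takes the values $1,\dots,p$ on the elements of $\widetilde{\gamma_+}$ from left to right, and the values $p+1,\dots,n$ on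 the elements of $\widetilde{\gamma_-}$ from left to right. Example: for $\gamma=(+,-,1,2,2,1)$, $u(\gamma)=365421$ and $v(\gamma)=142356$ in one-line notation. **Richardson varieties.** For $w\in S_n$, $X_w=\overline{BwB/B}$ is the Schubert variety and $X^w=\overline{B^-wB/B}$ the opposite Schubert variety, where $w$ denotes the permutation matrix sending $e_i$ to $e_{w(i)}$. For $u\ge v$ in Bruhat order, the Richardson variety is $X_u^v=X_u\cap X^v$. *)

theory Defs
  imports
    "Jordan_Normal_Form.VS_Connect"
    "HOL-Analysis.Abstract_Topology"
    "HOL-Combinatorics.Transposition"
begin

text \<open>
  Conventions: matrix indices, positions in a clan and the points permuted by an element of
  \<open>S\<^sub>n\<close> are 0-based (they range over \<open>{..<n}\<close>), in accordance with the matrix library. Hence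
  ``among the first \<open>i\<close> symbols'' means ``at a position \<open>< i\<close>''. Dimensions and the index of
  a component \<open>F i\<close> of a flag are not shifted.
\<close>

section \<open>Subspaces of complex n-space\<close>

abbreviation cspace :: "nat \<Rightarrow> (complex, complex vec) module" where
  "cspace n \<equiv> module_vec TYPE(complex) n"

abbreviation cspan :: "nat \<Rightarrow> complex vec set \<Rightarrow> complex vec set" where
  "cspan n \<equiv> LinearCombinations.module.span class_ring (cspace n)"

abbreviation csubspace :: "nat \<Rightarrow> complex vec set \<Rightarrow> bool" where
  "csubspace n W \<equiv> VectorSpace.subspace class_ring W (cspace n)"

abbreviation cdim :: "nat \<Rightarrow> complex vec set \<Rightarrow> nat" where
  "cdim n W \<equiv> vectorspace.dim class_ring ((cspace n)\<lparr>carrier := W\<rparr>)"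

definition E_first :: "nat \<Rightarrow> nat \<Rightarrow> complex vec set" where
  "E_first n j = cspan n {unit_vec n i | i. i < j \<and> i < n}"

definition E_last :: "nat \<Rightarrow> nat \<Rightarrow> complex vec set" where
  "E_last n j = cspan n {unit_vec n i | i. n - j \<le> i \<and> i < n}"

text \<open>For \<open>n = p + q\<close>, the projection onto \<open>E_first n p\<close> with kernel \<open>E_last n q\<close>.\<close>

definition proj_first :: "nat \<Rightarrow> nat \<Rightarrow> complex vec \<Rightarrow> complex vec" where
  "proj_first n p x = vec n (\<lambda>i. if i < p then x $ i else 0)"

section \<open>The flag variety\<close>

definition GL :: "nat \<Rightarrow> complex mat set" where
  "GL n = {g \<in> carrier_mat n n. invertible_mat g}"

definition flags :: "nat \<Rightarrow> (nat \<Rightarrow> complex vec set) set" where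
  "flags n = {F \<in> extensional {0..n}.
     (\<forall>i\<le>n. csubspace n (F i) \<and> cdim n (F i) = i) \<and> (\<forall>i<n. F i \<subset> F (Suc i))}"

text \<open>The flag corresponding to the coset \<open>gB\<close>.\<close>

definition flag_of :: "nat \<Rightarrow> complex mat \<Rightarrow> nat \<Rightarrow> complex vec set" where
  "flag_of n g = (\<lambda>i\<in>{0..n}. cspan n (set (take i (cols g))))"

inductive poly_fun :: "nat \<Rightarrow> (complex mat \<Rightarrow> complex) \<Rightarrow> bool" for n :: nat where
  const: "poly_fun n (\<lambda>A. c)"
| entry: "i < n \<Longrightarrow> j < n \<Longrightarrow> poly_fun n (\<lambda>A. A $$ (i, j))"
| add: "poly_fun n f \<Longrightarrow> poly_fun n g \<Longrightarrow> poly_fun n (\<lambda>A. f A + g A)"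
| mult: "poly_fun n f \<Longrightarrow> poly_fun n g \<Longrightarrow> poly_fun n (\<lambda>A. f A * g A)"

definition zero_locus :: "nat \<Rightarrow> (complex mat \<Rightarrow> complex) set \<Rightarrow> complex mat set" where
  "zero_locus n P = {g \<in> GL n. \<forall>f\<in>P. f g = 0}"

text \<open>
  The Zariski topology of \<open>GL n\<close>. Adjoining the inverse determinant to the coordinate
  functions does not change the closed sets.
\<close>

definition zariski_GL :: "nat \<Rightarrow> complex mat topology" where
  "zariski_GL n = topology (\<lambda>U. U \<subseteq> GL n \<and>
     (\<exists>P \<subseteq> Collect (poly_fun n). GL n - U = zero_locus n P))"

text \<open>
  The Zariski topology of the flag variety, i.e. the quotient topology of \<open>GL n / B\<close>.
\<close>

definition zariski_flags :: "nat \<Rightarrow> (nat \<Rightarrow> complex vec set) topology" where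
  "zariski_flags n = topology (\<lambda>U. U \<subseteq> flags n \<and>
     openin (zariski_GL n) {g \<in> GL n. flag_of n g \<in> U})"

lemma zero_locus_Un:
  "zero_locus n P \<union> zero_locus n Q = zero_locus n ((\<lambda>(f, h) A. f A * h A) ` (P \<times> Q))"
  by (auto simp: zero_locus_def)

lemma istopology_zariski_GL:
  "istopology (\<lambda>U. U \<subseteq> GL n \<and> (\<exists>P \<subseteq> Collect (poly_fun n). GL n - U = zero_locus n P))"
  (is "istopology ?T")
  unfolding istopology_def
proof (intro conjI allI impI)
  fix S T assume S: "?T S" and T: "?T T"
  then show "S \<inter> T \<subseteq> GL n" by blast
  obtain P where P: "P \<subseteq> Collect (poly_fun n)" "GL n - S = zero_locus n P" using S by auto
  obtain Q where Q: "Q \<subseteq> Collect (poly_fun n)" "GL n - T = zero_locus n Q" using T by auto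
  let ?R = "(\<lambda>(f, h) A. f A * h A) ` (P \<times> Q)"
  have "GL n - S \<inter> T = zero_locus n ?R"
    using P(2) Q(2) by (simp add: Diff_Int zero_locus_Un)
  moreover have "?R \<subseteq> Collect (poly_fun n)"
    using P(1) Q(1) by (auto intro: poly_fun.mult)
  ultimately show "\<exists>R \<subseteq> Collect (poly_fun n). GL n - S \<inter> T = zero_locus n R"
    by (intro exI[of _ ?R] conjI)
next
  fix \<K> assume K: "\<forall>U\<in>\<K>. ?T U"
  then show "\<Union>\<K> \<subseteq> GL n" by auto
  from K have "\<forall>U\<in>\<K>. \<exists>P. P \<subseteq> Collect (poly_fun n) \<and> GL n - U = zero_locus n P" by simp
  from bchoice[OF this] obtain P where
    P: "\<forall>U\<in>\<K>. P U \<subseteq> Collect (poly_fun n) \<and> GL n - U = zero_locus n (P U)" ..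
  have "GL n - \<Union>\<K> = {g \<in> GL n. \<forall>U\<in>\<K>. g \<in> GL n - U}" by auto
  also have "\<dots> = {g \<in> GL n. \<forall>U\<in>\<K>. g \<in> zero_locus n (P U)}" using P by simp
  also have "\<dots> = zero_locus n (\<Union>(P ` \<K>))" by (auto simp: zero_locus_def)
  finally have "GL n - \<Union>\<K> = zero_locus n (\<Union>(P ` \<K>))" .
  moreover have "\<Union>(P ` \<K>) \<subseteq> Collect (poly_fun n)" using P by (simp add: UN_subset_iff)
  ultimately show "\<exists>R \<subseteq> Collect (poly_fun n). GL n - \<Union>\<K> = zero_locus n R"
    by (intro exI[of _ "\<Union>(P ` \<K>)"] conjI)
qed

lemma openin_zariski_GL:
  "openin (zariski_GL n) U \<longleftrightarrow> U \<subseteq> GL n \<and>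
     (\<exists>P \<subseteq> Collect (poly_fun n). GL n - U = zero_locus n P)"
  unfolding zariski_GL_def by (simp only: topology_inverse'[OF istopology_zariski_GL])

lemma openin_zariski_flags:
  "openin (zariski_flags n) U \<longleftrightarrow> U \<subseteq> flags n \<and>
     openin (zariski_GL n) {g \<in> GL n. flag_of n g \<in> U}"
proof -
  let ?T = "\<lambda>U. U \<subseteq> flags n \<and> openin (zariski_GL n) {g \<in> GL n. flag_of n g \<in> U}"
  have "istopology ?T"
    unfolding istopology_def
  proof (intro conjI allI impI)
    fix S T assume *: "?T S" "?T T"
    have "{g \<in> GL n. flag_of n g \<in> S \<inter> T} =
      {g \<in> GL n. flag_of n g \<in> S} \<inter> {g \<in> GL n. flag_of n g \<in> T}" by blast
    with * show "openin (zariski_GL n) {g \<in> GL n. flag_of n g \<in> S \<inter> T}" by auto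
    show "S \<inter> T \<subseteq> flags n" using * by blast
  next
    fix \<K> assume *: "\<forall>U\<in>\<K>. ?T U"
    have "{g \<in> GL n. flag_of n g \<in> \<Union>\<K>} = (\<Union>U\<in>\<K>. {g \<in> GL n. flag_of n g \<in> U})" by blast
    with * show "openin (zariski_GL n) {g \<in> GL n. flag_of n g \<in> \<Union>\<K>}" by auto
    show "\<Union>\<K> \<subseteq> flags n" using * by blast
  qed
  then show ?thesis unfolding zariski_flags_def by (simp only: topology_inverse')
qed

section \<open>Schubert and Richardson varieties\<close>

definition borel_upper :: "nat \<Rightarrow> complex mat set" where
  "borel_upper n = {b \<in> GL n. \<forall>i<n. \<forall>j<n. j < i \<longrightarrow> b $$ (i, j) = 0}"

definition borel_lower :: "nat \<Rightarrow> complex mat set" where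
  "borel_lower n = {b \<in> GL n. \<forall>i<n. \<forall>j<n. i < j \<longrightarrow> b $$ (i, j) = 0}"

text \<open>The matrix sending the \<open>j\<close>-th unit vector to the \<open>w j\<close>-th one.\<close>

definition perm_matrix :: "nat \<Rightarrow> (nat \<Rightarrow> nat) \<Rightarrow> complex mat" where
  "perm_matrix n w = mat n n (\<lambda>(i, j). if i = w j then 1 else 0)"

definition schubert :: "nat \<Rightarrow> (nat \<Rightarrow> nat) \<Rightarrow> (nat \<Rightarrow> complex vec set) set" where
  "schubert n w = zariski_flags n closure_of
     {flag_of n (b * perm_matrix n w * b') | b b'. b \<in> borel_upper n \<and> b' \<in> borel_upper n}"

definition opp_schubert :: "nat \<Rightarrow> (nat \<Rightarrow> nat) \<Rightarrow> (nat \<Rightarrow> complex vec set) set" where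
  "opp_schubert n w = zariski_flags n closure_of
     {flag_of n (b * perm_matrix n w * b') | b b'. b \<in> borel_lower n \<and> b' \<in> borel_upper n}"

text \<open>
  Bruhat order on \<open>S\<^sub>n\<close>: the reflexive transitive closure of right multiplication by a
  transposition that increases the length; for \<open>i < j\<close> the latter means \<open>w i < w j\<close>.
\<close>

definition bruhat_step :: "nat \<Rightarrow> (nat \<Rightarrow> nat) \<Rightarrow> (nat \<Rightarrow> nat) \<Rightarrow> bool" where
  "bruhat_step n w w' \<longleftrightarrow>
     (\<exists>i j. i < j \<and> j < n \<and> w i < w j \<and> w' = w \<circ> Transposition.transpose i j)"

definition bruhat_le :: "nat \<Rightarrow> (nat \<Rightarrow> nat) \<Rightarrow> (nat \<Rightarrow> nat) \<Rightarrow> bool" where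
  "bruhat_le n = (bruhat_step n)\<^sup>*\<^sup>*"

text \<open>Only used for \<open>bruhat_le n v u\<close>.\<close>

definition richardson ::
  "nat \<Rightarrow> (nat \<Rightarrow> nat) \<Rightarrow> (nat \<Rightarrow> nat) \<Rightarrow> (nat \<Rightarrow> complex vec set) set" where
  "richardson n u v = schubert n u \<inter> opp_schubert n v"

section \<open>Clans\<close>

datatype clan_symbol = Plus | Minus | Num nat

text \<open>
  Clans are not quotiented by renaming of the natural numbers: everything below depends on
  the numbers only through the relation \<open>mates\<close> (and the positions of the signs).
\<close>

definition is_clan :: "nat \<Rightarrow> nat \<Rightarrow> clan_symbol list \<Rightarrow> bool" where
  "is_clan p q \<gamma> \<longleftrightarrow> length \<gamma> = p + q \<and>
     (\<forall>k. Num k \<in> set \<gamma> \<longrightarrow> count_list \<gamma> (Num k) = 2) \<and>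
     int (count_list \<gamma> Plus) - int (count_list \<gamma> Minus) = int p - int q"

definition avoids_1212 :: "clan_symbol list \<Rightarrow> bool" where
  "avoids_1212 \<gamma> \<longleftrightarrow> \<not> (\<exists>i j k l a b. i < j \<and> j < k \<and> k < l \<and> l < length \<gamma> \<and> a \<noteq> b \<and>
     \<gamma> ! i = Num a \<and> \<gamma> ! j = Num b \<and> \<gamma> ! k = Num a \<and> \<gamma> ! l = Num b)"

definition mates :: "clan_symbol list \<Rightarrow> nat \<Rightarrow> nat \<Rightarrow> bool" where
  "mates \<gamma> s t \<longleftrightarrow> s < t \<and> t < length \<gamma> \<and> (\<exists>k. \<gamma> ! s = Num k \<and> \<gamma> ! t = Num k)"

definition clan_plus :: "clan_symbol list \<Rightarrow> nat \<Rightarrow> nat" where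
  "clan_plus \<gamma> i = count_list (take i \<gamma>) Plus + card {(s, t). mates \<gamma> s t \<and> t < i}"

definition clan_minus :: "clan_symbol list \<Rightarrow> nat \<Rightarrow> nat" where
  "clan_minus \<gamma> i = count_list (take i \<gamma>) Minus + card {(s, t). mates \<gamma> s t \<and> t < i}"

text \<open>In 1-based positions the condition below reads \<open>s \<le> i < j < t\<close>.\<close>

definition clan_cross :: "clan_symbol list \<Rightarrow> nat \<Rightarrow> nat \<Rightarrow> nat" where
  "clan_cross \<gamma> i j = card {(s, t). mates \<gamma> s t \<and> s < i \<and> j \<le> t}"

definition clan_orbit ::
  "nat \<Rightarrow> nat \<Rightarrow> clan_symbol list \<Rightarrow> (nat \<Rightarrow> complex vec set) set" where
  "clan_orbit p q \<gamma> = (let n = p + q in {F \<in> flags n.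
     (\<forall>i. 1 \<le> i \<and> i \<le> n \<longrightarrow>
        cdim n (F i \<inter> E_first n p) = clan_plus \<gamma> i \<and>
        cdim n (F i \<inter> E_last n q) = clan_minus \<gamma> i) \<and>
     (\<forall>i j. 1 \<le> i \<and> i < j \<and> j \<le> n \<longrightarrow>
        cdim n (LinearCombinations.module.submodule_sum (cspace n)
            (proj_first n p ` F i) (F j)) = j + clan_cross \<gamma> i j)})"

text \<open>The sets \<open>\<gamma>\<^sub>+\<close> and \<open>\<gamma>\<^sub>+\<close>-tilde.\<close>

definition gplus :: "clan_symbol list \<Rightarrow> nat set" where
  "gplus \<gamma> = {i. i < length \<gamma> \<and> (\<gamma> ! i = Plus \<or> (\<exists>s. mates \<gamma> s i))}"

definition gplus_tilde :: "clan_symbol list \<Rightarrow> nat set" where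
  "gplus_tilde \<gamma> = {i. i < length \<gamma> \<and> (\<gamma> ! i = Plus \<or> (\<exists>t. mates \<gamma> i t))}"

text \<open>
  Values are 0-based, e.g. \<open>u\<close> takes the values \<open>p - 1, \<dots>, 0\<close> on \<open>\<gamma>\<^sub>+\<close>. Outside
  \<open>{..<p + q}\<close> both functions are the identity.
\<close>

definition clan_u :: "nat \<Rightarrow> nat \<Rightarrow> clan_symbol list \<Rightarrow> nat \<Rightarrow> nat" where
  "clan_u p q \<gamma> i =
     (if p + q \<le> i then i
      else if i \<in> gplus \<gamma> then p - 1 - card {j \<in> gplus \<gamma>. j < i}
      else p + q - 1 - card {j. j \<notin> gplus \<gamma> \<and> j < i})"

definition clan_v :: "nat \<Rightarrow> nat \<Rightarrow> clan_symbol list \<Rightarrow> nat \<Rightarrow> nat" where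
  "clan_v p q \<gamma> i =
     (if p + q \<le> i then i
      else if i \<in> gplus_tilde \<gamma> then card {j \<in> gplus_tilde \<gamma>. j < i}
      else p + card {j. j \<notin> gplus_tilde \<gamma> \<and> j < i})"

end

theory Submission
  imports Defs "Jordan_Normal_Form.DL_Rank"
begin

text \<open>
  Write \<open>E\<close> and \<open>E'\<close> for the spans of the first \<open>p\<close> and of the last \<open>q\<close> basis vectors. The
  permutation \<open>u\<close> of a clan is the largest element of its coset modulo the permutations that
  preserve \<open>{..<p}\<close>. Therefore the Schubert variety of \<open>u\<close> is stable under the stabilizer of
  \<open>E\<close>, and it is cut out by lower bounds for the dimensions of \<open>F i \<inter> E\<close> alone
  (\<open>schubert_coset_max\<close>). Dually, the opposite Schubert variety of \<open>v\<close> is cut out by lower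
  bounds for the dimensions of \<open>F i \<inter> E'\<close> (\<open>opp_schubert_coset_max\<close>). The bounds are the numbers
  that the orbit prescribes for these dimensions (\<open>richardson_eq\<close>), so the orbit is contained in
  the Richardson variety, which is closed. It remains to see that the orbit is dense in it.

  Density comes from a linear parametrization (\<open>incidence_subset_closure\<close>). A flag \<open>gB\<close> satisfies
  the lower bounds iff \<open>E\<close> and \<open>E'\<close> have bases whose vectors lie in prescribed members of the
  flag. If these vectors are the columns of \<open>N\<close>, this says that the invertible matrix
  \<open>M = g\<^sup>-\<^sup>1 N\<close> has zeros at prescribed places, which is a linear condition on \<open>M\<close>; conversely every
  such \<open>M\<close> gives back the flag \<open>N M\<^sup>-\<^sup>1 B\<close>. So two flags that satisfy the bounds are joined by the
  image of a line, and this becomes a polynomial curve of matrices when the inverse is replaced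
  by the adjugate. A closed set that misses one end of the curve meets it in finitely many
  points only, because a polynomial in one variable has finitely many zeros. Hence, if a single
  suitable flag avoids a closed set \<open>Z\<close>, every flag that satisfies the bounds is in the closure of
  those that avoid \<open>Z\<close>. The same argument, with bounds for \<open>E\<close> only, shows that the
  Bruhat cell of \<open>u\<close> is dense in the set that the rank conditions define.

  For the orbit, \<open>Z\<close> consists of the flags where one of the intersections with \<open>E\<close> or \<open>E'\<close> is too
  large or one of the sums \<open>\<pi> (F i) + F j\<close> is too small. An explicit flag read off from the clan
  avoids \<open>Z\<close> (\<open>standard_flag\<close>). Outside \<open>Z\<close> all dimensions are the prescribed ones, provided that
  the sums cannot be too large either. This is the point where the pattern matters: if no two arcs
  of the clan cross, the upper bounds for the sums follow from the lower bounds for the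
  intersections (\<open>cdim_proj_sum_le_cross\<close>).

  The Bruhat relation \<open>v \<le> u\<close> is a separate combinatorial statement (\<open>bruhat_le_coset_max\<close>).
\<close>

section \<open>Subspaces of complex n-space and their dimensions\<close>

abbreviation cindep :: "nat \<Rightarrow> complex vec set \<Rightarrow> bool" where
  "cindep n X \<equiv> \<not> LinearCombinations.module.lin_dep class_ring (cspace n) X"

lemma csubspace_iff:
  "csubspace n W \<longleftrightarrow> W \<subseteq> carrier_vec n \<and> 0\<^sub>v n \<in> W \<and>
     (\<forall>x\<in>W. \<forall>y\<in>W. x + y \<in> W) \<and> (\<forall>c. \<forall>x\<in>W. c \<cdot>\<^sub>v x \<in> W)"
proof -
  interpret vec_space "TYPE(complex)" n .
  show ?thesis
    using vec_vs[where ?'a=complex, of n] vec_module[where ?'a=complex, of n]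
    unfolding VectorSpace.subspace_def submodule_def
    by (auto simp: module_vec_simps)
qed

lemma csubspace_carrier: "csubspace n W \<Longrightarrow> W \<subseteq> carrier_vec n"
  and csubspace_zero: "csubspace n W \<Longrightarrow> 0\<^sub>v n \<in> W"
  and csubspace_add: "csubspace n W \<Longrightarrow> x \<in> W \<Longrightarrow> y \<in> W \<Longrightarrow> x + y \<in> W"
  and csubspace_smult: "csubspace n W \<Longrightarrow> x \<in> W \<Longrightarrow> c \<cdot>\<^sub>v x \<in> W"
  by (simp_all add: csubspace_iff)

lemma csubspace_diff:
  assumes "csubspace n W" "x \<in> W" "y \<in> W"
  shows "x - y \<in> W"
proof -
  have "x - y = x + (- 1) \<cdot>\<^sub>v y"
    using assms csubspace_carrier[OF assms(1)] by (intro eq_vecI) (auto simp: subset_iff dest!: carrier_vecD)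
  then show ?thesis using assms by (simp add: csubspace_add csubspace_smult)
qed

lemma csubspace_Int: "csubspace n U \<Longrightarrow> csubspace n W \<Longrightarrow> csubspace n (U \<inter> W)"
  by (auto simp: csubspace_iff)

lemma csubspace_carrier_vec: "csubspace n (carrier_vec n)"
  by (auto simp: csubspace_iff)

lemma csubspace_cspan: "X \<subseteq> carrier_vec n \<Longrightarrow> csubspace n (cspan n X)"
proof -
  interpret vec_space "TYPE(complex)" n .
  show "X \<subseteq> carrier_vec n \<Longrightarrow> csubspace n (cspan n X)" by (rule span_is_subspace)
qed

lemma cspan_superset: "X \<subseteq> carrier_vec n \<Longrightarrow> X \<subseteq> cspan n X"
proof -
  interpret vec_space "TYPE(complex)" n .
  show "X \<subseteq> carrier_vec n \<Longrightarrow> X \<subseteq> cspan n X" by (rule in_own_span)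
qed

lemma cspan_carrier: "X \<subseteq> carrier_vec n \<Longrightarrow> cspan n X \<subseteq> carrier_vec n"
  by (rule csubspace_carrier[OF csubspace_cspan])

lemma cspan_minimal: "csubspace n W \<Longrightarrow> X \<subseteq> W \<Longrightarrow> cspan n X \<subseteq> W"
proof -
  interpret vec_space "TYPE(complex)" n .
  show "csubspace n W \<Longrightarrow> X \<subseteq> W \<Longrightarrow> cspan n X \<subseteq> W" by (rule span_is_subset) simp_all
qed

lemma cspan_mono: "X \<subseteq> Y \<Longrightarrow> cspan n X \<subseteq> cspan n Y"
proof -
  interpret vec_space "TYPE(complex)" n .
  show "X \<subseteq> Y \<Longrightarrow> cspan n X \<subseteq> cspan n Y" by (rule span_is_monotone)
qed

lemma cspan_csubspace: "csubspace n W \<Longrightarrow> cspan n W = W"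
  by (meson antisym cspan_minimal cspan_superset csubspace_carrier order_refl)

lemma cspan_eqI:
  assumes "csubspace n W" "X \<subseteq> W" "W \<subseteq> cspan n X"
  shows "cspan n X = W"
  using assms cspan_minimal by blast

lemma cspan_Un_cspan:
  assumes "X \<subseteq> carrier_vec n" "Y \<subseteq> carrier_vec n"
  shows "cspan n (cspan n X \<union> cspan n Y) = cspan n (X \<union> Y)"
proof (rule cspan_eqI)
  show "csubspace n (cspan n (X \<union> Y))" using assms by (intro csubspace_cspan) auto
  show "cspan n X \<union> cspan n Y \<subseteq> cspan n (X \<union> Y)"
    using cspan_mono[of X "X \<union> Y" n] cspan_mono[of Y "X \<union> Y" n] by auto
  show "cspan n (X \<union> Y) \<subseteq> cspan n (cspan n X \<union> cspan n Y)"
    using cspan_superset[OF assms(1)] cspan_superset[OF assms(2)] by (intro cspan_mono) auto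
qed

lemma cindep_subset: "cindep n X \<Longrightarrow> Y \<subseteq> X \<Longrightarrow> cindep n Y"
proof -
  interpret vec_space "TYPE(complex)" n .
  show "cindep n X \<Longrightarrow> Y \<subseteq> X \<Longrightarrow> cindep n Y" by (rule subset_li_is_li)
qed

lemma cindep_insert:
  "cindep n X \<Longrightarrow> X \<subseteq> carrier_vec n \<Longrightarrow> v \<in> carrier_vec n \<Longrightarrow> v \<notin> cspan n X
     \<Longrightarrow> cindep n (insert v X)"
proof -
  interpret vec_space "TYPE(complex)" n .
  assume *: "cindep n X" "X \<subseteq> carrier_vec n" "v \<in> carrier_vec n" "v \<notin> cspan n X"
  then have "v \<notin> X" using in_own_span by auto
  with * show "cindep n (insert v X)" using lin_dep_iff_in_span[of X v] by simp
qed

lemma cindep_empty: "cindep n {}"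
proof -
  interpret vec_space "TYPE(complex)" n .
  show ?thesis unfolding lin_dep_def by auto
qed

lemma cindep_finite: "cindep n X \<Longrightarrow> X \<subseteq> carrier_vec n \<Longrightarrow> finite X"
  and cindep_card_le: "cindep n X \<Longrightarrow> X \<subseteq> carrier_vec n \<Longrightarrow> card X \<le> n"
proof -
  interpret vec_space "TYPE(complex)" n .
  show "cindep n X \<Longrightarrow> X \<subseteq> carrier_vec n \<Longrightarrow> finite X"
    and "cindep n X \<Longrightarrow> X \<subseteq> carrier_vec n \<Longrightarrow> card X \<le> n"
    using li_le_dim[of X] by (simp_all add: dim_is_n)
qed

lemma cindep_card_le_cspan:
  assumes "cindep n X" "finite X" "finite Y" "Y \<subseteq> carrier_vec n" "X \<subseteq> cspan n Y"
  shows "card X \<le> card Y"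
proof -
  interpret vec_space "TYPE(complex)" n .
  show ?thesis using replacement[of X Y] assms by auto
qed

lemma cdim_eq_card:
  assumes B: "cindep n B" "B \<subseteq> carrier_vec n" and W: "cspan n B = W"
  shows "cdim n W = card B"
proof -
  interpret vec_space "TYPE(complex)" n .
  have sub: "csubspace n W" using csubspace_cspan[OF B(2)] W by simp
  have BW: "B \<subseteq> W" using cspan_superset[OF B(2)] W by simp
  interpret W: vectorspace class_ring "vs W" using subspace_is_vs[OF sub] .
  have sm: "submodule class_ring W V" using sub by simp
  have "W.basis B"
    unfolding W.basis_def using span_li_not_depend[OF BW sm] B W BW by simp
  then show ?thesis using W.dim_basis cindep_finite[OF B] by blast
qed

lemma cbasis_between:
  assumes S: "S \<subseteq> carrier_vec n" and X: "X \<subseteq> S" "cindep n X"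
  obtains B where "X \<subseteq> B" "B \<subseteq> S" "finite B" "cindep n B" "cspan n B = cspan n S"
    "card B = cdim n (cspan n S)"
proof -
  interpret vec_space "TYPE(complex)" n .
  let ?P = "\<lambda>B. X \<subseteq> B \<and> B \<subseteq> S \<and> cindep n B"
  have "\<exists>B. finite B \<and> maximal B ?P"
  proof (rule maximal_exists)
    show "?P X" using X by simp
    show "finite A \<and> card A \<le> n" if "?P A" for A
      using that cindep_finite[of n A] cindep_card_le[of n A] S by auto
  qed
  then obtain B where B: "finite B" "?P B" and max: "\<And>C. C \<supseteq> B \<Longrightarrow> ?P C \<Longrightarrow> C = B"
    unfolding maximal_def by auto
  have "S \<subseteq> cspan n B"
  proof
    fix v assume v: "v \<in> S"
    show "v \<in> cspan n B"
    proof (rule ccontr)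
      assume nv: "v \<notin> cspan n B"
      then have "cindep n (insert v B)" using B(2) S v by (intro cindep_insert) auto
      then have "insert v B = B" using v B(2) by (intro max) auto
      then have "v \<in> B" by blast
      then have "v \<in> cspan n B" using cspan_superset[of B n] B(2) S by blast
      with nv show False ..
    qed
  qed
  then have sp: "cspan n B = cspan n S"
    using B(2) S by (meson antisym cspan_minimal cspan_mono csubspace_cspan subset_trans)
  have "B \<subseteq> carrier_vec n" using B(2) S by auto
  then have "cdim n (cspan n S) = card B" using cdim_eq_card B(2) sp by blast
  then show ?thesis using that[of B] B sp by simp
qed

lemma cbasis_in:
  assumes S: "S \<subseteq> carrier_vec n"
  obtains B where "B \<subseteq> S" "finite B" "cindep n B" "cspan n B = cspan n S"
    "card B = cdim n (cspan n S)"
  using cbasis_between[OF S empty_subsetI cindep_empty] .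

lemma cbasis_exists:
  assumes "csubspace n W"
  obtains B where "B \<subseteq> W" "finite B" "cindep n B" "cspan n B = W" "card B = cdim n W"
proof -
  have W: "W \<subseteq> carrier_vec n" "cspan n W = W"
    using assms csubspace_carrier cspan_csubspace by auto
  obtain B where "B \<subseteq> W" "finite B" "cindep n B" "cspan n B = cspan n W"
      "card B = cdim n (cspan n W)"
    using cbasis_in[OF W(1)] .
  then show ?thesis using that[of B] W(2) by simp
qed

lemma cindep_card_le_cdim:
  assumes "csubspace n W" "cindep n X" "X \<subseteq> W"
  shows "card X \<le> cdim n W"
proof -
  obtain B where B: "B \<subseteq> W" "finite B" "cindep n B" "cspan n B = W" "card B = cdim n W"
    using cbasis_exists[OF assms(1)] .
  have W: "W \<subseteq> carrier_vec n" using assms(1) csubspace_carrier by blast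
  have "card X \<le> card B"
    using assms B W by (intro cindep_card_le_cspan[of n]) (auto intro: cindep_finite)
  then show ?thesis using B by simp
qed

lemma cdim_cspan_le:
  assumes "finite X" "X \<subseteq> carrier_vec n"
  shows "cdim n (cspan n X) \<le> card X"
proof -
  obtain B where "B \<subseteq> X" "finite B" "cindep n B" "cspan n B = cspan n X" "card B = cdim n (cspan n X)"
    using cbasis_in[OF assms(2)] .
  then show ?thesis using card_mono[OF assms(1), of B] by simp
qed

lemma cdim_carrier_vec: "cdim n (carrier_vec n) = n"
proof -
  interpret vec_space "TYPE(complex)" n .
  have "cindep n (set (unit_vecs n))" "cspan n (set (unit_vecs n)) = carrier_vec n"
    using unit_vecs_basis unfolding basis_def by simp_all
  moreover have "card (set (unit_vecs n) :: complex vec set) = n"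
    using distinct_card[OF unit_vecs_distinct] by simp
  moreover have "set (unit_vecs n) \<subseteq> (carrier_vec n :: complex vec set)"
    by (rule unit_vecs_carrier)
  ultimately show ?thesis
    using cdim_eq_card[of n "set (unit_vecs n)" "carrier_vec n"] by simp
qed

lemma cdim_mono:
  assumes "csubspace n U" "csubspace n W" "U \<subseteq> W"
  shows "cdim n U \<le> cdim n W"
proof -
  obtain B where "B \<subseteq> U" "finite B" "cindep n B" "cspan n B = U" "card B = cdim n U"
    using cbasis_exists[OF assms(1)] .
  then show ?thesis using cindep_card_le_cdim[OF assms(2), of B] assms(3) by auto
qed

lemma csubspace_eqI:
  assumes "csubspace n U" "csubspace n W" "U \<subseteq> W" "cdim n W \<le> cdim n U"
  shows "U = W"
proof (rule ccontr)
  assume "U \<noteq> W"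
  then obtain v where v: "v \<in> W" "v \<notin> U" using assms(3) by auto
  obtain B where B: "B \<subseteq> U" "finite B" "cindep n B" "cspan n B = U" "card B = cdim n U"
    using cbasis_exists[OF assms(1)] .
  have W: "W \<subseteq> carrier_vec n" using assms(2) csubspace_carrier by blast
  have "cindep n (insert v B)" using B v W assms(3) by (intro cindep_insert) auto
  then have "card (insert v B) \<le> cdim n W"
    using B v assms by (intro cindep_card_le_cdim) auto
  moreover have "v \<notin> B" using B v by auto
  ultimately show False using B assms(4) by simp
qed

lemma cspan_eq_if_card_ge_cdim:
  assumes W: "csubspace n W" and X: "X \<subseteq> W" "cindep n X" "cdim n W \<le> card X"
  shows "cspan n X = W"
proof (rule csubspace_eqI)
  have C: "X \<subseteq> carrier_vec n" using X(1) csubspace_carrier[OF W] by auto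
  then show "csubspace n (cspan n X)" by (rule csubspace_cspan)
  show "cspan n X \<subseteq> W" using cspan_minimal[OF W X(1)] .
  show "cdim n W \<le> cdim n (cspan n X)" using cdim_eq_card[OF X(2) C refl] X(3) by simp
qed (rule W)

lemma cspan_Un_eq_sums:
  assumes "csubspace n U" "csubspace n W"
  shows "cspan n (U \<union> W) = {u + w | u w. u \<in> U \<and> w \<in> W}" (is "_ = ?S")
proof (rule cspan_eqI)
  have C: "U \<subseteq> carrier_vec n" "W \<subseteq> carrier_vec n" using assms csubspace_carrier by auto
  show "U \<union> W \<subseteq> ?S"
  proof
    fix x assume "x \<in> U \<union> W"
    then consider "x \<in> U" | "x \<in> W" by auto
    then show "x \<in> ?S"
    proof cases
      case 1
      then have "x = x + 0\<^sub>v n" using C by auto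
      then show ?thesis using 1 csubspace_zero[OF assms(2)] by blast
    next
      case 2
      then have "x = 0\<^sub>v n + x" using C by auto
      then show ?thesis using 2 csubspace_zero[OF assms(1)] by blast
    qed
  qed
  show "csubspace n ?S"
    unfolding csubspace_iff
  proof (intro conjI ballI allI)
    show "?S \<subseteq> carrier_vec n" using C by (auto simp: subset_iff intro!: add_carrier_vec)
    show "0\<^sub>v n \<in> ?S" using \<open>U \<union> W \<subseteq> ?S\<close> csubspace_zero[OF assms(1)] by blast
    show "x + y \<in> ?S" if "x \<in> ?S" "y \<in> ?S" for x y
    proof -
      from that obtain u w u' w' where *: "x = u + w" "y = u' + w'" "u \<in> U" "w \<in> W" "u' \<in> U" "w' \<in> W"
        by auto
      from * C have "dim_vec u = n" "dim_vec w = n" "dim_vec u' = n" "dim_vec w' = n" by auto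
      then have "x + y = (u + u') + (w + w')"
        using * by (intro eq_vecI) simp_all
      then show ?thesis using * assms csubspace_add by blast
    qed
    show "c \<cdot>\<^sub>v x \<in> ?S" if "x \<in> ?S" for c x
    proof -
      from that obtain u w where *: "x = u + w" "u \<in> U" "w \<in> W" by auto
      then have "c \<cdot>\<^sub>v x = c \<cdot>\<^sub>v u + c \<cdot>\<^sub>v w" using C by (metis smult_add_distrib_vec subsetD)
      then show ?thesis using * assms csubspace_smult by blast
    qed
  qed
  have "csubspace n (cspan n (U \<union> W))" using C by (intro csubspace_cspan) auto
  moreover have "U \<union> W \<subseteq> cspan n (U \<union> W)" using C by (intro cspan_superset) auto
  ultimately show "?S \<subseteq> cspan n (U \<union> W)"
    by (auto intro!: csubspace_add)
qed

lemma submodule_sum_eq_cspan: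
  assumes "csubspace n U" "csubspace n W"
  shows "LinearCombinations.module.submodule_sum (cspace n) U W = cspan n (U \<union> W)"
proof -
  interpret vec_space "TYPE(complex)" n .
  show ?thesis
    unfolding cspan_Un_eq_sums[OF assms] submodule_sum_def by (auto simp: image_def)
qed

lemma cdim_cspan_Un_le:
  assumes "A \<subseteq> carrier_vec n" "Z \<subseteq> carrier_vec n" "finite Z"
  shows "cdim n (cspan n (A \<union> Z)) \<le> cdim n (cspan n A) + card Z"
proof -
  obtain B where B: "B \<subseteq> A" "finite B" "cindep n B" "cspan n B = cspan n A"
      "card B = cdim n (cspan n A)"
    using cbasis_in[OF assms(1)] .
  have "cspan n (A \<union> Z) = cspan n (cspan n A \<union> cspan n Z)" using cspan_Un_cspan assms by simp
  also have "\<dots> = cspan n (B \<union> Z)" using cspan_Un_cspan[of B n Z] assms B by simp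
  finally have "cdim n (cspan n (A \<union> Z)) \<le> card (B \<union> Z)"
    using cdim_cspan_le[of "B \<union> Z" n] assms B by auto
  also have "\<dots> \<le> card B + card Z" by (rule card_Un_le)
  finally show ?thesis using B by simp
qed

text \<open>
  A basis of \<open>U \<inter> W\<close> extended inside \<open>W\<close> shows that the sum is not too large; a basis of \<open>U\<close>
  extended by vectors of \<open>W\<close> to a basis of the sum shows that the intersection is not too small.
\<close>

lemma cdim_sum_Int:
  assumes U: "csubspace n U" and W: "csubspace n W"
  shows "cdim n (cspan n (U \<union> W)) + cdim n (U \<inter> W) = cdim n U + cdim n W"
proof (rule order.antisym)
  have UC: "U \<subseteq> carrier_vec n" and WC: "W \<subseteq> carrier_vec n" using assms csubspace_carrier by auto
  have I: "csubspace n (U \<inter> W)" using assms by (rule csubspace_Int)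
  obtain B0 where B0: "B0 \<subseteq> U \<inter> W" "finite B0" "cindep n B0" "cspan n B0 = U \<inter> W"
      "card B0 = cdim n (U \<inter> W)"
    using cbasis_exists[OF I] .
  obtain B where B: "B0 \<subseteq> B" "B \<subseteq> W" "finite B" "cindep n B" "cspan n B = W" "card B = cdim n W"
  proof (rule cbasis_between[of W n B0])
    show "W \<subseteq> carrier_vec n" "B0 \<subseteq> W" "cindep n B0" using WC B0 by auto
  qed (simp add: cspan_csubspace[OF W])
  have "cspan n (U \<union> W) = cspan n (U \<union> (B - B0))"
  proof (rule cspan_eqI[symmetric, OF _ _ cspan_minimal])
    show *: "csubspace n (cspan n (U \<union> (B - B0)))"
      using UC WC B by (intro csubspace_cspan) auto
    have 1: "U \<union> (B - B0) \<subseteq> cspan n (U \<union> (B - B0))"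
      using UC WC B by (intro cspan_superset) auto
    then have "B \<subseteq> cspan n (U \<union> (B - B0))" using B0 by auto
    then have "cspan n B \<subseteq> cspan n (U \<union> (B - B0))" by (rule cspan_minimal[OF *])
    with 1 show "U \<union> W \<subseteq> cspan n (U \<union> (B - B0))" using B by auto
    show "csubspace n (cspan n (U \<union> W))" using UC WC by (intro csubspace_cspan) auto
    have "U \<union> W \<subseteq> cspan n (U \<union> W)" using UC WC by (intro cspan_superset) auto
    then show "U \<union> (B - B0) \<subseteq> cspan n (U \<union> W)" using B by auto
  qed
  then have "cdim n (cspan n (U \<union> W)) \<le> cdim n U + card (B - B0)"
    using cdim_cspan_Un_le[of U n "B - B0"] UC WC B(2,3) cspan_csubspace[OF U] by auto
  then show "cdim n (cspan n (U \<union> W)) + cdim n (U \<inter> W) \<le> cdim n U + cdim n W"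
    using B B0 card_Diff_subset[OF B0(2) B(1)] card_mono[OF B(3,1)] by linarith
  obtain D where D: "D \<subseteq> U" "finite D" "cindep n D" "cspan n D = U" "card D = cdim n U"
    using cbasis_exists[OF U] .
  obtain E where E: "D \<subseteq> E" "E \<subseteq> D \<union> W" "finite E" "cindep n E" "cspan n E = cspan n (D \<union> W)"
      "card E = cdim n (cspan n (D \<union> W))"
  proof (rule cbasis_between[of "D \<union> W" n D])
    show "D \<union> W \<subseteq> carrier_vec n" "D \<subseteq> D \<union> W" "cindep n D" using D UC WC by auto
  qed
  have DW: "cspan n (D \<union> W) = cspan n (U \<union> W)"
    using cspan_Un_cspan[of D n W] D UC WC cspan_csubspace[OF W] by auto
  let ?E = "E - D"
  have E': "?E \<subseteq> W" "?E \<subseteq> carrier_vec n" using E WC by auto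
  have "W \<subseteq> cspan n (B0 \<union> ?E)"
  proof
    fix w assume w: "w \<in> W"
    have "w \<in> cspan n (D \<union> ?E)"
    proof -
      have "D \<union> ?E = E" using E by auto
      moreover have "w \<in> cspan n (D \<union> W)" using w cspan_superset[of "D \<union> W" n] D UC WC by auto
      ultimately show ?thesis using E by simp
    qed
    also have "\<dots> = cspan n (U \<union> cspan n ?E)"
      using cspan_Un_cspan[of D n ?E] D UC E' by auto
    also have "\<dots> = {u + e | u e. u \<in> U \<and> e \<in> cspan n ?E}"
      using E' U by (intro cspan_Un_eq_sums csubspace_cspan) auto
    finally obtain u e where ue: "w = u + e" "u \<in> U" "e \<in> cspan n ?E" by auto
    have eW: "e \<in> W" using ue(3) cspan_minimal[OF W E'(1)] by auto
    have "u = w - e" using ue UC WC eW by (intro eq_vecI) (auto simp: subset_iff dest!: carrier_vecD)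
    then have "u \<in> U \<inter> W" using csubspace_diff[OF W w eW] ue by simp
    then have "u \<in> cspan n (B0 \<union> ?E)" using B0 cspan_mono[of B0 "B0 \<union> ?E" n] by auto
    moreover have "e \<in> cspan n (B0 \<union> ?E)" using ue cspan_mono[of ?E "B0 \<union> ?E" n] by auto
    ultimately show "w \<in> cspan n (B0 \<union> ?E)"
      using ue(1) csubspace_add[OF csubspace_cspan, of "B0 \<union> ?E" n] B0 UC E' by auto
  qed
  moreover have s: "csubspace n (cspan n (B0 \<union> ?E))" using B0 UC E' by (intro csubspace_cspan) auto
  ultimately have "cdim n W \<le> cdim n (cspan n (B0 \<union> ?E))" using W by (intro cdim_mono) auto
  also have "\<dots> \<le> card (B0 \<union> ?E)" using B0 UC E' E by (intro cdim_cspan_le) auto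
  also have "\<dots> \<le> card B0 + card ?E" by (rule card_Un_le)
  also have "card ?E = card E - card D" using D E by (simp add: card_Diff_subset)
  finally show "cdim n U + cdim n W \<le> cdim n (cspan n (U \<union> W)) + cdim n (U \<inter> W)"
    using B0 D E DW card_mono[OF E(3,1)] by simp
qed

lemma cdim_Int_ge:
  assumes "csubspace n U" "csubspace n V" "csubspace n W" "U \<subseteq> W" "V \<subseteq> W"
  shows "cdim n U + cdim n V \<le> cdim n (U \<inter> V) + cdim n W"
proof -
  have UV: "U \<union> V \<subseteq> carrier_vec n" using assms csubspace_carrier by blast
  have "cspan n (U \<union> V) \<subseteq> W" using cspan_minimal assms by simp
  then have "cdim n (cspan n (U \<union> V)) \<le> cdim n W"
    using cdim_mono[OF csubspace_cspan[OF UV] assms(3)] by simp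
  then show ?thesis using cdim_sum_Int[OF assms(1,2)] by simp
qed

lemma mult_mat_vec_in_cspan_cols:
  assumes "A \<in> carrier_mat n m" "c \<in> carrier_vec m"
  shows "A *\<^sub>v c \<in> cspan n (col A ` {j. j < m \<and> c $ j \<noteq> 0})"
proof -
  let ?X = "col A ` {j. j < m \<and> c $ j \<noteq> 0}"
  have X: "?X \<subseteq> carrier_vec n" using assms(1) by auto
  have s: "csubspace n (cspan n ?X)" using X by (rule csubspace_cspan)
  have "finite J \<Longrightarrow> J \<subseteq> {..<m} \<Longrightarrow> vec n (\<lambda>i. \<Sum>j\<in>J. A $$ (i, j) * c $ j) \<in> cspan n ?X" for J
  proof (induction J rule: finite_induct)
    case empty
    have "vec n (\<lambda>i. 0 :: complex) = 0\<^sub>v n" by auto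
    then show ?case using csubspace_zero[OF s] by (simp only: sum.empty)
  next
    case (insert k J)
    have "vec n (\<lambda>i. \<Sum>j\<in>insert k J. A $$ (i, j) * c $ j)
        = c $ k \<cdot>\<^sub>v col A k + vec n (\<lambda>i. \<Sum>j\<in>J. A $$ (i, j) * c $ j)"
      using insert assms by (intro eq_vecI) auto
    moreover have "c $ k \<cdot>\<^sub>v col A k \<in> cspan n ?X"
    proof (cases "c $ k = 0")
      case True
      then have "c $ k \<cdot>\<^sub>v col A k = 0\<^sub>v n" using assms insert by (intro eq_vecI) auto
      then show ?thesis using csubspace_zero[OF s] by simp
    next
      case False
      then have "col A k \<in> ?X" using insert by auto
      then show ?thesis using cspan_superset[OF X] s csubspace_smult by blast
    qed
    ultimately show ?case using insert s by (auto intro: csubspace_add)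
  qed
  from this[of "{..<m}"] have "vec n (\<lambda>i. \<Sum>j<m. A $$ (i, j) * c $ j) \<in> cspan n ?X" by simp
  also have "vec n (\<lambda>i. \<Sum>j<m. A $$ (i, j) * c $ j) = A *\<^sub>v c"
    using assms by (intro eq_vecI) (auto simp: scalar_prod_def atLeast0LessThan)
  finally show ?thesis .
qed

text \<open>
  The adjugate solves \<open>A *\<^sub>v c = v\<close> for every \<open>v\<close>, by Cramer's rule.
\<close>

lemma cspan_cols_invertible:
  assumes A: "A \<in> carrier_mat n n" and d: "det A \<noteq> 0"
  shows "cspan n (set (cols A)) = carrier_vec n"
proof (rule antisym)
  show "cspan n (set (cols A)) \<subseteq> carrier_vec n"
    using A cols_dim[of A] by (intro cspan_carrier) auto
  show "carrier_vec n \<subseteq> cspan n (set (cols A))"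
  proof
    fix v :: "complex vec" assume v: "v \<in> carrier_vec n"
    let ?c = "(1 / det A) \<cdot>\<^sub>v (adj_mat A *\<^sub>v v)"
    have c: "?c \<in> carrier_vec n" using adj_mat[OF A] v by auto
    have "A *\<^sub>v ?c = (1 / det A) \<cdot>\<^sub>v ((A * adj_mat A) *\<^sub>v v)"
      using adj_mat(1)[OF A] A v
      by (simp add: mult_mat_vec[of A n n] assoc_mult_mat_vec[of A n n "adj_mat A" n])
    also have "\<dots> = v"
    proof -
      have "(det A \<cdot>\<^sub>m 1\<^sub>m n) *\<^sub>v v = det A \<cdot>\<^sub>v v"
        using v by (intro eq_vecI) (simp_all add: row_smult)
      then show ?thesis using adj_mat(2)[OF A] v d by (simp add: smult_smult_assoc)
    qed
    finally have "v = A *\<^sub>v ?c" by simp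
    also have "\<dots> \<in> cspan n (set (cols A))"
    proof -
      have "col A ` {j. j < n \<and> ?c $ j \<noteq> 0} \<subseteq> set (cols A)" using A by (auto simp: cols_def)
      then show ?thesis using mult_mat_vec_in_cspan_cols[OF A c] cspan_mono by blast
    qed
    finally show "v \<in> cspan n (set (cols A))" .
  qed
qed

lemma cindep_if_card_le_cdim:
  assumes "finite X" "X \<subseteq> carrier_vec n" "card X \<le> cdim n (cspan n X)"
  shows "cindep n X"
proof -
  obtain B where B: "B \<subseteq> X" "finite B" "cindep n B" "cspan n B = cspan n X"
      "card B = cdim n (cspan n X)"
    using cbasis_in[OF assms(2)] .
  then have "B = X" using assms card_subset_eq[of X B] card_mono[of X B] by auto
  then show ?thesis using B by simp
qed

lemma det_nonzero_if_cindep: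
  assumes "length xs = n" "distinct xs" "set xs \<subseteq> carrier_vec n" "cindep n (set xs)"
  shows "det (mat_of_cols n xs) \<noteq> 0"
proof -
  interpret vec_space "TYPE(complex)" n .
  have A: "mat_of_cols n xs \<in> carrier_mat n n" using assms by auto
  have c: "cols (mat_of_cols n xs) = xs" using assms by (simp add: cols_mat_of_cols)
  show ?thesis
    using lin_indpt_full_rank[OF A] c assms det_rank_iff[OF A] by simp
qed

section \<open>Invertible matrices and flags\<close>

lemma GL_iff: "g \<in> GL n \<longleftrightarrow> g \<in> carrier_mat n n \<and> det g \<noteq> 0"
proof (intro iffI conjI)
  assume g: "g \<in> GL n"
  then show c: "g \<in> carrier_mat n n" by (simp add: GL_def)
  from g obtain B where B: "inverts_mat g B" "inverts_mat B g"
    by (auto simp: GL_def invertible_mat_def)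
  then have gB: "g * B = 1\<^sub>m n" and Bg: "B * g = 1\<^sub>m (dim_row B)"
    using c by (auto simp: inverts_mat_def)
  have "dim_col B = n" using arg_cong[OF gB, of dim_col] by simp
  moreover have "dim_row B = n" using arg_cong[OF Bg, of dim_col] c by simp
  ultimately have "B \<in> carrier_mat n n" by auto
  with gB c have "det g * det B = 1" using det_mult[of g n B] by simp
  then show "det g \<noteq> 0" by auto
next
  assume g: "g \<in> carrier_mat n n \<and> det g \<noteq> 0"
  let ?h = "(1 / det g) \<cdot>\<^sub>m adj_mat g"
  have "inverts_mat g ?h" "inverts_mat ?h g"
    using g adj_mat[of g n] by (auto simp: inverts_mat_def mult_smult_distrib mult_smult_assoc_mat)
  then show "g \<in> GL n" using g by (auto simp: GL_def invertible_mat_def)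
qed

lemma GL_carrier: "g \<in> GL n \<Longrightarrow> g \<in> carrier_mat n n"
  by (simp add: GL_def)

lemma GL_mult: "g \<in> GL n \<Longrightarrow> h \<in> GL n \<Longrightarrow> g * h \<in> GL n"
  by (auto simp: GL_iff det_mult)

lemma GL_one: "1\<^sub>m n \<in> GL n"
  by (simp add: GL_iff)

lemma GL_inverse:
  assumes "g \<in> GL n"
  obtains h where "h \<in> GL n" "g * h = 1\<^sub>m n" "h * g = 1\<^sub>m n"
proof -
  let ?h = "(1 / det g) \<cdot>\<^sub>m adj_mat g"
  have h: "?h \<in> carrier_mat n n" "g * ?h = 1\<^sub>m n" "?h * g = 1\<^sub>m n"
    using assms adj_mat[of g n] by (auto simp: GL_iff mult_smult_distrib mult_smult_assoc_mat)
  then have "det g * det ?h = 1" using assms det_mult[of g n ?h] by (simp add: GL_iff)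
  then have "?h \<in> GL n" using h by (auto simp: GL_iff)
  then show ?thesis using that h by blast
qed

lemma col_carrier: "A \<in> carrier_mat n m \<Longrightarrow> col A k \<in> carrier_vec n"
  by (intro carrier_vecI) simp

lemma mult_mat_vec_unit:
  "A \<in> carrier_mat n m \<Longrightarrow> k < m \<Longrightarrow> A *\<^sub>v unit_vec m k = (col A k :: complex vec)"
  by (intro eq_vecI) auto

lemma mult_mat_vec_zero: "A \<in> carrier_mat n m \<Longrightarrow> A *\<^sub>v 0\<^sub>v m = (0\<^sub>v n :: complex vec)"
  by (intro eq_vecI) auto

lemma csubspace_image:
  assumes A: "A \<in> carrier_mat n m" and W: "csubspace m W"
  shows "csubspace n ((*\<^sub>v) A ` W)"
  unfolding csubspace_iff
proof (intro conjI ballI allI)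
  have C: "W \<subseteq> carrier_vec m" using W csubspace_carrier by blast
  show "(*\<^sub>v) A ` W \<subseteq> carrier_vec n" using A C by auto
  show "0\<^sub>v n \<in> (*\<^sub>v) A ` W"
    using csubspace_zero[OF W] mult_mat_vec_zero[OF A] by (metis imageI)
  show "x + y \<in> (*\<^sub>v) A ` W" if x: "x \<in> (*\<^sub>v) A ` W" and y: "y \<in> (*\<^sub>v) A ` W" for x y
  proof -
    from x obtain x' where x': "x' \<in> W" "x = A *\<^sub>v x'" by auto
    from y obtain y' where y': "y' \<in> W" "y = A *\<^sub>v y'" by auto
    have "x + y = A *\<^sub>v (x' + y')" 
      using x' y' C mult_add_distrib_mat_vec[OF A, of x' y'] by (simp add: subset_iff)
    then show ?thesis using csubspace_add[OF W x'(1) y'(1)] by simp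
  qed
  show "c \<cdot>\<^sub>v x \<in> (*\<^sub>v) A ` W" if x: "x \<in> (*\<^sub>v) A ` W" for c x
  proof -
    from x obtain x' where x': "x' \<in> W" "x = A *\<^sub>v x'" by auto
    have "c \<cdot>\<^sub>v x = A *\<^sub>v (c \<cdot>\<^sub>v x')" using x' C mult_mat_vec[OF A] by auto
    then show ?thesis using csubspace_smult[OF W x'(1)] by simp
  qed
qed

lemma csubspace_vimage:
  assumes A: "A \<in> carrier_mat n m" and W: "csubspace n W"
  shows "csubspace m {x \<in> carrier_vec m. A *\<^sub>v x \<in> W}"
  unfolding csubspace_iff
proof (intro conjI ballI allI)
  show "0\<^sub>v m \<in> {x \<in> carrier_vec m. A *\<^sub>v x \<in> W}"
    using csubspace_zero[OF W] mult_mat_vec_zero[OF A] by simp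
qed (use csubspace_add[OF W] csubspace_smult[OF W] mult_add_distrib_mat_vec[OF A]
      mult_mat_vec[OF A] in auto)

lemma cspan_image:
  assumes A: "A \<in> carrier_mat n m" and X: "X \<subseteq> carrier_vec m"
  shows "cspan n ((*\<^sub>v) A ` X) = (*\<^sub>v) A ` cspan m X"
proof (rule cspan_eqI)
  show "csubspace n ((*\<^sub>v) A ` cspan m X)" using csubspace_image[OF A csubspace_cspan[OF X]] .
  show "(*\<^sub>v) A ` X \<subseteq> (*\<^sub>v) A ` cspan m X" using cspan_superset[OF X] by auto
  have AX: "(*\<^sub>v) A ` X \<subseteq> carrier_vec n" using A X by auto
  have "csubspace m {x \<in> carrier_vec m. A *\<^sub>v x \<in> cspan n ((*\<^sub>v) A ` X)}"
    using AX by (intro csubspace_vimage[OF A] csubspace_cspan)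
  moreover have "X \<subseteq> {x \<in> carrier_vec m. A *\<^sub>v x \<in> cspan n ((*\<^sub>v) A ` X)}"
    using X cspan_superset[OF AX] by auto
  ultimately have "cspan m X \<subseteq> {x \<in> carrier_vec m. A *\<^sub>v x \<in> cspan n ((*\<^sub>v) A ` X)}"
    by (rule cspan_minimal)
  then show "(*\<^sub>v) A ` cspan m X \<subseteq> cspan n ((*\<^sub>v) A ` X)" by auto
qed

lemma cdim_image_le:
  assumes A: "A \<in> carrier_mat n m" and W: "csubspace m W"
  shows "cdim n ((*\<^sub>v) A ` W) \<le> cdim m W"
proof -
  obtain B where B: "B \<subseteq> W" "finite B" "cindep m B" "cspan m B = W" "card B = cdim m W"
    using cbasis_exists[OF W] .
  have C: "B \<subseteq> carrier_vec m" using B(1) csubspace_carrier[OF W] by auto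
  have "cdim n ((*\<^sub>v) A ` W) = cdim n (cspan n ((*\<^sub>v) A ` B))" using cspan_image[OF A C] B by simp
  also have "\<dots> \<le> card ((*\<^sub>v) A ` B)" using A B C by (intro cdim_cspan_le) auto
  also have "\<dots> \<le> card B" using B by (intro card_image_le)
  finally show ?thesis using B by simp
qed

lemma GL_image_image:
  fixes g h :: "complex mat"
  assumes "g \<in> carrier_mat n n" "h \<in> carrier_mat n n" "h * g = 1\<^sub>m n" "W \<subseteq> carrier_vec n"
  shows "(*\<^sub>v) h ` (*\<^sub>v) g ` W = W"
proof -
  have "h *\<^sub>v (g *\<^sub>v x) = x" if "x \<in> W" for x
  proof -
    have "x \<in> carrier_vec n" using assms(4) that by auto
    then show ?thesis using assoc_mult_mat_vec[OF assms(2,1), of x] assms(3) by simp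
  qed
  then show ?thesis unfolding image_image by simp
qed

lemma cdim_image:
  assumes g: "g \<in> GL n" and W: "csubspace n W"
  shows "cdim n ((*\<^sub>v) g ` W) = cdim n W"
proof (rule antisym)
  have c: "g \<in> carrier_mat n n" using g GL_carrier by blast
  show "cdim n ((*\<^sub>v) g ` W) \<le> cdim n W" using cdim_image_le[OF c W] .
  obtain h where h: "h \<in> GL n" "h * g = 1\<^sub>m n" using GL_inverse[OF g] .
  then show "cdim n W \<le> cdim n ((*\<^sub>v) g ` W)"
    using cdim_image_le[OF GL_carrier[OF h(1)] csubspace_image[OF c W]]
      GL_image_image[OF c GL_carrier[OF h(1)] h(2) csubspace_carrier[OF W]] by simp
qed

text \<open>
  A generating family of \<open>n\<close> vectors leaves no room for repetitions or linear relations.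
\<close>

lemma cspan_image_columns:
  assumes "\<And>k. k < n \<Longrightarrow> x k \<in> carrier_vec n" "cspan n (x ` {..<n}) = carrier_vec n"
  shows "inj_on x {..<n}" "cindep n (x ` {..<n})"
proof -
  have C: "x ` {..<n} \<subseteq> carrier_vec n" using assms(1) by auto
  have "n \<le> card (x ` {..<n})"
    using cdim_cspan_le[of "x ` {..<n}" n] C assms(2) cdim_carrier_vec by simp
  moreover have "card (x ` {..<n}) \<le> n" using card_image_le[of "{..<n}" x] by simp
  ultimately have e: "card (x ` {..<n}) = n" by simp
  then show "inj_on x {..<n}" by (intro eq_card_imp_inj_on) auto
  show "cindep n (x ` {..<n})"
    using e C assms(2) cdim_carrier_vec by (intro cindep_if_card_le_cdim) auto
qed

lemma GL_of_independent_columns: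
  assumes "\<And>k. k < n \<Longrightarrow> x k \<in> carrier_vec n" "inj_on x {..<n}" "cindep n (x ` {..<n})"
  obtains g where "g \<in> GL n" "\<And>k. k < n \<Longrightarrow> col g k = x k"
proof -
  let ?xs = "map x [0..<n]"
  have s: "set ?xs = x ` {..<n}" by auto
  have "det (mat_of_cols n ?xs) \<noteq> 0"
    using assms by (intro det_nonzero_if_cindep) (auto simp: s distinct_map atLeast0LessThan)
  moreover have "mat_of_cols n ?xs \<in> carrier_mat n n" by auto
  moreover have "col (mat_of_cols n ?xs) k = x k" if "k < n" for k
    using that assms(1) by (subst col_mat_of_cols) auto
  ultimately show ?thesis using that by (auto simp: GL_iff)
qed

lemma GL_of_spanning_columns:
  assumes "\<And>k. k < n \<Longrightarrow> x k \<in> carrier_vec n" "cspan n (x ` {..<n}) = carrier_vec n"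
  obtains g where "g \<in> GL n" "\<And>k. k < n \<Longrightarrow> col g k = x k"
  using GL_of_independent_columns[of n x] cspan_image_columns[of n x] assms by blast

lemma set_take_cols:
  "g \<in> carrier_mat n m \<Longrightarrow> i \<le> m \<Longrightarrow> set (take i (cols g)) = col g ` {..<i}"
  by (auto simp: cols_def take_map)

lemma set_cols: "g \<in> carrier_mat n m \<Longrightarrow> set (cols g) = col g ` {..<m}"
  by (auto simp: cols_def)

lemma GL_columns:
  assumes "g \<in> GL n"
  shows "inj_on (col g) {..<n}" "cindep n (col g ` {..<n})" "cspan n (col g ` {..<n}) = carrier_vec n"
proof -
  have c: "g \<in> carrier_mat n n" "det g \<noteq> 0" using assms by (auto simp: GL_iff)
  show s: "cspan n (col g ` {..<n}) = carrier_vec n"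
    using cspan_cols_invertible[OF c] set_cols[OF c(1)] by simp
  show "inj_on (col g) {..<n}" "cindep n (col g ` {..<n})"
    using cspan_image_columns[of n "col g"] s c by auto
qed

lemma flag_of_eq: "g \<in> carrier_mat n n \<Longrightarrow> i \<le> n \<Longrightarrow> flag_of n g i = cspan n (col g ` {..<i})"
  by (simp add: flag_of_def set_take_cols)

lemma csubspace_supported_vectors:
  "csubspace n {c \<in> carrier_vec n. \<forall>r<n. P r \<longrightarrow> c $ r = 0}"
  by (auto simp: csubspace_iff)

lemma mult_mat_vec_supported:
  assumes A: "A \<in> carrier_mat n m" and P: "\<And>r. P r \<Longrightarrow> r < m"
  shows "cspan n (col A ` {r. P r}) = (*\<^sub>v) A ` {c \<in> carrier_vec m. \<forall>r<m. \<not> P r \<longrightarrow> c $ r = 0}"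
    (is "_ = _ ` ?S")
proof (rule cspan_eqI)
  show "csubspace n ((*\<^sub>v) A ` ?S)"
    using csubspace_image[OF A csubspace_supported_vectors] .
  show "col A ` {r. P r} \<subseteq> (*\<^sub>v) A ` ?S"
  proof
    fix v assume "v \<in> col A ` {r. P r}"
    then obtain r where r: "P r" "v = A *\<^sub>v unit_vec m r" "r < m"
      using P mult_mat_vec_unit[OF A] by fastforce
    have "unit_vec m r \<in> ?S" using r by (auto simp: unit_vec_def)
    then show "v \<in> (*\<^sub>v) A ` ?S" using r by blast
  qed
  show "(*\<^sub>v) A ` ?S \<subseteq> cspan n (col A ` {r. P r})"
  proof
    fix v assume "v \<in> (*\<^sub>v) A ` ?S"
    then obtain c where c: "c \<in> carrier_vec m" "\<And>r. r < m \<Longrightarrow> \<not> P r \<Longrightarrow> c $ r = 0" "v = A *\<^sub>v c" by auto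
    have "col A ` {j. j < m \<and> c $ j \<noteq> 0} \<subseteq> col A ` {r. P r}" using c(2) by auto
    then show "v \<in> cspan n (col A ` {r. P r})"
      using mult_mat_vec_in_cspan_cols[OF A c(1)] c(3) cspan_mono by blast
  qed
qed

lemma mem_flag_of_iff:
  assumes "g \<in> carrier_mat n n" "i \<le> n"
  shows "x \<in> flag_of n g i \<longleftrightarrow>
    (\<exists>c\<in>carrier_vec n. (\<forall>r<n. i \<le> r \<longrightarrow> c $ r = 0) \<and> x = g *\<^sub>v c)"
proof -
  have "flag_of n g i = (*\<^sub>v) g ` {c \<in> carrier_vec n. \<forall>r<n. \<not> r < i \<longrightarrow> c $ r = 0}"
    using flag_of_eq[OF assms] mult_mat_vec_supported[OF assms(1), of "\<lambda>r. r < i"] assms(2)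
    by (simp add: lessThan_def)
  then show ?thesis by (auto simp: not_less)
qed

lemma csubspace_flag_of: "g \<in> carrier_mat n n \<Longrightarrow> i \<le> n \<Longrightarrow> csubspace n (flag_of n g i)"
  by (auto simp: flag_of_eq intro!: csubspace_cspan)

lemma cdim_flag_of:
  assumes "g \<in> GL n" "i \<le> n"
  shows "cdim n (flag_of n g i) = i"
proof -
  have sub: "{..<i} \<subseteq> {..<n}" using assms(2) by auto
  have "cindep n (col g ` {..<i})"
    using cindep_subset[OF GL_columns(2)[OF assms(1)] image_mono[OF sub]] .
  then have "cdim n (flag_of n g i) = card (col g ` {..<i})"
    using assms GL_carrier[OF assms(1)] by (intro cdim_eq_card) (auto simp: flag_of_eq)
  then show ?thesis using card_image[OF inj_on_subset[OF GL_columns(1)[OF assms(1)] sub]] by simp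
qed

lemma col_in_flag_of: "g \<in> carrier_mat n n \<Longrightarrow> k < i \<Longrightarrow> i \<le> n \<Longrightarrow> col g k \<in> flag_of n g i"
proof -
  assume *: "g \<in> carrier_mat n n" "k < i" "i \<le> n"
  then have "col g ` {..<i} \<subseteq> carrier_vec n" using col_carrier by auto
  then show ?thesis using cspan_superset[of "col g ` {..<i}" n] * by (auto simp: flag_of_eq)
qed

lemma flag_of_mono:
  assumes "g \<in> carrier_mat n n" "i \<le> j" "j \<le> n"
  shows "flag_of n g i \<subseteq> flag_of n g j"
proof -
  have "col g ` {..<i} \<subseteq> col g ` {..<j}" using assms(2) by auto
  then show ?thesis using cspan_mono assms by (simp add: flag_of_eq)
qed

lemma flag_of_in_flags:
  assumes "g \<in> GL n"
  shows "flag_of n g \<in> flags n"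
proof -
  have c: "g \<in> carrier_mat n n" using assms GL_carrier by blast
  have "flag_of n g i \<subset> flag_of n g (Suc i)" if "i < n" for i
  proof -
    have "flag_of n g i \<noteq> flag_of n g (Suc i)"
      using cdim_flag_of[OF assms, of i] cdim_flag_of[OF assms, of "Suc i"] that by fastforce
    moreover have "flag_of n g i \<subseteq> flag_of n g (Suc i)" using that by (intro flag_of_mono[OF c]) auto
    ultimately show ?thesis by blast
  qed
  moreover have "flag_of n g \<in> extensional {0..n}" by (simp add: flag_of_def)
  ultimately show ?thesis
    unfolding flags_def using csubspace_flag_of[OF c] cdim_flag_of[OF assms] by blast
qed

lemma flags_subspace: "F \<in> flags n \<Longrightarrow> i \<le> n \<Longrightarrow> csubspace n (F i)"
  and flags_cdim: "F \<in> flags n \<Longrightarrow> i \<le> n \<Longrightarrow> cdim n (F i) = i"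
  by (simp_all add: flags_def)

lemma flags_mono:
  assumes "F \<in> flags n" "i \<le> j" "j \<le> n"
  shows "F i \<subseteq> F j"
  using assms(2,3)
proof (induction j rule: dec_induct)
  case (step m)
  then have "F m \<subset> F (Suc m)" using assms(1) unfolding flags_def by simp
  then show ?case using step by auto
qed simp

lemma flags_top: "F \<in> flags n \<Longrightarrow> F n = carrier_vec n"
  using csubspace_eqI[OF flags_subspace csubspace_carrier_vec, of F n n]
    csubspace_carrier[OF flags_subspace, of F n n] flags_cdim[of F n n] cdim_carrier_vec[of n] by simp

text \<open>
  Inclusions between members of two complete flags are equalities, since the dimensions agree.
\<close>

lemma flag_of_eqI:
  assumes F: "F \<in> flags n" and g: "g \<in> GL n" and c: "\<And>m. m < n \<Longrightarrow> col g m \<in> F (Suc m)"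
  shows "flag_of n g = F"
proof
  fix i
  show "flag_of n g i = F i"
  proof (cases "i \<le> n")
    case True
    have "col g m \<in> F i" if "m < i" for m
      using c[of m] flags_mono[OF F, of "Suc m" i] True that by auto
    then have "col g ` {..<i} \<subseteq> F i" by auto
    then have "flag_of n g i \<subseteq> F i"
      using cspan_minimal[OF flags_subspace[OF F True]] flag_of_eq[OF GL_carrier[OF g] True] by simp
    then show ?thesis
      by (rule csubspace_eqI[OF csubspace_flag_of[OF GL_carrier[OF g] True] flags_subspace[OF F True]])
        (simp add: flags_cdim[OF F True] cdim_flag_of[OF g True])
  next
    case False
    then show ?thesis using F by (auto simp: flags_def flag_of_def extensional_def)
  qed
qed

text \<open>
  Choose the vectors in the order of the bounds \<open>d k\<close>: when it is the turn of a maximal bound, the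
  subspace has room for one more vector outside the span of those already chosen. This
  produces bases adapted to a flag, both of the whole space and of its coordinate subspaces.
\<close>

lemma independent_choice:
  assumes "finite K" "\<And>i. i \<le> n \<Longrightarrow> csubspace n (A i)"
    and "\<And>i. i \<le> n \<Longrightarrow> card {k \<in> K. d k \<le> i} \<le> cdim n (A i)" "\<And>k. k \<in> K \<Longrightarrow> d k \<le> n"
  shows "\<exists>x. (\<forall>k\<in>K. x k \<in> A (d k)) \<and> inj_on x K \<and> cindep n (x ` K)"
  using assms(1,3,4)
proof (induction "card K" arbitrary: K)
  case 0
  then show ?case by (auto simp: cindep_empty)
next
  case (Suc N)
  then have K: "finite K" "K \<noteq> {}" by auto
  define m where "m = Max (d ` K)"
  have "m \<in> d ` K" unfolding m_def using K by (intro Max_in) auto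
  then obtain k where k: "k \<in> K" "d k = m" by auto
  have mx: "\<And>l. l \<in> K \<Longrightarrow> d l \<le> m" unfolding m_def using K by (intro Max_ge) auto
  let ?K = "K - {k}"
  have "\<exists>x. (\<forall>k\<in>?K. x k \<in> A (d k)) \<and> inj_on x ?K \<and> cindep n (x ` ?K)"
  proof (rule Suc.hyps(1))
    show "N = card ?K" using Suc.hyps(2) k K by simp
    show "card {k \<in> ?K. d k \<le> i} \<le> cdim n (A i)" if "i \<le> n" for i
      using card_mono[of "{k \<in> K. d k \<le> i}" "{k \<in> ?K. d k \<le> i}"] K Suc.prems(2)[OF that] by force
  qed (use K Suc.prems in auto)
  then obtain x where x: "\<forall>k\<in>?K. x k \<in> A (d k)" "inj_on x ?K" "cindep n (x ` ?K)" by auto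
  have mn: "m \<le> n" using Suc.prems(3) k by auto
  have sub: "csubspace n (A i)" if "i \<le> n" for i using assms(2) that .
  have C: "x ` ?K \<subseteq> carrier_vec n"
    using x(1) sub Suc.prems(3) csubspace_carrier by blast
  have "{l \<in> K. d l \<le> m} = K" using mx by auto
  then have "card K \<le> cdim n (A m)" using Suc.prems(2)[OF mn] by simp
  moreover have "cdim n (cspan n (x ` ?K)) < card K"
    using cdim_cspan_le[OF _ C] K k card_image_le[of ?K x] card_Diff1_less[of K k] by force
  ultimately have "\<not> A m \<subseteq> cspan n (x ` ?K)"
    using cdim_mono[OF sub[OF mn] csubspace_cspan[OF C]] by linarith
  then obtain v where v: "v \<in> A m" "v \<notin> cspan n (x ` ?K)" by auto
  have vC: "v \<in> carrier_vec n" using v(1) csubspace_carrier[OF sub[OF mn]] by auto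
  have vx: "v \<notin> x ` ?K" using v(2) cspan_superset[OF C] by auto
  have im: "x(k := v) ` K = insert v (x ` ?K)" using k by auto
  have "inj_on (x(k := v)) K"
    using x(2) vx k by (auto simp: inj_on_def)
  moreover have "cindep n (x(k := v) ` K)" unfolding im by (rule cindep_insert[OF x(3) C vC v(2)])
  moreover have "\<forall>l\<in>K. (x(k := v)) l \<in> A (d l)" using x(1) v k by auto
  ultimately show ?case by blast
qed

lemma flags_eq_flag_of:
  assumes F: "F \<in> flags n"
  obtains g where "g \<in> GL n" "F = flag_of n g"
proof -
  have "\<exists>x. (\<forall>k\<in>{..<n}. x k \<in> F (Suc k)) \<and> inj_on x {..<n} \<and> cindep n (x ` {..<n})"
  proof (rule independent_choice)
    show "card {k \<in> {..<n}. Suc k \<le> i} \<le> cdim n (F i)" if "i \<le> n" for i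
    proof -
      have "{k \<in> {..<n}. Suc k \<le> i} = {..<i}" using that by auto
      then show ?thesis using flags_cdim[OF F that] by simp
    qed
  qed (use flags_subspace[OF F] in auto)
  then obtain x where x: "\<forall>k\<in>{..<n}. x k \<in> F (Suc k)" "inj_on x {..<n}" "cindep n (x ` {..<n})"
    by blast
  have C: "\<And>k. k < n \<Longrightarrow> x k \<in> carrier_vec n"
    using x(1) flags_subspace[OF F] csubspace_carrier by (metis Suc_leI lessThan_iff subsetD)
  obtain g where g: "g \<in> GL n" "\<And>k. k < n \<Longrightarrow> col g k = x k"
    using GL_of_independent_columns[OF C x(2,3)] by blast
  then have "flag_of n g = F" using x(1) by (intro flag_of_eqI[OF F]) auto
  then show ?thesis using that g(1) by blast
qed

subsection \<open>Coordinate subspaces\<close>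

lemma cspan_units_eq:
  assumes "\<And>r. P r \<Longrightarrow> r < n"
  shows "cspan n {unit_vec n i | i. P i} = {x \<in> carrier_vec n. \<forall>r<n. \<not> P r \<longrightarrow> x $ r = 0}"
proof -
  have "col (1\<^sub>m n) ` {r. P r} = ({unit_vec n i | i. P i} :: complex vec set)" using assms by force
  moreover have "(*\<^sub>v) (1\<^sub>m n) ` S = S" if "S \<subseteq> carrier_vec n" for S :: "complex vec set"
  proof -
    have "\<And>x. x \<in> S \<Longrightarrow> 1\<^sub>m n *\<^sub>v x = x" using that by auto
    then show ?thesis by force
  qed
  ultimately show ?thesis
    using mult_mat_vec_supported[of "1\<^sub>m n" n n P] assms by (auto simp: Collect_restrict)
qed

lemma E_first_eq: "E_first n j = {x \<in> carrier_vec n. \<forall>r<n. j \<le> r \<longrightarrow> x $ r = 0}"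
  unfolding E_first_def using cspan_units_eq[of "\<lambda>i. i < j \<and> i < n" n] by (auto simp: not_less)

lemma E_last_eq: "E_last n j = {x \<in> carrier_vec n. \<forall>r<n. r < n - j \<longrightarrow> x $ r = 0}"
  unfolding E_last_def using cspan_units_eq[of "\<lambda>i. n - j \<le> i \<and> i < n" n] by (auto simp: not_le)

lemma csubspace_E_first: "csubspace n (E_first n j)"
  and csubspace_E_last: "csubspace n (E_last n j)"
  unfolding E_first_eq E_last_eq by (rule csubspace_supported_vectors)+

lemma E_first_mono: "i \<le> j \<Longrightarrow> E_first n i \<subseteq> E_first n j"
  by (auto simp: E_first_eq)

lemma E_first_carrier: "E_first n i \<subseteq> carrier_vec n"
  by (auto simp: E_first_eq)

lemma cdim_cspan_units:
  assumes "T \<subseteq> {..<n}"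
  shows "cindep n (unit_vec n ` T)" "cdim n (cspan n (unit_vec n ` T)) = card T"
proof -
  have u: "col (1\<^sub>m n :: complex mat) ` S = unit_vec n ` S" if "S \<subseteq> {..<n}" for S
    using that by force
  have ind: "cindep n (unit_vec n ` {..<n})" and inj: "inj_on (unit_vec n :: nat \<Rightarrow> complex vec) {..<n}"
    using GL_columns(1,2)[OF GL_one, of n] u[of "{..<n}"] by (simp_all add: inj_on_def)
  have *: "cindep n (unit_vec n ` T)" "inj_on (unit_vec n :: nat \<Rightarrow> complex vec) T"
    using cindep_subset[OF ind image_mono[OF assms]] inj_on_subset[OF inj assms] .
  then show "cindep n (unit_vec n ` T)" by simp
  show "cdim n (cspan n (unit_vec n ` T)) = card T"
    using cdim_eq_card[OF *(1) _ refl] card_image[OF *(2)] by (simp add: image_subset_iff)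
qed

lemma card_units_le_cdim:
  assumes "csubspace n W" "T \<subseteq> {..<n}" "\<And>k. k \<in> T \<Longrightarrow> unit_vec n k \<in> W"
  shows "card T \<le> cdim n W"
proof -
  have "unit_vec n ` T \<subseteq> W" using assms(3) by auto
  then have "cspan n (unit_vec n ` T) \<subseteq> W" by (rule cspan_minimal[OF assms(1)])
  moreover have "csubspace n (cspan n (unit_vec n ` T))" by (intro csubspace_cspan) auto
  ultimately show ?thesis
    using cdim_cspan_units(2)[OF assms(2)] cdim_mono[OF _ assms(1)] by metis
qed

lemma cdim_E_first: "j \<le> n \<Longrightarrow> cdim n (E_first n j) = j"
proof -
  assume "j \<le> n"
  then have "{unit_vec n i | i. i < j \<and> i < n} = (unit_vec n ` {..<j} :: complex vec set)" by auto
  then show ?thesis using cdim_cspan_units(2)[of "{..<j}" n] \<open>j \<le> n\<close> by (simp add: E_first_def)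
qed

lemma cdim_E_last: "j \<le> n \<Longrightarrow> cdim n (E_last n j) = j"
proof -
  assume "j \<le> n"
  have "{unit_vec n i | i. n - j \<le> i \<and> i < n} = (unit_vec n ` {n-j..<n} :: complex vec set)" by auto
  moreover have "{n-j..<n} \<subseteq> {..<n}" by auto
  ultimately show ?thesis using cdim_cspan_units(2)[of "{n-j..<n}" n] \<open>j \<le> n\<close> by (simp add: E_last_def)
qed

text \<open>
  Upper bounds for an intersection are obtained by exhibiting unit vectors in the sum.
\<close>

lemma cdim_Int_le_if_units_in_sum:
  assumes "csubspace n U" "csubspace n W" "K \<subseteq> {..<n}"
    and "\<And>k. k \<in> K \<Longrightarrow> unit_vec n k \<in> cspan n (U \<union> W)"
  shows "cdim n (U \<inter> W) + card K \<le> cdim n U + cdim n W"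
proof -
  have "U \<union> W \<subseteq> carrier_vec n" using assms(1,2) csubspace_carrier by auto
  then have "card K \<le> cdim n (cspan n (U \<union> W))"
    using assms(3,4) by (intro card_units_le_cdim csubspace_cspan)
  then show ?thesis using cdim_sum_Int[OF assms(1,2)] by simp
qed

lemma csubspace_eq_carrier_if_units:
  assumes "csubspace n W" "\<And>k. k < n \<Longrightarrow> unit_vec n k \<in> W"
  shows "W = carrier_vec n"
proof (rule csubspace_eqI[OF assms(1) csubspace_carrier_vec csubspace_carrier[OF assms(1)]])
  have "card {..<n} \<le> cdim n W" using assms by (intro card_units_le_cdim) auto
  then show "cdim n (carrier_vec n) \<le> cdim n W" by (simp add: cdim_carrier_vec)
qed

lemma cdim_first_Int_last: "cdim n (E_first n p \<inter> E_last n (n - p)) = 0"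
proof -
  have z: "csubspace n (cspan n {})" by (intro csubspace_cspan) simp
  have "E_first n p \<inter> E_last n (n - p) \<subseteq> {0\<^sub>v n}"
  proof
    fix x assume x: "x \<in> E_first n p \<inter> E_last n (n - p)"
    have "x $ r = 0" if "r < n" for r using x that by (cases "r < p") (auto simp: E_first_eq E_last_eq)
    then have "x = 0\<^sub>v n" using x by (intro eq_vecI) (auto simp: E_first_eq)
    then show "x \<in> {0\<^sub>v n}" by simp
  qed
  then have "E_first n p \<inter> E_last n (n - p) \<subseteq> cspan n {}" using csubspace_zero[OF z] by auto
  then have "cdim n (E_first n p \<inter> E_last n (n - p)) \<le> cdim n (cspan n {})"
    by (intro cdim_mono csubspace_Int csubspace_E_first csubspace_E_last z)
  also have "\<dots> \<le> 0" using cdim_cspan_le[of "{}" n] by simp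
  finally show ?thesis by simp
qed

section \<open>Closed conditions and polynomial curves\<close>

text \<open>
  Determinants and adjugates of matrices with polynomial entries have polynomial entries. This
  is needed both for polynomials in the entries of a matrix and for polynomials in the parameter
  of a curve, so it is proved for an arbitrary algebra of functions.
\<close>

locale function_algebra =
  fixes Q :: "('a \<Rightarrow> complex) \<Rightarrow> bool"
  assumes const: "Q (\<lambda>_. c)"
    and add: "Q f \<Longrightarrow> Q g \<Longrightarrow> Q (\<lambda>x. f x + g x)"
    and mult: "Q f \<Longrightarrow> Q g \<Longrightarrow> Q (\<lambda>x. f x * g x)"
begin

lemma sum: "finite I \<Longrightarrow> (\<And>i. i \<in> I \<Longrightarrow> Q (h i)) \<Longrightarrow> Q (\<lambda>x. \<Sum>i\<in>I. h i x)"
  by (induction I rule: finite_induct) (simp_all add: const add)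

lemma prod: "finite I \<Longrightarrow> (\<And>i. i \<in> I \<Longrightarrow> Q (h i)) \<Longrightarrow> Q (\<lambda>x. \<Prod>i\<in>I. h i x)"
  by (induction I rule: finite_induct) (simp_all add: const mult)

lemma det:
  assumes A: "\<And>x. A x \<in> carrier_mat m m"
    and entry: "\<And>i j. i < m \<Longrightarrow> j < m \<Longrightarrow> Q (\<lambda>x. A x $$ (i, j))"
  shows "Q (\<lambda>x. det (A x))"
proof -
  have "Q (\<lambda>x. \<Sum>s | s permutes {0..<m}. signof s * (\<Prod>i = 0..<m. A x $$ (i, s i)))"
  proof (intro sum mult const prod entry)
    fix s i assume "s \<in> {s. s permutes {0..<m}}" "i \<in> {0..<m}"
    then show "s i < m" using permutes_in_image[of s "{0..<m}" i] by auto
  qed (auto simp: finite_permutations)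
  then show ?thesis by (simp add: det_def'[OF A])
qed

lemma mat_mult:
  assumes "\<And>x. A x \<in> carrier_mat n m" "\<And>x. B x \<in> carrier_mat m l"
    and "\<And>i j. i < n \<Longrightarrow> j < m \<Longrightarrow> Q (\<lambda>x. A x $$ (i, j))"
    and "\<And>i j. i < m \<Longrightarrow> j < l \<Longrightarrow> Q (\<lambda>x. B x $$ (i, j))"
    and "i < n" "j < l"
  shows "Q (\<lambda>x. (A x * B x) $$ (i, j))"
proof -
  have "(A x * B x) $$ (i, j) = (\<Sum>k\<in>{0..<m}. A x $$ (i, k) * B x $$ (k, j))" for x
    using assms(1)[of x] assms(2)[of x] assms(5,6) by (auto simp: scalar_prod_def)
  then show ?thesis using assms by (auto intro!: sum mult)
qed

lemma adj_mat:
  assumes A: "\<And>x. A x \<in> carrier_mat n n"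
    and entry: "\<And>i j. i < n \<Longrightarrow> j < n \<Longrightarrow> Q (\<lambda>x. A x $$ (i, j))" and ij: "i < n" "j < n"
  shows "Q (\<lambda>x. adj_mat (A x) $$ (i, j))"
proof -
  have "adj_mat (A x) $$ (i, j) = (- 1) ^ (j + i) * Determinant.det (mat_delete (A x) j i)" for x
    using A[of x] ij by (auto simp: adj_mat_def cofactor_def)
  moreover have "Q (\<lambda>x. Determinant.det (mat_delete (A x) j i))"
  proof (rule det)
    show "mat_delete (A x) j i \<in> carrier_mat (n - 1) (n - 1)" for x
      using A[of x] by (auto simp: mat_delete_def)
    show "Q (\<lambda>x. mat_delete (A x) j i $$ (k, l))" if kl: "k < n - 1" "l < n - 1" for k l
    proof -
      let ?k = "if k < j then k else Suc k" and ?l = "if l < i then l else Suc l"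
      have "mat_delete (A x) j i $$ (k, l) = A x $$ (?k, ?l)" for x
        using A[of x] kl by (auto simp: mat_delete_def)
      moreover have "?k < n" "?l < n" using kl by auto
      ultimately show ?thesis using entry[of ?k ?l] by simp
    qed
  qed
  ultimately show ?thesis by (simp add: mult const)
qed

end

interpretation entry_poly: function_algebra "poly_fun n"
  by unfold_locales (auto intro: poly_fun.intros)

lemma topspace_zariski_flags: "topspace (zariski_flags n) = flags n"
proof (rule antisym)
  show "topspace (zariski_flags n) \<subseteq> flags n"
    unfolding topspace_def by (auto simp: openin_zariski_flags)
  have "{g \<in> GL n. flag_of n g \<in> flags n} = GL n" using flag_of_in_flags by auto
  moreover have "openin (zariski_GL n) (GL n)"
    unfolding openin_zariski_GL
    by (auto intro!: exI[of _ "{\<lambda>_. 1}"] poly_fun.const simp: zero_locus_def)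
  ultimately have "openin (zariski_flags n) (flags n)" by (simp add: openin_zariski_flags)
  then show "flags n \<subseteq> topspace (zariski_flags n)" by (rule openin_subset)
qed

lemma closedin_zariski_flags_iff:
  "closedin (zariski_flags n) C \<longleftrightarrow> C \<subseteq> flags n \<and>
     (\<exists>P \<subseteq> Collect (poly_fun n). {g \<in> GL n. flag_of n g \<in> C} = zero_locus n P)"
proof -
  have "GL n - {g \<in> GL n. flag_of n g \<in> flags n - C} = {g \<in> GL n. flag_of n g \<in> C}"
    using flag_of_in_flags by auto
  then show ?thesis
    unfolding closedin_def topspace_zariski_flags openin_zariski_flags openin_zariski_GL by auto
qed

definition poly_vec :: "nat \<Rightarrow> (complex mat \<Rightarrow> complex vec) \<Rightarrow> bool" where
  "poly_vec n w \<longleftrightarrow> (\<forall>g\<in>GL n. w g \<in> carrier_vec n) \<and> (\<forall>i<n. poly_fun n (\<lambda>g. w g $ i))"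

text \<open>
  The dimension of a span is lower semicontinuous: it exceeds \<open>d\<close> at \<open>g\<close> iff fewer than
  \<open>n - d\<close> constant vectors complete some of the given vectors to a basis, i.e. iff one of the
  determinants below does not vanish.
\<close>

lemma zero_locus_cdim_cspan_le:
  assumes W: "\<And>w. w \<in> W \<Longrightarrow> poly_vec n w"
  shows "\<exists>P \<subseteq> Collect (poly_fun n).
    {g \<in> GL n. cdim n (cspan n ((\<lambda>w. w g) ` W)) \<le> d} = zero_locus n P"
proof -
  \<comment> \<open>The columns of such a determinant are some of the given vectors, completed by constant
  vectors \<open>Z\<close>, of which there are fewer than \<open>n - d\<close>.\<close>
  define D where "D xs g = det (mat_of_cols n (map (\<lambda>f. f g) xs))"
    for xs :: "(complex mat \<Rightarrow> complex vec) list" and g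
  define X where "X = {xs. \<exists>Z. length xs = n \<and> set xs \<subseteq> W \<union> (\<lambda>z _. z) ` Z \<and>
    Z \<subseteq> carrier_vec n \<and> finite Z \<and> d + card Z < n}"
  have "D ` X \<subseteq> Collect (poly_fun n)"
  proof
    fix f assume "f \<in> D ` X"
    then obtain xs Z where f: "f = (\<lambda>g. D xs g)" and xs: "length xs = n"
        "set xs \<subseteq> W \<union> (\<lambda>z _. z) ` Z"
      unfolding X_def by auto
    have "poly_fun n (\<lambda>g. D xs g)"
      unfolding D_def
    proof (rule entry_poly.det)
      show "mat_of_cols n (map (\<lambda>f. f g) xs) \<in> carrier_mat n n" for g using xs by auto
      show "poly_fun n (\<lambda>g. mat_of_cols n (map (\<lambda>f. f g) xs) $$ (i, j))" if "i < n" "j < n" for i j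
      proof -
        have "xs ! j \<in> set xs" using that xs by simp
        then consider "xs ! j \<in> W" | z where "xs ! j = (\<lambda>_. z)" using xs(2) by auto
        then have "poly_fun n (\<lambda>g. (xs ! j) g $ i)"
          using W that by cases (auto simp: poly_vec_def intro: poly_fun.const)
        then show ?thesis using that xs by (simp add: mat_of_cols_def)
      qed
    qed
    then show "f \<in> Collect (poly_fun n)" using f by simp
  qed
  moreover have "{g \<in> GL n. cdim n (cspan n ((\<lambda>w. w g) ` W)) \<le> d} = zero_locus n (D ` X)"
  proof (intro equalityI subsetI)
    fix g assume "g \<in> {g \<in> GL n. cdim n (cspan n ((\<lambda>w. w g) ` W)) \<le> d}"
    then have g: "g \<in> GL n" "cdim n (cspan n ((\<lambda>w. w g) ` W)) \<le> d" by auto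
    have WC: "(\<lambda>w. w g) ` W \<subseteq> carrier_vec n" using W g by (auto simp: poly_vec_def)
    have "D xs g = 0" if "xs \<in> X" for xs
    proof (rule ccontr)
      assume nz: "D xs g \<noteq> 0"
      obtain Z where Z: "length xs = n" "set xs \<subseteq> W \<union> (\<lambda>z _. z) ` Z" "Z \<subseteq> carrier_vec n"
          "finite Z" "d + card Z < n"
        using \<open>xs \<in> X\<close> unfolding X_def by auto
      let ?A = "mat_of_cols n (map (\<lambda>f. f g) xs)"
      have sub: "(\<lambda>f. f g) ` set xs \<subseteq> (\<lambda>w. w g) ` W \<union> Z" using Z(2) by auto
      have "cols ?A = map (\<lambda>f. f g) xs" using sub WC Z(3) by (intro cols_mat_of_cols) auto
      moreover have "?A \<in> carrier_mat n n" using Z(1) by auto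
      ultimately have "carrier_vec n = cspan n ((\<lambda>f. f g) ` set xs)"
        using cspan_cols_invertible[of ?A n] nz by (simp add: D_def)
      also have "\<dots> \<subseteq> cspan n ((\<lambda>w. w g) ` W \<union> Z)" using sub by (rule cspan_mono)
      finally have "cdim n (carrier_vec n) \<le> cdim n (cspan n ((\<lambda>w. w g) ` W \<union> Z))"
        using WC Z(3) by (intro cdim_mono csubspace_carrier_vec csubspace_cspan) auto
      then show False
        using cdim_cspan_Un_le[OF WC Z(3,4)] g(2) Z(5) by (simp add: cdim_carrier_vec)
    qed
    then show "g \<in> zero_locus n (D ` X)" using g by (auto simp: zero_locus_def)
  next
    fix g assume "g \<in> zero_locus n (D ` X)"
    then have g: "g \<in> GL n" and z: "\<And>xs. xs \<in> X \<Longrightarrow> D xs g = 0" by (auto simp: zero_locus_def)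
    have WC: "(\<lambda>w. w g) ` W \<subseteq> carrier_vec n" using W g by (auto simp: poly_vec_def)
    have "cdim n (cspan n ((\<lambda>w. w g) ` W)) \<le> d"
    proof (rule ccontr)
      assume gt: "\<not> ?thesis"
      obtain B where B: "B \<subseteq> (\<lambda>w. w g) ` W" "finite B" "cindep n B"
          "cspan n B = cspan n ((\<lambda>w. w g) ` W)" "card B = cdim n (cspan n ((\<lambda>w. w g) ` W))"
        using cbasis_in[OF WC] .
      have BC: "B \<subseteq> carrier_vec n" using B WC by auto
      \<comment> \<open>A basis of the span has more than \<open>d\<close> elements, so few constant vectors complete it.\<close>
      obtain C where C: "B \<subseteq> C" "C \<subseteq> carrier_vec n" "finite C" "cindep n C"
          "cspan n C = cspan n (carrier_vec n)" "card C = cdim n (cspan n (carrier_vec n))"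
        using cbasis_between[OF order_refl BC B(3)] .
      have cC: "card C = n"
        using C(6) by (simp add: cspan_csubspace[OF csubspace_carrier_vec] cdim_carrier_vec)
      obtain ys where ys: "set ys = C" "distinct ys" using finite_distinct_list[OF C(3)] by blast
      have len: "length ys = n" using ys cC distinct_card by metis
      have "\<forall>y\<in>B. \<exists>w\<in>W. w g = y" using B(1) by auto
      then obtain s where s: "\<And>y. y \<in> B \<Longrightarrow> s y \<in> W \<and> s y g = y" by metis
      define xs where "xs = map (\<lambda>y. if y \<in> B then s y else (\<lambda>_. y)) ys"
      have xg: "map (\<lambda>f. f g) xs = ys" unfolding xs_def using s by (induction ys) auto
      have "card B \<le> n" using cindep_card_le[OF B(3) BC] .
      then have "d + card (C - B) < n"
        using gt B(2,5) C(1) cC by (simp add: card_Diff_subset)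
      moreover have "set xs \<subseteq> W \<union> (\<lambda>z _. z) ` (C - B)" using s ys unfolding xs_def by auto
      moreover have "length xs = n" using len by (simp add: xs_def)
      ultimately have "xs \<in> X" unfolding X_def using C(2,3) by blast
      then have "det (mat_of_cols n ys) = 0" using z xg unfolding D_def by metis
      then show False using det_nonzero_if_cindep[OF len ys(2)] ys(1) C by simp
    qed
    then show "g \<in> {g \<in> GL n. cdim n (cspan n ((\<lambda>w. w g) ` W)) \<le> d}" using g by simp
  qed
  ultimately show ?thesis by blast
qed

lemma closedin_flags_cdim_cspan_le:
  assumes "\<And>w. w \<in> W \<Longrightarrow> poly_vec n w"
    and "\<And>g. g \<in> GL n \<Longrightarrow> c (flag_of n g) \<longleftrightarrow> cdim n (cspan n ((\<lambda>w. w g) ` W)) \<le> d"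
  shows "closedin (zariski_flags n) {F \<in> flags n. c F}"
proof -
  have "{g \<in> GL n. flag_of n g \<in> {F \<in> flags n. c F}} =
      {g \<in> GL n. cdim n (cspan n ((\<lambda>w. w g) ` W)) \<le> d}"
    using assms(2) flag_of_in_flags by auto
  then show ?thesis
    using zero_locus_cdim_cspan_le[of W n d] assms(1) by (auto simp: closedin_zariski_flags_iff)
qed

lemma poly_vec_col: "k < n \<Longrightarrow> poly_vec n (\<lambda>g. vec n (\<lambda>i. g $$ (i, k)))"
  by (auto simp: poly_vec_def intro: poly_fun.intros)

lemma poly_vec_const: "x \<in> carrier_vec n \<Longrightarrow> poly_vec n (\<lambda>_. x)"
  by (auto simp: poly_vec_def intro: poly_fun.const)

lemma col_eq_vec: "g \<in> carrier_mat n n \<Longrightarrow> k < n \<Longrightarrow> col g k = vec n (\<lambda>i. g $$ (i, k))"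
  by (intro eq_vecI) auto

text \<open>
  A lower bound for the intersection with a fixed subspace is an upper bound for the sum with it.
\<close>

lemma closedin_flags_cdim_Int_ge:
  assumes E: "csubspace n E" and i: "i \<le> n"
  shows "closedin (zariski_flags n) {F \<in> flags n. a \<le> cdim n (F i \<inter> E)}"
proof (cases "a \<le> i + cdim n E")
  case True
  have EC: "E \<subseteq> carrier_vec n" using E csubspace_carrier by blast
  let ?W = "(\<lambda>k g. vec n (\<lambda>r. g $$ (r, k))) ` {..<i} \<union> (\<lambda>x _. x) ` E"
  show ?thesis
  proof (rule closedin_flags_cdim_cspan_le)
    show "poly_vec n w" if "w \<in> ?W" for w
      using that i EC by (auto intro: poly_vec_col poly_vec_const)
    fix g assume g: "g \<in> GL n"
    have c: "g \<in> carrier_mat n n" using g GL_carrier by blast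
    have "(\<lambda>w. w g) ` ?W = (\<lambda>k. vec n (\<lambda>r. g $$ (r, k))) ` {..<i} \<union> E"
      unfolding image_Un image_image by simp
    also have "(\<lambda>k. vec n (\<lambda>r. g $$ (r, k))) ` {..<i} = col g ` {..<i}"
      using i by (intro image_cong) (auto simp: col_eq_vec[OF c])
    finally have "(\<lambda>w. w g) ` ?W = col g ` {..<i} \<union> E" .
    moreover have "cspan n (col g ` {..<i} \<union> E) = cspan n (flag_of n g i \<union> E)"
    proof -
      have "col g ` {..<i} \<subseteq> carrier_vec n" using c by auto
      then show ?thesis
        using cspan_Un_cspan[of "col g ` {..<i}" n E] EC
        by (simp add: flag_of_eq[OF c i] cspan_csubspace[OF E])
    qed
    moreover have "cdim n (cspan n (flag_of n g i \<union> E)) + cdim n (flag_of n g i \<inter> E) = i + cdim n E"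
      using cdim_sum_Int[OF csubspace_flag_of[OF c i] E] cdim_flag_of[OF g i] by simp
    ultimately show "a \<le> cdim n (flag_of n g i \<inter> E) \<longleftrightarrow>
        cdim n (cspan n ((\<lambda>w. w g) ` ?W)) \<le> i + cdim n E - a"
      using True by auto
  qed
next
  case False
  have "cdim n (F i \<inter> E) \<le> cdim n E" if "F \<in> flags n" for F
    using csubspace_Int[OF flags_subspace[OF that i] E] E by (intro cdim_mono) auto
  then have "{F \<in> flags n. a \<le> cdim n (F i \<inter> E)} = {}" using False by fastforce
  then show ?thesis by (simp only: closedin_empty)
qed

definition proj_mat :: "nat \<Rightarrow> nat \<Rightarrow> complex mat" where
  "proj_mat n p = mat n n (\<lambda>(i, j). if i = j \<and> i < p then 1 else 0)"

lemma proj_mat_carrier: "proj_mat n p \<in> carrier_mat n n"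
  by (simp add: proj_mat_def)

lemma proj_first_eq: "x \<in> carrier_vec n \<Longrightarrow> proj_first n p x = proj_mat n p *\<^sub>v x"
proof (intro eq_vecI)
  fix i assume x: "x \<in> carrier_vec n" and "i < dim_vec (proj_mat n p *\<^sub>v x)"
  then have i: "i < n" by (simp add: proj_mat_def)
  have "(proj_mat n p *\<^sub>v x) $ i =
      (\<Sum>j\<in>{0..<n}. (if i = j \<and> i < p then 1 else 0) * x $ j)"
    using i x unfolding proj_mat_def by (simp add: scalar_prod_def)
  also have "\<dots> = (\<Sum>j\<in>{0..<n}. if i = j then (if i < p then x $ j else 0) else 0)"
    by (intro sum.cong) auto
  also have "\<dots> = (if i < p then x $ i else 0)" using i by (subst sum.delta') auto
  finally have "(proj_mat n p *\<^sub>v x) $ i = (if i < p then x $ i else 0)" .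
  then show "proj_first n p x $ i = (proj_mat n p *\<^sub>v x) $ i"
    using i by (simp add: proj_first_def)
qed (simp add: proj_first_def proj_mat_def)

lemma proj_first_image_eq: "W \<subseteq> carrier_vec n \<Longrightarrow> proj_first n p ` W = (*\<^sub>v) (proj_mat n p) ` W"
  using proj_first_eq by (intro image_cong) auto

lemma csubspace_proj_first: "csubspace n W \<Longrightarrow> csubspace n (proj_first n p ` W)"
  using csubspace_image[OF proj_mat_carrier] proj_first_image_eq csubspace_carrier by metis

lemma cspan_proj_first: "X \<subseteq> carrier_vec n \<Longrightarrow> cspan n (proj_first n p ` X) = proj_first n p ` cspan n X"
  using cspan_image[OF proj_mat_carrier] proj_first_image_eq cspan_carrier by metis

abbreviation proj_sum :: "nat \<Rightarrow> nat \<Rightarrow> complex vec set \<Rightarrow> complex vec set \<Rightarrow> complex vec set" where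
  "proj_sum n p U W \<equiv>
     LinearCombinations.module.submodule_sum (cspace n) (proj_first n p ` U) W"

lemma proj_sum_eq_cspan:
  assumes "csubspace n U" "csubspace n W"
  shows "proj_sum n p U W = cspan n (proj_first n p ` U \<union> W)"
  using submodule_sum_eq_cspan[OF csubspace_proj_first[OF assms(1)] assms(2)] .

lemma closedin_flags_cdim_proj_sum_le:
  assumes i: "i \<le> n" and j: "j \<le> n"
  shows "closedin (zariski_flags n) {F \<in> flags n. cdim n (proj_sum n p (F i) (F j)) \<le> d}"
proof -
  let ?W = "(\<lambda>k g. proj_first n p (vec n (\<lambda>r. g $$ (r, k)))) ` {..<i} \<union>
    (\<lambda>k g. vec n (\<lambda>r. g $$ (r, k))) ` {..<j}"
  show ?thesis
  proof (rule closedin_flags_cdim_cspan_le)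
    show "poly_vec n w" if w: "w \<in> ?W" for w
    proof -
      from w consider k where "k < i" "w = (\<lambda>g. proj_first n p (vec n (\<lambda>r. g $$ (r, k))))"
        | k where "k < j" "w = (\<lambda>g. vec n (\<lambda>r. g $$ (r, k)))" by auto
      then show ?thesis
      proof cases
        case 1
        have "poly_fun n (\<lambda>g. w g $ r)" if "r < n" for r
          using 1 that i by (cases "r < p") (auto simp: proj_first_def intro: poly_fun.intros)
        then show ?thesis using 1 by (auto simp: poly_vec_def proj_first_def)
      qed (use j in \<open>auto intro: poly_vec_col\<close>)
    qed
    fix g assume g: "g \<in> GL n"
    have c: "g \<in> carrier_mat n n" using g GL_carrier by blast
    have cols: "(\<lambda>k. vec n (\<lambda>r. g $$ (r, k))) ` {..<m} = col g ` {..<m}" if "m \<le> n" for m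
      using that by (intro image_cong) (auto simp: col_eq_vec[OF c])
    have "(\<lambda>w. w g) ` ?W = proj_first n p ` (\<lambda>k. vec n (\<lambda>r. g $$ (r, k))) ` {..<i} \<union>
        (\<lambda>k. vec n (\<lambda>r. g $$ (r, k))) ` {..<j}"
      unfolding image_Un image_image by simp
    also have "\<dots> = proj_first n p ` col g ` {..<i} \<union> col g ` {..<j}"
      using cols[OF i] cols[OF j] by simp
    finally have e: "(\<lambda>w. w g) ` ?W = proj_first n p ` col g ` {..<i} \<union> col g ` {..<j}" .
    have C: "col g ` {..<i} \<subseteq> carrier_vec n" "col g ` {..<j} \<subseteq> carrier_vec n"
      "proj_first n p ` col g ` {..<i} \<subseteq> carrier_vec n"
      using c by (auto simp: proj_first_def)
    have "cspan n ((\<lambda>w. w g) ` ?W) = proj_sum n p (flag_of n g i) (flag_of n g j)"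
      unfolding proj_sum_eq_cspan[OF csubspace_flag_of[OF c i] csubspace_flag_of[OF c j]] e
      using cspan_Un_cspan[OF C(3,2)] cspan_proj_first[OF C(1)] flag_of_eq[OF c i] flag_of_eq[OF c j]
      by simp
    then show "cdim n (proj_sum n p (flag_of n g i) (flag_of n g j)) \<le> d \<longleftrightarrow>
        cdim n (cspan n ((\<lambda>w. w g) ` ?W)) \<le> d" by simp
  qed
qed

subsection \<open>Polynomial curves\<close>

definition poly_curve :: "(complex \<Rightarrow> complex) \<Rightarrow> bool" where
  "poly_curve f \<longleftrightarrow> (\<exists>P. \<forall>t. f t = poly P t)"

interpretation curve: function_algebra poly_curve
proof
  show "poly_curve (\<lambda>_. c)" for c
    unfolding poly_curve_def by (rule exI[of _ "[:c:]"]) simp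
  show "poly_curve (\<lambda>x. f x + g x)" if "poly_curve f" "poly_curve g" for f g
    using that unfolding poly_curve_def by (metis poly_add)
  show "poly_curve (\<lambda>x. f x * g x)" if "poly_curve f" "poly_curve g" for f g
    using that unfolding poly_curve_def by (metis poly_mult)
qed

lemma poly_curve_line: "poly_curve (\<lambda>t. (1 - t) * a + t * b)"
  unfolding poly_curve_def by (rule exI[of _ "[:a, b - a:]"]) (simp add: algebra_simps)

lemma poly_curve_finite_zeros:
  assumes "poly_curve f" "f t0 \<noteq> 0"
  shows "finite {t. f t = 0}"
proof -
  obtain P where P: "\<And>t. f t = poly P t" using assms(1) unfolding poly_curve_def by auto
  then have "P \<noteq> 0" using assms(2) by auto
  then show ?thesis using poly_roots_finite[of P] P by simp
qed

lemma poly_fun_along_curve: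
  assumes "poly_fun n f" "\<And>i j. i < n \<Longrightarrow> j < n \<Longrightarrow> poly_curve (\<lambda>t. c t $$ (i, j))"
  shows "poly_curve (\<lambda>t. f (c t))"
  using assms(1) by induction (auto intro: curve.const curve.add curve.mult assms(2))

section \<open>Incidence varieties of flags\<close>

text \<open>
  The flags in which, for the numbers of vectors counted here, the coordinate subspaces can have
  bases whose \<open>k\<close>-th vector lies in the \<open>d k\<close>-th member of the flag. Both Schubert varieties and
  their intersection have this form for suitable \<open>d\<close>; \<open>d k = n\<close> imposes no condition.
\<close>

definition incidence ::
  "nat \<Rightarrow> nat \<Rightarrow> (nat \<Rightarrow> nat) \<Rightarrow> (nat \<Rightarrow> complex vec set) set" where
  "incidence n p d = {F \<in> flags n. \<forall>i\<le>n.
     card {k \<in> {..<p}. d k \<le> i} \<le> cdim n (F i \<inter> E_first n p) \<and>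
     card {k \<in> {p..<n}. d k \<le> i} \<le> cdim n (F i \<inter> E_last n (n - p))}"

text \<open>
  The bounds in the definition are those under which vectors of \<open>F (d k)\<close> can be chosen
  independently inside each of the two coordinate subspaces, and these are complementary.
\<close>

lemma adapted_basis:
  assumes F: "F \<in> incidence n p d" and p: "p \<le> n" and d: "\<forall>k<n. d k \<le> n"
  obtains N where "N \<in> GL n" "\<forall>k<n. col N k \<in> F (d k)"
    "\<forall>k<p. col N k \<in> E_first n p" "\<forall>k<n. p \<le> k \<longrightarrow> col N k \<in> E_last n (n - p)"
proof -
  have Ff: "F \<in> flags n" using F by (simp add: incidence_def)
  have "\<exists>x. (\<forall>k\<in>{..<p}. x k \<in> F (d k) \<inter> E_first n p) \<and> inj_on x {..<p} \<and> cindep n (x ` {..<p})"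
    using F p d by (intro independent_choice csubspace_Int csubspace_E_first flags_subspace[OF Ff])
      (auto simp: incidence_def)
  then obtain x where x: "\<forall>k\<in>{..<p}. x k \<in> F (d k) \<inter> E_first n p" "inj_on x {..<p}"
      "cindep n (x ` {..<p})" by blast
  have "\<exists>y. (\<forall>k\<in>{p..<n}. y k \<in> F (d k) \<inter> E_last n (n - p)) \<and> inj_on y {p..<n} \<and> cindep n (y ` {p..<n})"
    using F p d by (intro independent_choice csubspace_Int csubspace_E_last flags_subspace[OF Ff])
      (auto simp: incidence_def)
  then obtain y where y: "\<forall>k\<in>{p..<n}. y k \<in> F (d k) \<inter> E_last n (n - p)" "inj_on y {p..<n}"
      "cindep n (y ` {p..<n})" by blast
  define z where "z k = (if k < p then x k else y k)" for k
  have zx: "z ` {..<p} = x ` {..<p}" and zy: "z ` {p..<n} = y ` {p..<n}" by (auto simp: z_def)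
  have xE: "x ` {..<p} \<subseteq> E_first n p" and yE: "y ` {p..<n} \<subseteq> E_last n (n - p)" using x(1) y(1) by auto
  have EC: "E_first n p \<subseteq> carrier_vec n" "E_last n (n - p) \<subseteq> carrier_vec n"
    by (auto simp: E_first_eq E_last_eq)
  have "cspan n (x ` {..<p}) = E_first n p"
    using x xE card_image[OF x(2)] cdim_E_first[OF p]
    by (intro cspan_eq_if_card_ge_cdim csubspace_E_first) auto
  moreover have "cspan n (y ` {p..<n}) = E_last n (n - p)"
    using y yE card_image[OF y(2)] cdim_E_last[of "n - p" n]
    by (intro cspan_eq_if_card_ge_cdim csubspace_E_last) auto
  moreover have zC: "z k \<in> carrier_vec n" if "k < n" for k
    using that xE yE EC by (cases "k < p") (auto simp: z_def image_subset_iff)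
  moreover have "{..<n} = {..<p} \<union> {p..<n}" using p by auto
  ultimately have sub: "E_first n p \<subseteq> cspan n (z ` {..<n})" "E_last n (n - p) \<subseteq> cspan n (z ` {..<n})"
    using cspan_mono[of "z ` {..<p}" "z ` {..<n}" n] cspan_mono[of "z ` {p..<n}" "z ` {..<n}" n] zx zy
    by (auto simp: image_Un)
  have zs: "csubspace n (cspan n (z ` {..<n}))" using zC by (intro csubspace_cspan) auto
  have "carrier_vec n \<subseteq> cspan n (z ` {..<n})"
  proof
    fix v :: "complex vec" assume v: "v \<in> carrier_vec n"
    let ?a = "vec n (\<lambda>i. if i < p then v $ i else 0)" and ?b = "vec n (\<lambda>i. if i < p then 0 else v $ i)"
    have "?a \<in> E_first n p" "?b \<in> E_last n (n - p)"
      using p by (auto simp: E_first_eq E_last_eq)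
    then have "?a + ?b \<in> cspan n (z ` {..<n})" using sub by (intro csubspace_add[OF zs]) auto
    moreover have "v = ?a + ?b" using v by (intro eq_vecI) auto
    ultimately show "v \<in> cspan n (z ` {..<n})" by simp
  qed
  then have "cspan n (z ` {..<n}) = carrier_vec n" using zs csubspace_carrier by blast
  then obtain N where N: "N \<in> GL n" "\<And>k. k < n \<Longrightarrow> col N k = z k"
    using GL_of_spanning_columns[of n z] zC by blast
  show ?thesis
  proof (rule that[OF N(1)])
    show "\<forall>k<n. col N k \<in> F (d k)" using N(2) x(1) y(1) by (auto simp: z_def)
    show "\<forall>k<p. col N k \<in> E_first n p" using N(2) p x(1) by (auto simp: z_def)
    show "\<forall>k<n. p \<le> k \<longrightarrow> col N k \<in> E_last n (n - p)" using N(2) y(1) by (auto simp: z_def)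
  qed
qed

text \<open>
  Converse of the previous lemma: the columns of \<open>N\<close> give enough independent vectors.
\<close>

lemma incidenceI:
  assumes F: "F \<in> flags n" and p: "p \<le> n" and N: "N \<in> GL n"
    and NF: "\<And>k. k < n \<Longrightarrow> d k \<le> n \<Longrightarrow> col N k \<in> F (d k)"
    and first: "\<And>k. k < p \<Longrightarrow> col N k \<in> E_first n p"
    and last: "\<And>k. p \<le> k \<Longrightarrow> k < n \<Longrightarrow> col N k \<in> E_last n (n - p)"
  shows "F \<in> incidence n p d"
proof -
  have main: "card K \<le> cdim n (F i \<inter> E)"
    if i: "i \<le> n" and E: "csubspace n E" and K: "K \<subseteq> {..<n}" "\<And>k. k \<in> K \<Longrightarrow> d k \<le> i"
      "\<And>k. k \<in> K \<Longrightarrow> col N k \<in> E" for i E K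
  proof -
    have "col N k \<in> F i" if "k \<in> K" for k
      using NF[of k] K(1,2) that i flags_mono[OF F, of "d k" i] by fastforce
    then have "card (col N ` K) \<le> cdim n (F i \<inter> E)"
      using K(3) cindep_subset[OF GL_columns(2)[OF N] image_mono[OF K(1)]]
      by (intro cindep_card_le_cdim csubspace_Int flags_subspace[OF F i] E) auto
    then show ?thesis using card_image[OF inj_on_subset[OF GL_columns(1)[OF N] K(1)]] by simp
  qed
  show ?thesis
    unfolding incidence_def using F p first last
    by (auto intro!: main csubspace_E_first csubspace_E_last)
qed

lemma flag_of_smult:
  assumes "g \<in> carrier_mat n n" "c \<noteq> 0"
  shows "flag_of n (c \<cdot>\<^sub>m g) = flag_of n g"
proof
  fix i
  have sub: "flag_of n (a \<cdot>\<^sub>m h) i \<subseteq> flag_of n h i" if "i \<le> n" "h \<in> carrier_mat n n" for a h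
  proof -
    have "col (a \<cdot>\<^sub>m h) k \<in> flag_of n h i" if "k < i" for k
    proof -
      have "col (a \<cdot>\<^sub>m h) k = a \<cdot>\<^sub>v col h k"
        using that \<open>i \<le> n\<close> \<open>h \<in> carrier_mat n n\<close> by (intro eq_vecI) auto
      moreover have "col h ` {..<i} \<subseteq> flag_of n h i"
        using \<open>i \<le> n\<close> \<open>h \<in> carrier_mat n n\<close> by (simp add: flag_of_eq) (intro cspan_superset, auto)
      ultimately show ?thesis
        using csubspace_smult[OF csubspace_flag_of] that \<open>i \<le> n\<close> \<open>h \<in> carrier_mat n n\<close> by auto
    qed
    then have "cspan n (col (a \<cdot>\<^sub>m h) ` {..<i}) \<subseteq> flag_of n h i"
      using that by (intro cspan_minimal csubspace_flag_of) auto
    then show ?thesis using that by (simp add: flag_of_eq)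
  qed
  show "flag_of n (c \<cdot>\<^sub>m g) i = flag_of n g i"
  proof (cases "i \<le> n")
    case True
    have "g = (1 / c) \<cdot>\<^sub>m (c \<cdot>\<^sub>m g)" using assms by (intro eq_matI) auto
    then have "flag_of n g i \<subseteq> flag_of n (c \<cdot>\<^sub>m g) i"
      using sub[OF True, of "c \<cdot>\<^sub>m g" "1 / c"] assms by simp
    then show ?thesis using sub[OF True assms(1)] by blast
  next
    case False
    then show ?thesis by (simp add: flag_of_def)
  qed
qed

text \<open>The linear conditions on \<open>g\<^sup>-\<^sup>1N\<close> that say that \<open>col N k\<close> lies in the \<open>d k\<close>-th space of the flag of \<open>g\<close>.\<close>

lemma adapted_coordinates:
  assumes g: "g \<in> GL n" and N: "N \<in> GL n" and d: "\<forall>k<n. d k \<le> n"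
    and NF: "\<forall>k<n. col N k \<in> flag_of n g (d k)"
  obtains M where "M \<in> GL n" "N = g * M" "\<forall>r<n. \<forall>k<n. d k \<le> r \<longrightarrow> M $$ (r, k) = 0"
proof -
  obtain h where h: "h \<in> GL n" "g * h = 1\<^sub>m n" "h * g = 1\<^sub>m n" using GL_inverse[OF g] .
  note c = GL_carrier[OF g] GL_carrier[OF N] GL_carrier[OF h(1)]
  have "N = g * (h * N)" using c h(2) by (simp flip: assoc_mult_mat[of g n n h n N n])
  moreover have "(h * N) $$ (r, k) = 0" if rk: "r < n" "k < n" "d k \<le> r" for r k
  proof -
    obtain x where x: "x \<in> carrier_vec n" "\<forall>r<n. d k \<le> r \<longrightarrow> x $ r = 0" "col N k = g *\<^sub>v x"
      using NF mem_flag_of_iff[OF c(1)] d rk(2) by blast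
    have "col (h * N) k = h *\<^sub>v (g *\<^sub>v x)" using x(3) col_mult2[OF c(3,2) rk(2)] by simp
    also have "\<dots> = (h * g) *\<^sub>v x" using c x(1) by simp
    also have "\<dots> = x" using h(3) x(1) by simp
    finally have "col (h * N) k $ r = 0" using x(2) rk by simp
    then show ?thesis using rk c by simp
  qed
  ultimately show ?thesis using that[of "h * N"] GL_mult[OF h(1) N] by blast
qed

text \<open>
  The key density statement. The coordinates of an adapted basis with respect to a flag range
  over the invertible matrices in a linear space of matrices, so any two points of an incidence
  variety can be joined by a line of such coordinates. A closed set that misses one end of this
  line meets it in finitely many points only.
\<close>

lemma incidence_subset_closure:
  assumes p: "p \<le> n" and d: "\<forall>k<n. d k \<le> n"
    and g1: "g1 \<in> GL n" "\<And>k. k < n \<Longrightarrow> unit_vec n k \<in> flag_of n g1 (d k)"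
    and Z: "closedin (zariski_flags n) Z" "flag_of n g1 \<notin> Z"
  shows "incidence n p d \<subseteq> zariski_flags n closure_of (incidence n p d - Z)"
proof
  fix F0 assume F0: "F0 \<in> incidence n p d"
  let ?C = "zariski_flags n closure_of (incidence n p d - Z)"
  show "F0 \<in> ?C"
  proof (rule ccontr)
    assume nC: "F0 \<notin> ?C"
    obtain P where P: "P \<subseteq> Collect (poly_fun n)" "{g \<in> GL n. flag_of n g \<in> ?C} = zero_locus n P"
    proof -
      have "closedin (zariski_flags n) ?C" by (rule closedin_closure_of)
      then show ?thesis using that unfolding closedin_zariski_flags_iff by blast
    qed
    obtain P' where P': "P' \<subseteq> Collect (poly_fun n)" "{g \<in> GL n. flag_of n g \<in> Z} = zero_locus n P'"
      using Z(1) by (auto simp: closedin_zariski_flags_iff)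
    have "F0 \<in> flags n" using F0 by (simp add: incidence_def)
    then obtain g0 where g0: "g0 \<in> GL n" "F0 = flag_of n g0" by (rule flags_eq_flag_of)
    obtain N0 where N0: "N0 \<in> GL n" "\<forall>k<n. col N0 k \<in> F0 (d k)"
        "\<forall>k<p. col N0 k \<in> E_first n p" "\<forall>k<n. p \<le> k \<longrightarrow> col N0 k \<in> E_last n (n - p)"
      using adapted_basis[OF F0 p d] .
    have N0F: "\<forall>k<n. col N0 k \<in> flag_of n g0 (d k)" using N0(2) g0(2) by simp
    obtain M0 where M0: "M0 \<in> GL n" "N0 = g0 * M0"
        "\<forall>r<n. \<forall>k<n. d k \<le> r \<longrightarrow> M0 $$ (r, k) = 0"
      using adapted_coordinates[OF g0(1) N0(1) d N0F] .
    have N1F: "\<forall>k<n. col (1\<^sub>m n) k \<in> flag_of n g1 (d k)" using g1(2) by simp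
    obtain M1 where M1: "M1 \<in> GL n" "1\<^sub>m n = g1 * M1"
        "\<forall>r<n. \<forall>k<n. d k \<le> r \<longrightarrow> M1 $$ (r, k) = 0"
      using adapted_coordinates[OF g1(1) GL_one d N1F] .
    note c = GL_carrier[OF g0(1)] GL_carrier[OF N0(1)] GL_carrier[OF M0(1)] GL_carrier[OF g1(1)]
      GL_carrier[OF M1(1)]
    \<comment> \<open>The coordinates move on a line from \<open>M0\<close> to \<open>M1\<close>. The adapted basis moves along with
    them, from \<open>N0\<close> to the standard basis; it stays adapted since its columns stay in their
    coordinate subspaces. Using the adjugate instead of the inverse multiplies \<open>h t\<close> by a
    scalar, which does not change its flag.\<close>
    define line :: "complex mat \<Rightarrow> complex mat \<Rightarrow> complex \<Rightarrow> complex mat" where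
      "line A B t = mat n n (\<lambda>ij. (1 - t) * A $$ ij + t * B $$ ij)" for A B t
    define M where "M = line M0 M1"
    define N where "N = line N0 (1\<^sub>m n)"
    define h where "h t = N t * adj_mat (M t)" for t
    have C: "N t \<in> carrier_mat n n" "M t \<in> carrier_mat n n" for t
      by (auto simp: N_def M_def line_def)
    have hC: "h t \<in> carrier_mat n n" for t unfolding h_def by (rule mult_carrier_mat[OF C(1) adj_mat(1)[OF C(2)]])
    have ends: "M 0 = M0" "M 1 = M1" "N 0 = N0" "N 1 = 1\<^sub>m n"
      using c by (auto simp: M_def N_def line_def intro!: eq_matI)
    have end_flag: "flag_of n (h t) = flag_of n g \<and> h t \<in> GL n"
      if "g \<in> GL n" "M t \<in> GL n" "N t = g * M t" for g t
    proof -
      note c' = GL_carrier[OF that(1)] GL_carrier[OF that(2)]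
      have "h t = g * (M t * adj_mat (M t))"
        unfolding h_def that(3) using c' adj_mat(1)[OF c'(2)] by (simp add: assoc_mult_mat[of g n n _ n _ n])
      also have "\<dots> = det (M t) \<cdot>\<^sub>m g" using adj_mat(2)[OF c'(2)] c'
        by (simp add: mult_smult_distrib[of g n n "1\<^sub>m n" n])
      finally show ?thesis
        using flag_of_smult[OF c'(1), of "det (M t)"] that by (auto simp: GL_iff)
    qed
    have h0: "flag_of n (h 0) = F0" "h 0 \<in> GL n" using end_flag[of g0 0] g0 M0 ends by auto
    have h1: "flag_of n (h 1) = flag_of n g1" "h 1 \<in> GL n" using end_flag[of g1 1] g1 M1 ends by auto
    have line_entry: "poly_curve (\<lambda>t. line A B t $$ (i, j))" if "i < n" "j < n" for A B i j
      using that by (simp add: line_def poly_curve_line)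
    have entry: "poly_curve (\<lambda>t. N t $$ (i, j))" "poly_curve (\<lambda>t. M t $$ (i, j))"
      if "i < n" "j < n" for i j
      unfolding N_def M_def by (rule line_entry[OF that])+
    have h_entry: "poly_curve (\<lambda>t. h t $$ (i, j))" if "i < n" "j < n" for i j
      unfolding h_def using that C entry
      by (intro curve.mat_mult[where m = n and n = n and l = n] curve.adj_mat[where n = n]) (auto simp: adj_mat(1))
    obtain f where f: "f \<in> P" "f (h 0) \<noteq> 0"
    proof -
      have "h 0 \<notin> zero_locus n P" using h0(1) nC unfolding P(2)[symmetric] by simp
      then show ?thesis using that h0(2) unfolding zero_locus_def by blast
    qed
    obtain f' where f': "f' \<in> P'" "f' (h 1) \<noteq> 0"
    proof -
      have "h 1 \<notin> zero_locus n P'" using h1(1) Z(2) unfolding P'(2)[symmetric] by simp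
      then show ?thesis using that h1(2) unfolding zero_locus_def by blast
    qed
    have "finite {t. f (h t) = 0}"
    proof (rule poly_curve_finite_zeros)
      show "poly_curve (\<lambda>t. f (h t))"
        using f(1) P(1) h_entry by (intro poly_fun_along_curve[where f = f and c = h and n = n]) auto
    qed (rule f(2))
    moreover have "finite {t. f' (h t) = 0}"
    proof (rule poly_curve_finite_zeros)
      show "poly_curve (\<lambda>t. f' (h t))"
        using f'(1) P'(1) h_entry by (intro poly_fun_along_curve[where f = f' and c = h and n = n]) auto
    qed (rule f'(2))
    moreover have "finite {t. det (N t) = 0}"
    proof (rule poly_curve_finite_zeros)
      show "poly_curve (\<lambda>t. det (N t))" by (rule curve.det[OF C(1) entry(1)])
      show "det (N 0) \<noteq> 0" using ends N0(1) by (simp add: GL_iff)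
    qed
    moreover have "finite {t. det (M t) = 0}"
    proof (rule poly_curve_finite_zeros)
      show "poly_curve (\<lambda>t. det (M t))" by (rule curve.det[OF C(2) entry(2)])
      show "det (M 0) \<noteq> 0" using ends M0(1) by (simp add: GL_iff)
    qed
    ultimately have "finite ({t. f (h t) = 0} \<union> {t. f' (h t) = 0} \<union> {t. det (N t) = 0} \<union> {t. det (M t) = 0})"
      by blast
    then have "\<exists>t. t \<notin> {t. f (h t) = 0} \<union> {t. f' (h t) = 0} \<union> {t. det (N t) = 0} \<union> {t. det (M t) = 0}"
      by (rule ex_new_if_finite[OF infinite_UNIV_char_0])
    then obtain t where t: "f (h t) \<noteq> 0" "f' (h t) \<noteq> 0" "det (N t) \<noteq> 0" "det (M t) \<noteq> 0"
      by blast
    \<comment> \<open>For this \<open>t\<close> the flag of \<open>h t\<close> is again in the incidence variety: by \<open>hM\<close>, the coordinates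
    of the columns of \<open>N t\<close> are those of \<open>M t\<close>, up to the scalar.\<close>
    have hM: "h t * M t = det (M t) \<cdot>\<^sub>m N t"
      unfolding h_def using C[of t] adj_mat[OF C(2), of t]
      by (simp add: assoc_mult_mat[of "N t" n n _ n "M t" n] mult_smult_distrib[of "N t" n n "1\<^sub>m n" n])
    have "det (h t) * det (M t) = det (M t) ^ n * det (N t)"
      using det_mult[OF hC C(2), of t t] hM C(1)[of t] by (simp add: det_smult)
    then have hG: "h t \<in> GL n" using t(3,4) hC[of t] by (auto simp: GL_iff)
    have "flag_of n (h t) \<in> incidence n p d"
    proof (rule incidenceI[OF flag_of_in_flags[OF hG] p])
      show "N t \<in> GL n" using t(3) C by (simp add: GL_iff)
      show "col (N t) k \<in> flag_of n (h t) (d k)" if k: "k < n" "d k \<le> n" for k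
      proof -
        let ?x = "(1 / det (M t)) \<cdot>\<^sub>v col (M t) k"
        have "h t *\<^sub>v ?x = (1 / det (M t)) \<cdot>\<^sub>v col (h t * M t) k"
          unfolding col_mult2[OF hC C(2) k(1)] using col_carrier[OF C(2)] by (rule mult_mat_vec[OF hC])
        also have "\<dots> = col (N t) k"
          unfolding hM using k C(1)[of t] t(4) by (intro eq_vecI) auto
        finally have "col (N t) k = h t *\<^sub>v ?x" ..
        moreover have "?x $ r = 0" if "r < n" "d k \<le> r" for r
          using that k C(2)[of t] M0(3) M1(3)
          by (simp add: M_def line_def)
        moreover have "?x \<in> carrier_vec n" using carrier_matD(1)[OF C(2)[of t]] by (intro carrier_vecI) simp
        ultimately show ?thesis using mem_flag_of_iff[OF hC k(2)] by blast
      qed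
      show "col (N t) k \<in> E_first n p" if k: "k < p" for k
        using N0(3) k p c(2) by (auto simp: E_first_eq N_def line_def)
      show "col (N t) k \<in> E_last n (n - p)" if k: "p \<le> k" "k < n" for k
        using N0(4) k p c(2) by (auto simp: E_last_eq N_def line_def)
    qed
    moreover have "flag_of n (h t) \<notin> Z"
    proof
      assume "flag_of n (h t) \<in> Z"
      then have "h t \<in> zero_locus n P'" using P'(2) hG by blast
      then show False using f'(1) t(2) by (simp add: zero_locus_def)
    qed
    ultimately have "flag_of n (h t) \<in> incidence n p d - Z" by simp
    then have "flag_of n (h t) \<in> ?C"
      using closure_of_subset_Int[of "zariski_flags n" "incidence n p d - Z"] flag_of_in_flags[OF hG]
      by (auto simp: topspace_zariski_flags)
    then have "h t \<in> zero_locus n P" using P(2) hG by blast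
    then show False using f(1) t(1) by (simp add: zero_locus_def)
  qed
qed

section \<open>Schubert varieties of maximal coset representatives\<close>

text \<open>
  The largest permutation \<open>w\<close> in the Bruhat order for which \<open>S\<close> is the set of positions of the
  values below \<open>p = card S\<close>: both the small and the large values are decreasing.
\<close>

definition coset_max :: "nat \<Rightarrow> nat \<Rightarrow> nat set \<Rightarrow> nat \<Rightarrow> nat" where
  "coset_max n p S i =
     (if n \<le> i then i
      else if i \<in> S then p - 1 - card {j \<in> S. j < i}
      else n - 1 - card {j. j \<notin> S \<and> j < i})"

context
  fixes n p :: nat and S :: "nat set"
  assumes S: "S \<subseteq> {..<n}" and cS: "card S = p"
begin

lemma finite_S: "finite S" and p_le_n: "p \<le> n"
  using S cS card_mono[of "{..<n}" S] by (auto intro: finite_subset)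

lemma card_not_S: "card {j. j \<notin> S \<and> j < n} = n - p"
proof -
  have "{j. j \<notin> S \<and> j < n} = {..<n} - S" by auto
  then show ?thesis using S cS finite_S by (simp add: card_Diff_subset)
qed

lemma card_S_less: "i \<in> S \<Longrightarrow> card {j \<in> S. j < i} < p"
  using psubset_card_mono[of S "{j \<in> S. j < i}"] finite_S cS by auto

lemma card_not_S_less: "i < n \<Longrightarrow> i \<notin> S \<Longrightarrow> card {j. j \<notin> S \<and> j < i} < n - p"
proof -
  assume "i < n" "i \<notin> S"
  then have "card {j. j \<notin> S \<and> j < i} < card {j. j \<notin> S \<and> j < n}"
    by (intro psubset_card_mono) auto
  then show ?thesis using card_not_S by simp
qed

lemma coset_max_S: "i \<in> S \<Longrightarrow> coset_max n p S i < p"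
  and coset_max_S_eq: "i \<in> S \<Longrightarrow> card {j \<in> S. j < i} + coset_max n p S i = p - 1"
  using S card_S_less[of i] by (auto simp: coset_max_def)

lemma coset_max_not_S: "i < n \<Longrightarrow> i \<notin> S \<Longrightarrow> p \<le> coset_max n p S i \<and> coset_max n p S i < n"
  and coset_max_not_S_eq:
    "i < n \<Longrightarrow> i \<notin> S \<Longrightarrow> card {j. j \<notin> S \<and> j < i} + coset_max n p S i = n - 1"
  using card_not_S_less[of i] by (auto simp: coset_max_def)

lemma coset_max_less: "i < n \<Longrightarrow> coset_max n p S i < n"
  using coset_max_S[of i] coset_max_not_S[of i] p_le_n by (cases "i \<in> S") auto

lemma coset_max_less_p_iff: "i < n \<Longrightarrow> coset_max n p S i < p \<longleftrightarrow> i \<in> S"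
  using coset_max_S[of i] coset_max_not_S[of i] by (cases "i \<in> S") auto

lemma coset_max_decreasing:
  assumes "i < j" "j < n" "i \<in> S \<longleftrightarrow> j \<in> S"
  shows "coset_max n p S j < coset_max n p S i"
proof (cases "j \<in> S")
  case True
  have "card {l \<in> S. l < i} < card {l \<in> S. l < j}"
    using assms True finite_S by (intro psubset_card_mono) auto
  then show ?thesis using coset_max_S_eq[of i] coset_max_S_eq[of j] assms True by auto
next
  case False
  have "card {l. l \<notin> S \<and> l < i} < card {l. l \<notin> S \<and> l < j}"
    using assms False by (intro psubset_card_mono) auto
  then show ?thesis using coset_max_not_S_eq[of i] coset_max_not_S_eq[of j] assms False by auto
qed

lemma bij_coset_max: "bij_betw (coset_max n p S) {..<n} {..<n}"
proof -
  have "inj_on (coset_max n p S) {..<n}"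
  proof (rule linorder_inj_onI)
    fix i j assume "i < j" "i \<in> {..<n}" "j \<in> {..<n}"
    then show "coset_max n p S i \<noteq> coset_max n p S j"
      using coset_max_decreasing[of i j] coset_max_less_p_iff[of i] coset_max_less_p_iff[of j]
      by (cases "i \<in> S \<longleftrightarrow> j \<in> S") auto
  qed auto
  moreover have "coset_max n p S ` {..<n} \<subseteq> {..<n}" using coset_max_less by auto
  ultimately show ?thesis unfolding bij_betw_def using endo_inj_surj[of "{..<n}"] by blast
qed

lemma inverse_coset_max:
  obtains e where "bij_betw e {..<n} {..<n}" "\<forall>k<n. coset_max n p S (e k) = k"
    "\<forall>i<n. e (coset_max n p S i) = i" "bij_betw e {..<p} S"
proof -
  let ?u = "coset_max n p S"
  let ?e = "inv_into {..<n} ?u"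
  have b: "bij_betw ?e {..<n} {..<n}" using bij_coset_max by (rule bij_betw_inv_into)
  have ue: "\<forall>k<n. ?u (?e k) = k" using bij_betw_inv_into_right[OF bij_coset_max] by simp
  have eu: "\<forall>i<n. ?e (?u i) = i" using bij_betw_inv_into_left[OF bij_coset_max] by simp
  have "?e ` {..<p} = S"
  proof (intro equalityI subsetI)
    fix i assume "i \<in> ?e ` {..<p}"
    then obtain k where k: "k < p" "i = ?e k" by auto
    then have "k < n" using p_le_n by simp
    then have "i < n" "?u i < p" using b ue k by (auto dest: bij_betwE)
    then show "i \<in> S" using coset_max_less_p_iff by simp
  next
    fix i assume i: "i \<in> S"
    then have "i = ?e (?u i)" using eu S by auto
    then show "i \<in> ?e ` {..<p}" using coset_max_S[OF i] by blast
  qed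
  then have "bij_betw ?e {..<p} S" using bij_betw_subset[OF b, of "{..<p}"] p_le_n by auto
  then show ?thesis using that[of ?e] b ue eu by blast
qed

end

lemma perm_matrix_carrier: "perm_matrix n w \<in> carrier_mat n n"
  by (simp add: perm_matrix_def)

lemma col_perm_matrix: "j < n \<Longrightarrow> col (perm_matrix n w) j = unit_vec n (w j)"
  by (intro eq_vecI) (auto simp: perm_matrix_def unit_vec_def)

lemma perm_matrix_GL:
  assumes "bij_betw w {..<n} {..<n}"
  shows "perm_matrix n w \<in> GL n"
proof -
  have wn: "w ` {..<n} = {..<n}" using assms by (simp add: bij_betw_def)
  have "cspan n (col (perm_matrix n w) ` {..<n}) = cspan n (unit_vec n ` w ` {..<n})"
    unfolding image_image by (intro arg_cong[of _ _ "cspan n"] image_cong) (auto simp: col_perm_matrix)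
  also have "\<dots> = cspan n (col (1\<^sub>m n) ` {..<n})"
    unfolding wn by (intro arg_cong[of _ _ "cspan n"] image_cong) auto
  also have "\<dots> = carrier_vec n" by (rule GL_columns(3)[OF GL_one])
  finally have sp: "cspan n (col (perm_matrix n w) ` {..<n}) = carrier_vec n" .
  have C: "col (perm_matrix n w) k \<in> carrier_vec n" for k by (rule col_carrier[OF perm_matrix_carrier])
  obtain g where g: "g \<in> GL n" "\<And>k. k < n \<Longrightarrow> col g k = col (perm_matrix n w) k"
    using GL_of_spanning_columns[of n "col (perm_matrix n w)"] C sp by blast
  have "g = perm_matrix n w"
    using g GL_carrier[OF g(1)] perm_matrix_carrier[of n w] by (intro mat_col_eqI) auto
  then show ?thesis using g by simp
qed

lemma borel_upper_GL: "b \<in> borel_upper n \<Longrightarrow> b \<in> GL n"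
  by (simp add: borel_upper_def)

lemma one_borel_upper: "1\<^sub>m n \<in> borel_upper n"
  by (auto simp: borel_upper_def GL_one)

lemma flag_of_mult_borel_upper:
  assumes g: "g \<in> GL n" and b: "b \<in> borel_upper n"
  shows "flag_of n (g * b) = flag_of n g"
proof (rule flag_of_eqI[OF flag_of_in_flags[OF g]])
  have bG: "b \<in> GL n" using b borel_upper_GL by blast
  note c = GL_carrier[OF g] GL_carrier[OF bG]
  show "g * b \<in> GL n" using g bG by (rule GL_mult)
  show "col (g * b) m \<in> flag_of n g (Suc m)" if m: "m < n" for m
  proof -
    have "\<forall>r<n. Suc m \<le> r \<longrightarrow> col b m $ r = 0" using b c m by (auto simp: borel_upper_def)
    moreover have "col (g * b) m = g *\<^sub>v col b m" using col_mult2[OF c m] .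
    moreover have "col b m \<in> carrier_vec n" using c(2) by (rule col_carrier)
    ultimately show ?thesis using mem_flag_of_iff[OF c(1), of "Suc m"] m by auto
  qed
qed

lemma col_mult_perm_matrix:
  assumes "g \<in> carrier_mat n n" "j < n" "w j < n"
  shows "col (g * perm_matrix n w) j = col g (w j)"
  unfolding col_mult2[OF assms(1) perm_matrix_carrier assms(2)] col_perm_matrix[OF assms(2)]
  by (rule mult_mat_vec_unit[OF assms(1,3)])

lemma card_bound_via_bij:
  assumes "bij_betw e K S"
  shows "card {k \<in> K. Suc (e k) \<le> i} = card {j \<in> S. j < i}"
proof (rule bij_betw_same_card)
  show "bij_betw e {k \<in> K. Suc (e k) \<le> i} {j \<in> S. j < i}"
    using assms unfolding bij_betw_def by (auto simp: inj_on_def image_iff Suc_le_eq)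
qed

text \<open>
  The vectors that witness the jumps, sorted by the values of \<open>w\<close>, are the columns of an upper
  triangular matrix.
\<close>

lemma in_bruhat_cell_if_jumps:
  assumes F: "F \<in> flags n" and w: "bij_betw w {..<n} {..<n}"
    and jump: "\<And>m. m < n \<Longrightarrow>
      cdim n (F (Suc m) \<inter> E_first n (w m)) < cdim n (F (Suc m) \<inter> E_first n (Suc (w m)))"
  obtains b where "b \<in> borel_upper n" "F = flag_of n (b * perm_matrix n w)"
proof -
  have wn: "w m < n" if "m < n" for m using w that by (auto dest: bij_betwE)
  have "\<exists>z. z \<in> F (Suc m) \<and> z \<in> E_first n (Suc (w m)) \<and> z $ w m \<noteq> 0" if m: "m < n" for m
  proof -
    have s: "csubspace n (F (Suc m) \<inter> E_first n j)" for j
      using m by (intro csubspace_Int flags_subspace[OF F] csubspace_E_first) auto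
    have "\<not> F (Suc m) \<inter> E_first n (Suc (w m)) \<subseteq> F (Suc m) \<inter> E_first n (w m)"
      using cdim_mono[OF s s] jump[OF m] by (meson linorder_not_less)
    then obtain z where z: "z \<in> F (Suc m)" "z \<in> E_first n (Suc (w m))" "z \<notin> E_first n (w m)" by auto
    then have "z $ w m \<noteq> 0" by (auto simp: E_first_eq Suc_le_eq le_less)
    then show ?thesis using z by blast
  qed
  then obtain z where z: "\<And>m. m < n \<Longrightarrow> z m \<in> F (Suc m) \<and> z m \<in> E_first n (Suc (w m)) \<and> z m $ w m \<noteq> 0"
    by metis
  let ?e = "inv_into {..<n} w"
  have e: "?e k < n" "w (?e k) = k" if "k < n" for k
    using that bij_betw_inv_into_right[OF w] bij_betw_inv_into[OF w] by (auto dest: bij_betwE)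
  have ew: "?e (w m) = m" if "m < n" for m using bij_betw_inv_into_left[OF w] that by simp
  define b where "b = mat n n (\<lambda>(i, k). z (?e k) $ i)"
  have bc: "b \<in> carrier_mat n n" by (simp add: b_def)
  have up: "b $$ (i, k) = 0" if "i < n" "k < n" "k < i" for i k
    using z[OF e(1)[OF that(2)]] e(2)[OF that(2)] that by (auto simp: b_def E_first_eq)
  have "upper_triangular b" using up bc by auto
  then have "det b = prod_list (diag_mat b)" using bc by (rule det_upper_triangular)
  moreover have "0 \<notin> set (diag_mat b)"
  proof -
    have "b $$ (k, k) \<noteq> 0" if "k < n" for k
      using z[OF e(1)[OF that]] e(2)[OF that] that by (simp add: b_def)
    then show ?thesis using bc by (auto simp: diag_mat_def)
  qed
  ultimately have "det b \<noteq> 0" by (simp add: prod_list_zero_iff)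
  then have bG: "b \<in> GL n" using bc by (simp add: GL_iff)
  then have bB: "b \<in> borel_upper n" using up by (auto simp: borel_upper_def)
  have "flag_of n (b * perm_matrix n w) = F"
  proof (rule flag_of_eqI[OF F GL_mult[OF bG perm_matrix_GL[OF w]]])
    fix m assume m: "m < n"
    have "z m \<in> carrier_vec n" using z[OF m] by (auto simp: E_first_eq)
    then have "col b (w m) = z m" using wn[OF m] ew[OF m] by (intro eq_vecI) (auto simp: b_def)
    then show "col (b * perm_matrix n w) m \<in> F (Suc m)"
      using col_mult_perm_matrix[where w = w, OF bc m wn[OF m]] z[OF m] by simp
  qed
  then show ?thesis using that[OF bB] by blast
qed

text \<open>
  The unit vectors in \<open>F i + E_first n k\<close> are counted by inclusion and exclusion.
\<close>

lemma flag_of_perm_cdim_Int_le: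
  assumes w: "bij_betw w {..<n} {..<n}" and "i \<le> n" "k \<le> n"
  shows "cdim n (flag_of n (perm_matrix n w) i \<inter> E_first n k) \<le> card (w ` {..<i} \<inter> {..<k})"
proof -
  let ?F = "flag_of n (perm_matrix n w) i"
  have pG: "perm_matrix n w \<in> GL n" using w by (rule perm_matrix_GL)
  note c = GL_carrier[OF pG]
  have sF: "csubspace n ?F" using csubspace_flag_of[OF c assms(2)] .
  have C: "?F \<union> E_first n k \<subseteq> carrier_vec n" using csubspace_carrier[OF sF] E_first_carrier by auto
  have wi: "w ` {..<i} \<subseteq> {..<n}" using w assms(2) by (auto dest: bij_betwE)
  have "cdim n (?F \<inter> E_first n k) + card (w ` {..<i} \<union> {..<k}) \<le> cdim n ?F + cdim n (E_first n k)"
  proof (rule cdim_Int_le_if_units_in_sum[OF sF csubspace_E_first])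
    show "w ` {..<i} \<union> {..<k} \<subseteq> {..<n}" using wi assms by auto
    fix l assume "l \<in> w ` {..<i} \<union> {..<k}"
    then consider m where "m < i" "l = w m" | "l < k" by auto
    then have "unit_vec n l \<in> ?F \<union> E_first n k"
    proof cases
      case 1
      then show ?thesis using col_in_flag_of[OF c 1(1) assms(2)] col_perm_matrix[of m n w] assms by auto
    qed (use assms in \<open>auto simp: E_first_eq\<close>)
    then show "unit_vec n l \<in> cspan n (?F \<union> E_first n k)" using cspan_superset[OF C] by auto
  qed
  moreover have "card (w ` {..<i}) = i"
    using card_image[OF inj_on_subset[OF bij_betw_imp_inj_on[OF w]], of "{..<i}"] assms(2) by simp
  moreover have "card (w ` {..<i} \<union> {..<k}) + card (w ` {..<i} \<inter> {..<k}) = card (w ` {..<i}) + card {..<k}"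
    using card_Un_Int[of "w ` {..<i}" "{..<k}"] by simp
  ultimately show ?thesis
    using cdim_flag_of[OF pG assms(2)] cdim_E_first[OF assms(3)] by simp
qed

text \<open>
  The columns of \<open>b\<close> with index below \<open>p\<close> lie in \<open>E_first n p\<close>, and those whose index is a value
  of the permutation before position \<open>i\<close> lie in the \<open>i\<close>-th member of the flag.
\<close>

lemma bruhat_cell_coset_max:
  assumes S: "S \<subseteq> {..<n}" and cS: "card S = p" and b: "b \<in> borel_upper n" and i: "i \<le> n"
  shows "card {j \<in> S. j < i} \<le> cdim n (flag_of n (b * perm_matrix n (coset_max n p S)) i \<inter> E_first n p)"
proof -
  let ?u = "coset_max n p S"
  let ?F = "flag_of n (b * perm_matrix n ?u)"
  note u = bij_coset_max[OF S cS] and ul = coset_max_less[OF S cS] and up_iff = coset_max_less_p_iff[OF S cS]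
  have bG: "b \<in> GL n" using b borel_upper_GL by blast
  note bc = GL_carrier[OF bG]
  have gG: "b * perm_matrix n ?u \<in> GL n" using bG perm_matrix_GL[OF u] by (rule GL_mult)
  note gc = GL_carrier[OF gG]
  let ?J = "{j \<in> S. j < i}"
  have Jn: "?u ` ?J \<subseteq> {..<n}" "?J \<subseteq> {..<n}" using ul S by auto
  have "col b ` ?u ` ?J \<subseteq> ?F i \<inter> E_first n p"
  proof
    fix x assume "x \<in> col b ` ?u ` ?J"
    then obtain j where j: "j \<in> S" "j < i" "x = col b (?u j)" by auto
    have jn: "j < n" using j i by simp
    have "x \<in> ?F i"
      using col_in_flag_of[OF gc j(2) i] col_mult_perm_matrix[where w = ?u, OF bc jn ul[OF jn]] j(3) by simp
    moreover have "x \<in> E_first n p"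
      using b bc up_iff[OF jn] ul[OF jn] j by (auto simp: E_first_eq borel_upper_def)
    ultimately show "x \<in> ?F i \<inter> E_first n p" by simp
  qed
  then have "card (col b ` ?u ` ?J) \<le> cdim n (?F i \<inter> E_first n p)"
    using i by (intro cindep_card_le_cdim csubspace_Int csubspace_flag_of[OF gc] csubspace_E_first
        cindep_subset[OF GL_columns(2)[OF bG] image_mono[OF Jn(1)]]) auto
  moreover have "card (col b ` ?u ` ?J) = card ?J"
    using card_image[OF inj_on_subset[OF GL_columns(1)[OF bG] Jn(1)]]
      card_image[OF inj_on_subset[OF bij_betw_imp_inj_on[OF u] Jn(2)]] by simp
  ultimately show ?thesis by simp
qed

text \<open>
  Let \<open>u\<close> be the representative. A small value of \<open>u\<close> precedes all smaller ones, and inside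
  \<open>E_first n p\<close> the flag is large enough to meet \<open>E_first n (Suc (u m))\<close>. Before a large value, only
  the small values are smaller, and the expected dimension in the whole space is one more than
  their number.
\<close>

lemma coset_max_jump:
  assumes S: "S \<subseteq> {..<n}" and cS: "card S = p" and Ff: "F \<in> flags n"
    and ge: "\<And>i. i \<le> n \<Longrightarrow> card {j \<in> S. j < i} \<le> cdim n (F i \<inter> E_first n p)"
    and m: "m < n"
  shows "card (coset_max n p S ` {..<Suc m} \<inter> {..<coset_max n p S m})
    < cdim n (F (Suc m) \<inter> E_first n (Suc (coset_max n p S m)))"
    (is "?r < _")
proof -
  let ?u = "coset_max n p S"
  note pn = p_le_n[OF S cS] and ul = coset_max_less[OF S cS] and up_iff = coset_max_less_p_iff[OF S cS]
  show ?thesis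
  proof (cases "m \<in> S")
    case True
    have "?u ` {..<Suc m} \<inter> {..<?u m} = {}"
    proof -
      have False if l: "l \<le> m" "?u l < ?u m" for l
      proof -
        have "l < n" "?u l < p" using l m up_iff[OF m] True by auto
        then have "l \<in> S" "l \<noteq> m" using up_iff l by auto
        then show False using coset_max_decreasing[OF S cS, of l m] l m True by auto
      qed
      then show ?thesis by (auto simp: less_Suc_eq_le)
    qed
    then have r0: "?r = 0" by simp
    have um: "?u m < p" using up_iff[OF m] True by simp
    have "{j \<in> S. j < Suc m} = insert m {j \<in> S. j < m}" using True by auto
    then have "card {j \<in> S. j < Suc m} = Suc (card {j \<in> S. j < m})" using finite_S[OF S cS] by simp
    then have cSm: "card {j \<in> S. j < Suc m} = p - ?u m"
      using coset_max_S_eq[OF S cS True] um by simp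
    have "cdim n (F (Suc m) \<inter> E_first n p) + cdim n (E_first n (Suc (?u m)))
        \<le> cdim n (F (Suc m) \<inter> E_first n p \<inter> E_first n (Suc (?u m))) + cdim n (E_first n p)"
      using m E_first_mono[of "Suc (?u m)" p n] um
      by (intro cdim_Int_ge csubspace_Int flags_subspace[OF Ff] csubspace_E_first) auto
    moreover have "F (Suc m) \<inter> E_first n p \<inter> E_first n (Suc (?u m)) = F (Suc m) \<inter> E_first n (Suc (?u m))"
      using E_first_mono[of "Suc (?u m)" p n] um by auto
    ultimately show ?thesis
      using r0 ge[of "Suc m"] cSm m um pn cdim_E_first[of p n] cdim_E_first[of "Suc (?u m)" n] by simp
  next
    case False
    have "?u ` {..<Suc m} \<inter> {..<?u m} \<subseteq> ?u ` {j \<in> S. j < Suc m}"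
    proof
      fix x assume "x \<in> ?u ` {..<Suc m} \<inter> {..<?u m}"
      then obtain l where l: "l \<le> m" "x = ?u l" "?u l < ?u m" by (auto simp: less_Suc_eq_le)
      then have "l < m" by (cases "l = m") auto
      then have "l \<in> S" using coset_max_decreasing[OF S cS, of l m] l m False by fastforce
      then show "x \<in> ?u ` {j \<in> S. j < Suc m}" using l by auto
    qed
    then have rle: "?r \<le> card {j \<in> S. j < Suc m}"
      using finite_S[OF S cS] by (intro surj_card_le) auto
    have "{j. j \<notin> S \<and> j < Suc m} = insert m {j. j \<notin> S \<and> j < m}" using False by auto
    then have "card {j. j \<notin> S \<and> j < Suc m} = Suc (card {j. j \<notin> S \<and> j < m})" by simp
    moreover have "card {j \<in> S. j < Suc m} + card {j. j \<notin> S \<and> j < Suc m} = Suc m"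
    proof -
      have "card ({j \<in> S. j < Suc m} \<union> {j. j \<notin> S \<and> j < Suc m}) =
          card {j \<in> S. j < Suc m} + card {j. j \<notin> S \<and> j < Suc m}"
        using finite_S[OF S cS] by (intro card_Un_disjoint) auto
      moreover have "{j \<in> S. j < Suc m} \<union> {j. j \<notin> S \<and> j < Suc m} = {..<Suc m}" by auto
      ultimately show ?thesis by simp
    qed
    ultimately have cSm: "card {j \<in> S. j < Suc m} + n = Suc m + ?u m"
      using coset_max_not_S_eq[OF S cS m False] m by simp
    have "cdim n (F (Suc m)) + cdim n (E_first n (Suc (?u m)))
        \<le> cdim n (F (Suc m) \<inter> E_first n (Suc (?u m))) + cdim n (carrier_vec n)"
      using m csubspace_carrier[OF flags_subspace[OF Ff, of "Suc m"]] E_first_carrier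
      by (intro cdim_Int_ge flags_subspace[OF Ff] csubspace_E_first csubspace_carrier_vec) auto
    then show ?thesis
      using rle cSm m ul[OF m] flags_cdim[OF Ff, of "Suc m"] cdim_E_first[of "Suc (?u m)" n]
      by (simp add: cdim_carrier_vec)
  qed
qed

text \<open>
  The rank conditions for the single subspace \<open>E_first n p\<close> imply the lower bounds needed for all
  the jumps. The matching upper bounds hold outside a closed set that misses the flag of the
  representative itself. So the Bruhat cell is dense in the set defined by the rank conditions.
\<close>

lemma schubert_coset_max:
  assumes S: "S \<subseteq> {..<n}" and cS: "card S = p"
  shows "schubert n (coset_max n p S) =
    {F \<in> flags n. \<forall>i\<le>n. card {j \<in> S. j < i} \<le> cdim n (F i \<inter> E_first n p)}"
    (is "_ = ?\<Omega>")
proof (rule antisym)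
  let ?u = "coset_max n p S" and ?B = "{flag_of n (b * perm_matrix n (coset_max n p S) * b') | b b'.
    b \<in> borel_upper n \<and> b' \<in> borel_upper n}"
  note pn = p_le_n[OF S cS] and u = bij_coset_max[OF S cS] and ul = coset_max_less[OF S cS]
  have uG: "perm_matrix n ?u \<in> GL n" using u by (rule perm_matrix_GL)
  have B_eq: "flag_of n (b * perm_matrix n ?u * b') = flag_of n (b * perm_matrix n ?u)"
    if "b \<in> borel_upper n" "b' \<in> borel_upper n" for b b'
    using that by (intro flag_of_mult_borel_upper GL_mult uG borel_upper_GL)
  have "closedin (zariski_flags n) (\<Inter>i\<in>{..n}. {F \<in> flags n. card {j \<in> S. j < i} \<le> cdim n (F i \<inter> E_first n p)})"
    by (intro closedin_INT closedin_flags_cdim_Int_ge csubspace_E_first) auto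
  also have "(\<Inter>i\<in>{..n}. {F \<in> flags n. card {j \<in> S. j < i} \<le> cdim n (F i \<inter> E_first n p)}) = ?\<Omega>" by auto
  finally have closed: "closedin (zariski_flags n) ?\<Omega>" .
  have "?B \<subseteq> ?\<Omega>"
  proof
    fix F assume "F \<in> ?B"
    then obtain b where b: "b \<in> borel_upper n" and F: "F = flag_of n (b * perm_matrix n ?u)" using B_eq by auto
    have gG: "b * perm_matrix n ?u \<in> GL n" using borel_upper_GL[OF b] uG by (rule GL_mult)
    have Ff: "F \<in> flags n" using F flag_of_in_flags[OF gG] by simp
    have "card {j \<in> S. j < i} \<le> cdim n (F i \<inter> E_first n p)" if i: "i \<le> n" for i
      unfolding F by (rule bruhat_cell_coset_max[OF S cS b i])
    then show "F \<in> ?\<Omega>" using Ff by simp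
  qed
  then show "schubert n ?u \<subseteq> ?\<Omega>"
    unfolding schubert_def by (rule closure_of_minimal[OF _ closed])
  show "?\<Omega> \<subseteq> schubert n ?u"
  proof -
    obtain e where e: "bij_betw e {..<n} {..<n}" "\<forall>k<n. ?u (e k) = k" "\<forall>i<n. e (?u i) = i"
        "bij_betw e {..<p} S"
      using inverse_coset_max[OF S cS] .
    have en: "e k < n" if "k < n" for k using e(1) that by (auto dest: bij_betwE)
    \<comment> \<open>The \<open>k\<close>-th basis vector of \<open>E_first n p\<close> lies in the flag of \<open>u\<close> from the position of the
    value \<open>k\<close> onwards.\<close>
    define d where "d k = (if k < p then Suc (e k) else n)" for k
    have cd: "card {k \<in> {..<p}. d k \<le> i} = card {j \<in> S. j < i}" for i
    proof -
      have "{k \<in> {..<p}. d k \<le> i} = {k \<in> {..<p}. Suc (e k) \<le> i}" by (auto simp: d_def)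
      then show ?thesis using card_bound_via_bij[OF e(4)] by simp
    qed
    have "?\<Omega> \<subseteq> incidence n p d"
    proof
      fix F assume F: "F \<in> ?\<Omega>"
      have "card {k \<in> {p..<n}. d k \<le> i} \<le> cdim n (F i \<inter> E_last n (n - p))" if i: "i \<le> n" for i
      proof (cases "i = n")
        case True
        have "F n \<inter> E_last n (n - p) = E_last n (n - p)"
          using flags_top[of F n] F by (auto simp: E_last_eq)
        moreover have "card {k \<in> {p..<n}. d k \<le> n} \<le> card {p..<n}" by (intro card_mono) auto
        ultimately show ?thesis using True cdim_E_last[of "n - p" n] by simp
      next
        case False
        then have "{k \<in> {p..<n}. d k \<le> i} = {}" using i by (auto simp: d_def)
        then show ?thesis by (simp only: card.empty)
      qed
      then show "F \<in> incidence n p d" using F cd by (simp add: incidence_def)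
    qed
    \<comment> \<open>The number \<open>r m\<close> is the dimension at the flag of \<open>u\<close>, and \<open>Z\<close> is where it is exceeded.\<close>
    define r where "r m = card (?u ` {..<Suc m} \<inter> {..<?u m})" for m
    define Z where "Z = (\<Union>m\<in>{..<n}. {F \<in> flags n. Suc (r m) \<le> cdim n (F (Suc m) \<inter> E_first n (?u m))})"
    have "incidence n p d \<subseteq> zariski_flags n closure_of (incidence n p d - Z)"
    proof (rule incidence_subset_closure[OF pn _ uG])
      show "\<forall>k<n. d k \<le> n" using en pn by (auto simp: d_def Suc_le_eq)
      show "unit_vec n k \<in> flag_of n (perm_matrix n ?u) (d k)" if k: "k < n" for k
      proof (cases "k < p")
        case True
        have "col (perm_matrix n ?u) (e k) \<in> flag_of n (perm_matrix n ?u) (Suc (e k))"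
          using en[OF k] by (intro col_in_flag_of perm_matrix_carrier) auto
        then show ?thesis using True en[OF k] e(2) k by (simp add: d_def col_perm_matrix)
      next
        case False
        then show ?thesis using flags_top[OF flag_of_in_flags[OF uG]] by (simp add: d_def)
      qed
      show "closedin (zariski_flags n) Z"
        unfolding Z_def by (intro closedin_Union) (auto intro!: closedin_flags_cdim_Int_ge csubspace_E_first)
      show "flag_of n (perm_matrix n ?u) \<notin> Z"
      proof
        assume "flag_of n (perm_matrix n ?u) \<in> Z"
        then obtain m where m: "m < n" "Suc (r m) \<le> cdim n (flag_of n (perm_matrix n ?u) (Suc m) \<inter> E_first n (?u m))"
          by (auto simp: Z_def)
        then show False
          using flag_of_perm_cdim_Int_le[OF u, of "Suc m" "?u m"] ul[OF m(1)] by (simp add: r_def)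
      qed
    qed
    moreover have "incidence n p d - Z \<subseteq> ?B"
    proof
      fix F assume F: "F \<in> incidence n p d - Z"
      then have Ff: "F \<in> flags n"
        and ge: "\<And>i. i \<le> n \<Longrightarrow> card {j \<in> S. j < i} \<le> cdim n (F i \<inter> E_first n p)"
        using cd by (auto simp: incidence_def)
      have "cdim n (F (Suc m) \<inter> E_first n (?u m)) < cdim n (F (Suc m) \<inter> E_first n (Suc (?u m)))"
        if m: "m < n" for m
      proof -
        have "cdim n (F (Suc m) \<inter> E_first n (?u m)) \<le> r m"
          using F Ff m by (auto simp: Z_def not_less_eq_eq)
        moreover have "r m < cdim n (F (Suc m) \<inter> E_first n (Suc (?u m)))"
          unfolding r_def by (rule coset_max_jump[OF S cS Ff ge m])
        ultimately show ?thesis by simp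
      qed
      then obtain b where b: "b \<in> borel_upper n" "F = flag_of n (b * perm_matrix n ?u)"
        using in_bruhat_cell_if_jumps[OF Ff u] by blast
      then have "F = flag_of n (b * perm_matrix n ?u * 1\<^sub>m n)" using B_eq[OF b(1) one_borel_upper] by simp
      then show "F \<in> ?B" using b(1) one_borel_upper by blast
    qed
    ultimately show ?thesis
      unfolding schubert_def using \<open>?\<Omega> \<subseteq> incidence n p d\<close> closure_of_mono by blast
  qed
qed

section \<open>Opposite Schubert varieties\<close>

text \<open>
  Reversing the standard basis exchanges the two Borel subgroups and the two families of
  coordinate subspaces, and it acts on the flag variety by a homeomorphism.
\<close>

definition rev_mat :: "nat \<Rightarrow> complex mat" where
  "rev_mat n = perm_matrix n (\<lambda>j. n - 1 - j)"

definition flag_act :: "nat \<Rightarrow> complex mat \<Rightarrow> (nat \<Rightarrow> complex vec set) \<Rightarrow> nat \<Rightarrow> complex vec set" where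
  "flag_act n g F = (\<lambda>i\<in>{0..n}. (*\<^sub>v) g ` F i)"

lemma flag_act_flag_of:
  assumes "g \<in> carrier_mat n n" "h \<in> carrier_mat n n"
  shows "flag_act n g (flag_of n h) = flag_of n (g * h)"
proof
  fix i
  show "flag_act n g (flag_of n h) i = flag_of n (g * h) i"
  proof (cases "i \<le> n")
    case True
    have C: "col h ` {..<i} \<subseteq> carrier_vec n" using col_carrier[OF assms(2)] by auto
    have "col (g * h) ` {..<i} = (*\<^sub>v) g ` col h ` {..<i}"
      unfolding image_image using True col_mult2[OF assms] by (intro image_cong) auto
    then show ?thesis
      using True assms cspan_image[OF assms(1) C] mult_carrier_mat[OF assms]
      by (simp add: flag_act_def flag_of_eq)
  qed (simp add: flag_act_def flag_of_def)
qed

lemma flag_act_flags: "g \<in> GL n \<Longrightarrow> F \<in> flags n \<Longrightarrow> flag_act n g F \<in> flags n"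
  by (metis GL_carrier GL_mult flag_act_flag_of flag_of_in_flags flags_eq_flag_of)

text \<open>
  On matrices of another format, products with \<open>g\<close> have unspecified entries. So the composition
  with left multiplication agrees with a polynomial only on the \<open>n \<times> n\<close> matrices.
\<close>

lemma poly_fun_mult_left:
  assumes "poly_fun n f" "g \<in> carrier_mat n n"
  shows "\<exists>f'. poly_fun n f' \<and> (\<forall>h\<in>carrier_mat n n. f' h = f (g * h))"
  using assms(1)
proof induction
  case (const c)
  then show ?case by (intro exI[of _ "\<lambda>_. c"]) (auto intro: poly_fun.const)
next
  case (entry i j)
  have "(g * h) $$ (i, j) = (\<Sum>k\<in>{0..<n}. g $$ (i, k) * h $$ (k, j))" if "h \<in> carrier_mat n n" for h
    using entry assms(2) that by (auto simp: scalar_prod_def)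
  moreover have "poly_fun n (\<lambda>h. \<Sum>k\<in>{0..<n}. g $$ (i, k) * h $$ (k, j))"
    using entry by (intro entry_poly.sum entry_poly.mult entry_poly.const poly_fun.entry) auto
  ultimately show ?case by (intro exI[of _ "\<lambda>h. \<Sum>k\<in>{0..<n}. g $$ (i, k) * h $$ (k, j)"]) auto
next
  case (add f1 f2)
  then obtain f1' f2' where "poly_fun n f1'" "\<forall>h\<in>carrier_mat n n. f1' h = f1 (g * h)"
    "poly_fun n f2'" "\<forall>h\<in>carrier_mat n n. f2' h = f2 (g * h)" by blast
  then show ?case by (intro exI[of _ "\<lambda>h. f1' h + f2' h"]) (auto intro: poly_fun.add)
next
  case (mult f1 f2)
  then obtain f1' f2' where "poly_fun n f1'" "\<forall>h\<in>carrier_mat n n. f1' h = f1 (g * h)"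
    "poly_fun n f2'" "\<forall>h\<in>carrier_mat n n. f2' h = f2 (g * h)" by blast
  then show ?case by (intro exI[of _ "\<lambda>h. f1' h * f2' h"]) (auto intro: poly_fun.mult)
qed

lemma continuous_flag_act:
  assumes g: "g \<in> GL n"
  shows "continuous_map (zariski_flags n) (zariski_flags n) (flag_act n g)"
  unfolding continuous_map_closedin topspace_zariski_flags
proof (intro conjI allI impI)
  note c = GL_carrier[OF g]
  show "flag_act n g \<in> flags n \<rightarrow> flags n" using flag_act_flags[OF g] by auto
  fix C assume "closedin (zariski_flags n) C"
  then obtain P where P: "P \<subseteq> Collect (poly_fun n)" "{h \<in> GL n. flag_of n h \<in> C} = zero_locus n P"
    unfolding closedin_zariski_flags_iff by blast
  define P' where "P' = {f'. poly_fun n f' \<and> (\<exists>f\<in>P. \<forall>h\<in>carrier_mat n n. f' h = f (g * h))}"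
  have "{h \<in> GL n. flag_of n h \<in> {F \<in> flags n. flag_act n g F \<in> C}} = {h \<in> GL n. g * h \<in> zero_locus n P}"
    using flag_act_flag_of[OF c GL_carrier] flag_of_in_flags GL_mult[OF g]
    unfolding P(2)[symmetric] by auto
  also have "\<dots> = zero_locus n P'"
  proof (intro equalityI subsetI)
    fix h assume h: "h \<in> {h \<in> GL n. g * h \<in> zero_locus n P}"
    then show "h \<in> zero_locus n P'" using GL_carrier[of h n] by (auto simp: zero_locus_def P'_def)
  next
    fix h assume h: "h \<in> zero_locus n P'"
    then have hG: "h \<in> GL n" by (simp add: zero_locus_def)
    have "f (g * h) = 0" if f: "f \<in> P" for f
    proof -
      obtain f' where f': "poly_fun n f'" "\<forall>h\<in>carrier_mat n n. f' h = f (g * h)"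
        using poly_fun_mult_left[OF _ c, of f] f P(1) by auto
      then have "f' h = 0" using h f by (auto simp: zero_locus_def P'_def)
      then show ?thesis using f'(2) GL_carrier[OF hG] by simp
    qed
    then show "h \<in> {h \<in> GL n. g * h \<in> zero_locus n P}"
      using hG GL_mult[OF g hG] by (simp add: zero_locus_def)
  qed
  finally have "{h \<in> GL n. flag_of n h \<in> {F \<in> flags n. flag_act n g F \<in> C}} = zero_locus n P'" .
  moreover have "P' \<subseteq> Collect (poly_fun n)" by (auto simp: P'_def)
  ultimately show "closedin (zariski_flags n) {F \<in> flags n. flag_act n g F \<in> C}"
    unfolding closedin_zariski_flags_iff by blast
qed

lemma flag_act_inverse:
  assumes "g \<in> carrier_mat n n" "h \<in> carrier_mat n n" "h * g = 1\<^sub>m n" "F \<in> flags n"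
  shows "flag_act n h (flag_act n g F) = F"
proof -
  obtain x where x: "x \<in> GL n" "F = flag_of n x" using flags_eq_flag_of[OF assms(4)] .
  note c = GL_carrier[OF x(1)]
  have "flag_act n h (flag_act n g F) = flag_of n (h * (g * x))"
    unfolding x(2) using flag_act_flag_of[OF assms(1) c] flag_act_flag_of[OF assms(2) mult_carrier_mat[OF assms(1) c]]
    by simp
  also have "h * (g * x) = x" using assms c by (simp flip: assoc_mult_mat[of h n n g n x n])
  finally show ?thesis using x by simp
qed

lemma closure_of_flag_act:
  assumes g: "g \<in> GL n" and A: "A \<subseteq> flags n"
  shows "zariski_flags n closure_of (flag_act n g ` A) = flag_act n g ` (zariski_flags n closure_of A)"
proof -
  obtain h where h: "h \<in> GL n" "g * h = 1\<^sub>m n" "h * g = 1\<^sub>m n" using GL_inverse[OF g] .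
  have "homeomorphic_maps (zariski_flags n) (zariski_flags n) (flag_act n g) (flag_act n h)"
    unfolding homeomorphic_maps_def topspace_zariski_flags
    using continuous_flag_act g h flag_act_inverse[OF GL_carrier[OF g] GL_carrier[OF h(1)]]
      flag_act_inverse[OF GL_carrier[OF h(1)] GL_carrier[OF g]] by auto
  then have "homeomorphic_map (zariski_flags n) (zariski_flags n) (flag_act n g)"
    unfolding homeomorphic_map_maps by blast
  then show ?thesis using homeomorphic_map_closure_of A by (metis topspace_zariski_flags)
qed

lemma bij_rev: "bij_betw (\<lambda>j. n - 1 - j) {..<n} {..<n :: nat}"
  by (rule bij_betw_byWitness[where f' = "\<lambda>j. n - 1 - j"]) auto

lemma rev_mat_GL: "rev_mat n \<in> GL n"
  unfolding rev_mat_def using bij_rev by (rule perm_matrix_GL)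

lemma rev_mat_carrier: "rev_mat n \<in> carrier_mat n n"
  using rev_mat_GL GL_carrier by blast

lemma rev_mat_mult_vec:
  assumes "x \<in> carrier_vec n" "i < n"
  shows "(rev_mat n *\<^sub>v x) $ i = x $ (n - 1 - i)"
proof -
  have "(rev_mat n *\<^sub>v x) $ i = (\<Sum>k\<in>{0..<n}. (if i = n - 1 - k then 1 else 0) * x $ k)"
    using assms by (simp add: rev_mat_def perm_matrix_def scalar_prod_def)
  also have "\<dots> = (\<Sum>k\<in>{0..<n}. if k = n - 1 - i then x $ k else 0)"
    using assms(2) by (intro sum.cong) auto
  also have "\<dots> = x $ (n - 1 - i)" using assms(2) by (subst sum.delta) auto
  finally show ?thesis .
qed

lemma entry_eq_col: "A \<in> carrier_mat n m \<Longrightarrow> i < n \<Longrightarrow> j < m \<Longrightarrow> A $$ (i, j) = col A j $ i"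
  by auto

lemma rev_mat_mult:
  assumes "A \<in> carrier_mat n n" "i < n" "j < n"
  shows "(rev_mat n * A) $$ (i, j) = A $$ (n - 1 - i, j)"
proof -
  have "(rev_mat n * A) $$ (i, j) = col (rev_mat n * A) j $ i"
    using entry_eq_col[OF mult_carrier_mat[OF rev_mat_carrier assms(1)] assms(2,3)] .
  also have "\<dots> = (rev_mat n *\<^sub>v col A j) $ i"
    unfolding col_mult2[OF rev_mat_carrier assms(1,3)] ..
  finally show ?thesis using rev_mat_mult_vec[OF col_carrier[OF assms(1)] assms(2), of j] assms by simp
qed

lemma mult_rev_mat:
  assumes "A \<in> carrier_mat n n" "i < n" "j < n"
  shows "(A * rev_mat n) $$ (i, j) = A $$ (i, n - 1 - j)"
proof -
  have "(A * rev_mat n) $$ (i, j) = col (A * rev_mat n) j $ i"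
    using entry_eq_col[OF mult_carrier_mat[OF assms(1) rev_mat_carrier] assms(2,3)] .
  also have "\<dots> = col A (n - 1 - j) $ i"
    using assms col_mult_perm_matrix[where w = "\<lambda>j. n - 1 - j", OF assms(1,3)] by (simp add: rev_mat_def)
  finally show ?thesis using assms by simp
qed

lemma rev_mat_square: "rev_mat n * rev_mat n = 1\<^sub>m n"
proof (rule eq_matI)
  fix i j assume ij: "i < dim_row (1\<^sub>m n :: complex mat)" "j < dim_col (1\<^sub>m n :: complex mat)"
  then have "(rev_mat n * rev_mat n) $$ (i, j) = rev_mat n $$ (n - 1 - i, j)"
    using rev_mat_mult[OF rev_mat_carrier] by simp
  also have "\<dots> = (if n - 1 - i = n - 1 - j then 1 else 0)"
    using ij by (simp add: rev_mat_def perm_matrix_def)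
  also have "\<dots> = 1\<^sub>m n $$ (i, j)" using ij by auto
  finally show "(rev_mat n * rev_mat n) $$ (i, j) = 1\<^sub>m n $$ (i, j)" .
qed (use rev_mat_carrier[of n] in auto)

lemma rev_conjugate_borel:
  assumes b: "b \<in> carrier_mat n n" "det b \<noteq> 0"
  shows "rev_mat n * b * rev_mat n \<in> GL n"
    and "i < n \<Longrightarrow> j < n \<Longrightarrow> (rev_mat n * b * rev_mat n) $$ (i, j) = b $$ (n - 1 - i, n - 1 - j)"
proof -
  show "rev_mat n * b * rev_mat n \<in> GL n"
    using b rev_mat_GL[of n] by (intro GL_mult) (auto simp: GL_iff)
  show "i < n \<Longrightarrow> j < n \<Longrightarrow> (rev_mat n * b * rev_mat n) $$ (i, j) = b $$ (n - 1 - i, n - 1 - j)"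
    using mult_rev_mat[OF mult_carrier_mat[OF rev_mat_carrier b(1)]] rev_mat_mult[OF b(1)] by simp
qed

lemma rev_conjugate_lower_upper:
  assumes "b \<in> borel_lower n"
  shows "rev_mat n * b * rev_mat n \<in> borel_upper n"
  using assms rev_conjugate_borel[of b n] by (auto simp: borel_lower_def borel_upper_def GL_iff)

lemma rev_conjugate_upper_lower:
  assumes "b \<in> borel_upper n"
  shows "rev_mat n * b * rev_mat n \<in> borel_lower n"
  using assms rev_conjugate_borel[of b n] by (auto simp: borel_lower_def borel_upper_def GL_iff)

text \<open>
  Conjugation by the reversal \<open>J\<close> turns \<open>B\<^sup>- v B\<close> into \<open>J B (J v) B\<close>, where \<open>J v\<close> has the values of
  \<open>v\<close> in reversed order.
\<close>

lemma opp_schubert_eq: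
  assumes w: "\<And>i. i < n \<Longrightarrow> w i = n - 1 - v i" and v: "\<And>i. i < n \<Longrightarrow> v i < n"
    and bw: "bij_betw w {..<n} {..<n}"
  shows "opp_schubert n v = flag_act n (rev_mat n) ` schubert n w"
proof -
  let ?J = "rev_mat n" and ?B = "{flag_of n (b * perm_matrix n w * b') | b b'. b \<in> borel_upper n \<and> b' \<in> borel_upper n}"
  note Jc = rev_mat_carrier[of n] and Pc = perm_matrix_carrier[of n]
  have wn: "w i < n" "v i = n - 1 - w i" if "i < n" for i using w[OF that] v[OF that] that by auto
  have Jw: "?J * perm_matrix n w = perm_matrix n v"
  proof (rule mat_col_eqI)
    fix j assume "j < dim_col (perm_matrix n v)"
    then have j: "j < n" by (simp add: perm_matrix_def)
    then show "col (?J * perm_matrix n w) j = col (perm_matrix n v) j"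
      using col_mult_perm_matrix[where w = w, OF Jc j wn(1)[OF j]] wn[OF j]
      by (simp add: rev_mat_def col_perm_matrix)
  qed (use carrier_matD[OF Jc] carrier_matD[OF Pc] in simp_all)
  have key: "flag_act n ?J (flag_of n (c * perm_matrix n w * b')) =
      flag_of n ((?J * c * ?J) * perm_matrix n v * b')"
    if "c \<in> carrier_mat n n" "b' \<in> carrier_mat n n" for c b'
  proof -
    have "(?J * c * ?J) * perm_matrix n v = ?J * c * (?J * ?J) * perm_matrix n w"
      unfolding Jw[symmetric] using that Jc Pc[of w]
      by (simp add: assoc_mult_mat[of _ n n _ n _ n])
    also have "\<dots> = ?J * c * perm_matrix n w"
      using that Jc Pc[of w] by (simp add: rev_mat_square)
    finally have "(?J * c * ?J) * perm_matrix n v * b' = ?J * (c * perm_matrix n w * b')"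
      using that Jc Pc[of w] by (simp add: assoc_mult_mat[of _ n n _ n _ n])
    then show ?thesis
      using flag_act_flag_of[OF Jc, of "c * perm_matrix n w * b'"] that Pc[of w] by simp
  qed
  have GLc: "b \<in> carrier_mat n n" if "b \<in> borel_upper n \<or> b \<in> borel_lower n" for b
    using that by (auto simp: borel_upper_def borel_lower_def GL_iff)
  have "{flag_of n (b * perm_matrix n v * b') | b b'. b \<in> borel_lower n \<and> b' \<in> borel_upper n} = flag_act n ?J ` ?B"
    (is "?A = _")
  proof (intro equalityI subsetI)
    fix F assume "F \<in> ?A"
    then obtain b b' where F: "F = flag_of n (b * perm_matrix n v * b')" "b \<in> borel_lower n" "b' \<in> borel_upper n"
      by auto
    let ?c = "?J * b * ?J"
    have bc: "b \<in> carrier_mat n n" using F GLc by blast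
    have "?J * ?c * ?J = (?J * ?J) * b * (?J * ?J)"
      using bc Jc by (simp add: assoc_mult_mat[of _ n n _ n _ n])
    then have "?J * ?c * ?J = b" using bc by (simp add: rev_mat_square)
    moreover have cB: "?c \<in> borel_upper n" using rev_conjugate_lower_upper F by blast
    ultimately have "F = flag_act n ?J (flag_of n (?c * perm_matrix n w * b'))"
      using key[of ?c b'] GLc F by simp
    then show "F \<in> flag_act n ?J ` ?B" using cB F(3) by blast
  next
    fix F assume "F \<in> flag_act n ?J ` ?B"
    then obtain c b' where F: "F = flag_act n ?J (flag_of n (c * perm_matrix n w * b'))"
      "c \<in> borel_upper n" "b' \<in> borel_upper n" by auto
    then have "F = flag_of n ((?J * c * ?J) * perm_matrix n v * b')" using key GLc by simp
    then show "F \<in> ?A" using rev_conjugate_upper_lower[OF F(2)] F(3) by blast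
  qed
  moreover have "?B \<subseteq> flags n"
    using perm_matrix_GL[OF bw] by (auto intro!: flag_of_in_flags GL_mult simp: borel_upper_GL)
  ultimately show ?thesis
    unfolding opp_schubert_def schubert_def using closure_of_flag_act[OF rev_mat_GL] by simp
qed

text \<open>
  Apply the description of Schubert varieties to the reversed flag; the reversal exchanges the
  first \<open>q\<close> with the last \<open>q\<close> basis vectors.
\<close>

lemma opp_schubert_coset_max:
  assumes T: "T \<subseteq> {..<n}" and cT: "card T = q"
    and v: "\<And>i. i < n \<Longrightarrow> v i < n \<and> coset_max n q T i = n - 1 - v i"
  shows "opp_schubert n v =
    {F \<in> flags n. \<forall>i\<le>n. card {j \<in> T. j < i} \<le> cdim n (F i \<inter> E_last n q)}"
proof -
  let ?J = "rev_mat n"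
  have inv: "flag_act n ?J (flag_act n ?J F) = F" if "F \<in> flags n" for F
    using flag_act_inverse[OF rev_mat_carrier rev_mat_carrier rev_mat_square that] .
  have JJ: "?J *\<^sub>v (?J *\<^sub>v x) = x" if "x \<in> carrier_vec n" for x
    using assoc_mult_mat_vec[OF rev_mat_carrier rev_mat_carrier that] rev_mat_square[of n] that by simp
  have Jc: "?J *\<^sub>v x \<in> carrier_vec n" if "x \<in> carrier_vec n" for x
    using mult_mat_vec_carrier[OF rev_mat_carrier that] .
  have JE: "?J *\<^sub>v x \<in> E_first n q \<longleftrightarrow> x \<in> E_last n q" if x: "x \<in> carrier_vec n" for x
  proof -
    have "(\<forall>r<n. q \<le> r \<longrightarrow> x $ (n - 1 - r) = 0) \<longleftrightarrow> (\<forall>r<n. r < n - q \<longrightarrow> x $ r = 0)" (is "?l = ?r")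
    proof
      assume ?l
      show ?r
      proof (intro allI impI)
        fix r assume "r < n" "r < n - q"
        then show "x $ r = 0" using \<open>?l\<close>[rule_format, of "n - 1 - r"] by simp
      qed
    qed auto
    then show ?thesis using x Jc[OF x] rev_mat_mult_vec[OF x] by (auto simp: E_first_eq E_last_eq)
  qed
  have dim: "cdim n (flag_act n ?J F i \<inter> E_first n q) = cdim n (F i \<inter> E_last n q)"
    if F: "F \<in> flags n" and i: "i \<le> n" for F i
  proof -
    have C: "F i \<subseteq> carrier_vec n" using csubspace_carrier[OF flags_subspace[OF F i]] .
    have "flag_act n ?J F i \<inter> E_first n q = (*\<^sub>v) ?J ` (F i \<inter> E_last n q)"
      using JE C i by (auto simp: flag_act_def)
    then show ?thesis
      using cdim_image[OF rev_mat_GL csubspace_Int[OF flags_subspace[OF F i] csubspace_E_last[of n q]]] by simp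
  qed
  have "opp_schubert n v = flag_act n ?J ` schubert n (coset_max n q T)"
    using v bij_coset_max[OF T cT] by (intro opp_schubert_eq) auto
  also have "\<dots> = flag_act n ?J `
      {F \<in> flags n. \<forall>i\<le>n. card {j \<in> T. j < i} \<le> cdim n (F i \<inter> E_first n q)}"
    by (simp add: schubert_coset_max[OF T cT])
  also have "\<dots> = {F \<in> flags n. \<forall>i\<le>n. card {j \<in> T. j < i} \<le> cdim n (F i \<inter> E_last n q)}" (is "?l = ?r")
  proof (intro equalityI subsetI)
    fix F assume "F \<in> ?l"
    then obtain F' where F': "F' \<in> flags n" "\<forall>i\<le>n. card {j \<in> T. j < i} \<le> cdim n (F' i \<inter> E_first n q)"
      "F = flag_act n ?J F'" by auto
    have Ff: "F \<in> flags n" using F' flag_act_flags[OF rev_mat_GL] by simp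
    moreover have "F' = flag_act n ?J F" using F' inv by simp
    ultimately show "F \<in> ?r" using F'(2) dim[OF Ff] by auto
  next
    fix F assume F: "F \<in> ?r"
    then have "flag_act n ?J F \<in> {F \<in> flags n. \<forall>i\<le>n. card {j \<in> T. j < i} \<le> cdim n (F i \<inter> E_first n q)}"
      using dim flag_act_flags[OF rev_mat_GL] by auto
    moreover have "F = flag_act n ?J (flag_act n ?J F)" using F inv by simp
    ultimately show "F \<in> ?l" by blast
  qed
  finally show ?thesis .
qed

section \<open>Bruhat order and maximal coset representatives\<close>

text \<open>
  The weighted sum serves as a termination measure for sorting in the Bruhat order.
\<close>

lemma weighted_sum_transpose_less:
  fixes w :: "nat \<Rightarrow> nat"
  assumes "i < j" "j < n" "w i < w j"
  shows "(\<Sum>k<n. k * (w \<circ> Transposition.transpose i j) k) < (\<Sum>k<n. k * w k)"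
proof -
  let ?w = "w \<circ> Transposition.transpose i j"
  have split: "(\<Sum>k<n. k * f k) = i * f i + j * f j + (\<Sum>k\<in>{..<n} - {i, j}. k * f k)" for f :: "nat \<Rightarrow> nat"
  proof -
    have "{i, j} \<subseteq> {..<n}" using assms by auto
    then have "(\<Sum>k<n. k * f k) = (\<Sum>k\<in>{..<n} - {i, j}. k * f k) + (\<Sum>k\<in>{i, j}. k * f k)"
      by (intro sum.subset_diff) auto
    then show ?thesis using assms by simp
  qed
  have "(\<Sum>k\<in>{..<n} - {i, j}. k * ?w k) = (\<Sum>k\<in>{..<n} - {i, j}. k * w k)"
    by (intro sum.cong) (auto simp: Transposition.transpose_def)
  moreover have "i * w j + j * w i < i * w i + j * w j"
  proof -
    have "x * v + y * u < x * u + y * v" if "x < y" "u < v" for x y u v :: nat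
    proof -
      obtain a b where "y = x + Suc a" "v = u + Suc b"
      using \<open>x < y\<close> \<open>u < v\<close> less_imp_Suc_add by (metis add_Suc_right)
    then show ?thesis by (simp add: algebra_simps)
  qed
    then show ?thesis using assms(1,3) .
  qed
  ultimately show ?thesis
    unfolding split[of ?w] split[of w] by (simp add: Transposition.transpose_def)
qed

text \<open>
  A decreasing enumeration of an interval of values is determined by the positions: the value at
  \<open>i\<close> is the number of larger values, which are those at the earlier positions of the same kind.
\<close>

lemma coset_max_unique:
  assumes S: "S \<subseteq> {..<n}" "card S = p"
    and w: "bij_betw w {..<n} {..<n}" "\<And>i. n \<le> i \<Longrightarrow> w i = i"
    and low: "{k. k < n \<and> w k < p} = S"
    and dec: "\<And>i j. i < j \<Longrightarrow> j < n \<Longrightarrow> (i \<in> S \<longleftrightarrow> j \<in> S) \<Longrightarrow> w j < w i"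
  shows "w = coset_max n p S"
proof
  fix i
  have inj: "inj_on w {..<n}" and im: "w ` {..<n} = {..<n}" using w(1) by (auto simp: bij_betw_def)
  have pn: "p \<le> n" using S card_mono[of "{..<n}" S] by simp
  have iff: "w k < p \<longleftrightarrow> k \<in> S" if "k < n" for k using low that by auto
  have onto: "\<exists>k<n. w k = x" if "x < n" for x
  proof -
    have "x \<in> w ` {..<n}" using im that by simp
    then show ?thesis by auto
  qed
  show "w i = coset_max n p S i"
  proof (cases "i < n")
    case False
    then show ?thesis using w(2) by (simp add: coset_max_def)
  next
    case i: True
    have before: "k < i" if k: "k < n" "w i < w k" "k \<in> S \<longleftrightarrow> i \<in> S" for k
      using dec[of i k] k by (cases "k = i") (auto simp: not_less_iff_gr_or_eq linorder_neq_iff)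
    show ?thesis
    proof (cases "i \<in> S")
      case True
      have "w ` {j \<in> S. j < i} = {w i<..<p}"
      proof (intro equalityI subsetI)
        fix x assume "x \<in> w ` {j \<in> S. j < i}"
        then show "x \<in> {w i<..<p}" using dec i iff True by auto
      next
        fix x assume x: "x \<in> {w i<..<p}"
        then obtain k where k: "k < n" "w k = x" using onto[of x] pn by auto
        then have "k \<in> S" using x iff by auto
        then show "x \<in> w ` {j \<in> S. j < i}" using before[of k] k x True by auto
      qed
      moreover have "card (w ` {j \<in> S. j < i}) = card {j \<in> S. j < i}"
        using S by (intro card_image inj_on_subset[OF inj]) auto
      ultimately have "card {j \<in> S. j < i} = p - 1 - w i" by simp
      then show ?thesis using True i iff[OF i] by (simp add: coset_max_def)
    next
      case False
      have "w ` {j. j \<notin> S \<and> j < i} = {w i<..<n}"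
      proof (intro equalityI subsetI)
        fix x assume "x \<in> w ` {j. j \<notin> S \<and> j < i}"
        then obtain j where j: "j \<notin> S" "j < i" "x = w j" by auto
        then have "w j < n" using im i by auto
        then show "x \<in> {w i<..<n}" using dec[of j i] i j False by auto
      next
        fix x assume x: "x \<in> {w i<..<n}"
        then obtain k where k: "k < n" "w k = x" using onto[of x] by auto
        have "k \<notin> S" using iff[OF k(1)] iff[OF i] False x k by auto
        then show "x \<in> w ` {j. j \<notin> S \<and> j < i}" using before[of k] k x False by auto
      qed
      moreover have "card (w ` {j. j \<notin> S \<and> j < i}) = card {j. j \<notin> S \<and> j < i}"
        using i by (intro card_image inj_on_subset[OF inj]) auto
      ultimately have "card {j. j \<notin> S \<and> j < i} = n - 1 - w i" by simp
      moreover have "w i < n" using im i by auto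
      ultimately show ?thesis using False i by (simp add: coset_max_def)
    qed
  qed
qed

text \<open>
  Ascend in the Bruhat order towards the representative. As long as the small values do not sit
  at the positions \<open>S\<close>, move one of them from a superfluous position to the first missing one, which
  comes later by the hypothesis; after that, exchange two small or two large values that are not
  in decreasing order.
\<close>

lemma bruhat_le_coset_max:
  assumes S: "S \<subseteq> {..<n}" "card S = p"
    and "bij_betw w {..<n} {..<n}" "\<And>i. n \<le> i \<Longrightarrow> w i = i"
    and "\<And>i. i \<le> n \<Longrightarrow> card {j \<in> S. j < i} \<le> card {k. k < i \<and> w k < p}"
  shows "bruhat_le n w (coset_max n p S)"
  using assms(3-)
proof (induction "\<Sum>k<n. k * w k" arbitrary: w rule: less_induct)
  case less
  note bij = less.prems(1) and fixed = less.prems(2) and dom = less.prems(3)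
  have inj: "inj_on w {..<n}" and im: "w ` {..<n} = {..<n}" using bij by (auto simp: bij_betw_def)
  have finS: "finite S" using S(1) finite_subset by blast
  let ?low = "{k. k < n \<and> w k < p}"
  show ?case
  proof (cases "w = coset_max n p S")
    case True
    then show ?thesis by (simp add: bruhat_le_def)
  next
    case False
    have step: "bruhat_le n w (coset_max n p S)"
      if ij: "i < j" "j < n" "w i < w j"
        and dom': "\<And>l. l \<le> n \<Longrightarrow>
          card {r \<in> S. r < l} \<le> card {k. k < l \<and> (w \<circ> Transposition.transpose i j) k < p}" for i j
    proof -
      let ?w = "w \<circ> Transposition.transpose i j"
      have "bij_betw (Transposition.transpose i j) {..<n} {..<n}"
        using ij by (intro bij_betw_byWitness[where f' = "Transposition.transpose i j"])
          (auto simp: Transposition.transpose_def)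
      then have "bij_betw ?w {..<n} {..<n}" using bij by (rule bij_betw_trans)
      moreover have "?w k = k" if "n \<le> k" for k
        using that ij fixed by (auto simp: Transposition.transpose_def)
      ultimately have "bruhat_le n ?w (coset_max n p S)"
        using weighted_sum_transpose_less[OF ij] dom' by (intro less.hyps) auto
      moreover have "bruhat_step n w ?w" using ij by (auto simp: bruhat_step_def)
      ultimately show ?thesis unfolding bruhat_le_def by (metis converse_rtranclp_into_rtranclp)
    qed
    show ?thesis
    proof (cases "?low = S")
      case True
      obtain i j where ij: "i < j" "j < n" "i \<in> S \<longleftrightarrow> j \<in> S" "\<not> w j < w i"
        using coset_max_unique[OF S bij fixed True] False by blast
      have "w i \<noteq> w j" using ij inj by (auto simp: inj_on_def)
      then have wij: "w i < w j" using ij(4) by simp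
      have "k \<in> S \<longleftrightarrow> w k < p" if "k < n" for k using that True[symmetric] by simp
      from this[of i] this[of j] have "w i < p \<longleftrightarrow> w j < p" using ij by simp
      then have "(w \<circ> Transposition.transpose i j) k < p \<longleftrightarrow> w k < p" for k
        by (auto simp: Transposition.transpose_def)
      then show ?thesis using step[OF ij(1,2) wij] dom by simp
    next
      case neq: False
      have "card ?low = p"
      proof -
        have "w ` ?low = {..<p}"
        proof (intro equalityI subsetI)
          fix x assume "x \<in> {..<p}"
          moreover have "p \<le> n" using S card_mono[of "{..<n}" S] by simp
          ultimately have "x \<in> w ` {..<n}" using im by auto
          then show "x \<in> w ` ?low" using \<open>x \<in> {..<p}\<close> by auto
        qed auto
        moreover have "card (w ` ?low) = card ?low" by (intro card_image inj_on_subset[OF inj]) auto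
        ultimately show ?thesis by simp
      qed
      then have "\<not> S \<subseteq> ?low" using neq S card_subset_eq[of ?low S] by auto
      then have ex: "\<exists>t. t \<in> S - ?low" by auto
      define t where "t = (LEAST t. t \<in> S - ?low)"
      have t: "t \<in> S" "t \<notin> ?low" using LeastI_ex[OF ex] by (auto simp: t_def)
      have tmin: "r \<in> ?low" if "r \<in> S" "r < t" for r
        using not_less_Least[of r "\<lambda>t. t \<in> S - ?low"] that by (auto simp: t_def)
      have tn: "t < n" using t S by auto
      have wt: "p \<le> w t" using t(2) tn by auto
      have "\<exists>s. s < t \<and> w s < p \<and> s \<notin> S"
      proof (rule ccontr)
        assume no: "\<not> ?thesis"
        have "{k. k < Suc t \<and> w k < p} \<subseteq> {j \<in> S. j < t}" using no wt by (auto simp: less_Suc_eq)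
        then have "card {k. k < Suc t \<and> w k < p} \<le> card {j \<in> S. j < t}" using finS by (intro card_mono) auto
        also have "\<dots> < card {j \<in> S. j < Suc t}" using finS t by (intro psubset_card_mono) auto
        finally show False using dom[of "Suc t"] tn by simp
      qed
      then obtain s where s: "s < t" "w s < p" "s \<notin> S" by blast
      let ?w = "w \<circ> Transposition.transpose s t"
      have ws: "?w s = w t" "?w t = w s" "\<And>k. k \<noteq> s \<Longrightarrow> k \<noteq> t \<Longrightarrow> ?w k = w k"
        by (auto simp: Transposition.transpose_def)
      have "card {r \<in> S. r < l} \<le> card {k. k < l \<and> ?w k < p}" if l: "l \<le> n" for l
      proof -
        consider "l \<le> s" | "s < l" "l \<le> t" | "t < l" by linarith
        then show ?thesis
        proof cases
          case 1
          then have "{k. k < l \<and> ?w k < p} = {k. k < l \<and> w k < p}" using s ws by auto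
          then show ?thesis using dom[OF l] by simp
        next
          case 2
          have "{r \<in> S. r < l} \<subseteq> {k. k < l \<and> ?w k < p}"
          proof
            fix r assume r: "r \<in> {r \<in> S. r < l}"
            then have "w r < p" "r \<noteq> s" "r \<noteq> t" using tmin[of r] 2 s by auto
            then show "r \<in> {k. k < l \<and> ?w k < p}" using r ws(3) by simp
          qed
          then show ?thesis by (intro card_mono) auto
        next
          case 3
          have "{k. k < l \<and> ?w k < p} = insert t ({k. k < l \<and> w k < p} - {s})"
          proof (intro equalityI subsetI)
            fix k assume "k \<in> {k. k < l \<and> ?w k < p}"
            then show "k \<in> insert t ({k. k < l \<and> w k < p} - {s})"
              using ws wt by (cases "k = s"; cases "k = t") auto
          next
            fix k assume "k \<in> insert t ({k. k < l \<and> w k < p} - {s})"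
            then show "k \<in> {k. k < l \<and> ?w k < p}"
              using ws s 3 by (cases "k = t") auto
          qed
          moreover have "card (insert t (X - {s})) = card X" if "t \<notin> X - {s}" "s \<in> X" "finite X" for X
            using that card.remove[OF that(3,2)] by simp
          from this[of "{k. k < l \<and> w k < p}"]
          have "card (insert t ({k. k < l \<and> w k < p} - {s})) = card {k. k < l \<and> w k < p}"
            using wt s 3 by simp
          ultimately have "card {k. k < l \<and> ?w k < p} = card {k. k < l \<and> w k < p}" by simp
          then show ?thesis using dom[OF l] by simp
        qed
      qed
      then show ?thesis using step[OF s(1) tn] s(2) wt by simp
    qed
  qed
qed

section \<open>Positions in a clan\<close>

lemma count_list_eq_card: "count_list xs x = card {i. i < length xs \<and> xs ! i = x}"
  by (simp add: count_list_eq_length_filter length_filter_conv_card eq_commute)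

definition clan_first :: "clan_symbol list \<Rightarrow> nat set" where
  "clan_first \<gamma> = {s. \<exists>t. mates \<gamma> s t}"

definition clan_second :: "clan_symbol list \<Rightarrow> nat set" where
  "clan_second \<gamma> = {t. \<exists>s. mates \<gamma> s t}"

definition clan_sign :: "clan_symbol list \<Rightarrow> clan_symbol \<Rightarrow> nat set" where
  "clan_sign \<gamma> c = {i. i < length \<gamma> \<and> \<gamma> ! i = c}"

text \<open>
  The default value \<open>j\<close> allows signs and starts of arcs to be treated alike: in either case
  \<open>arc_end \<gamma> j\<close> is the position that carries the unit vectors associated with \<open>j\<close>.
\<close>

definition arc_end :: "clan_symbol list \<Rightarrow> nat \<Rightarrow> nat" where
  "arc_end \<gamma> j = (if \<exists>t. mates \<gamma> j t then THE t. mates \<gamma> j t else j)"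

locale clan =
  fixes p q n :: nat and \<gamma> :: "clan_symbol list"
  assumes is_clan: "is_clan p q \<gamma>" and n: "n = p + q"
begin

abbreviation "Fst \<equiv> clan_first \<gamma>"
abbreviation "Snd \<equiv> clan_second \<gamma>"
abbreviation "Pls \<equiv> clan_sign \<gamma> Plus"
abbreviation "Mns \<equiv> clan_sign \<gamma> Minus"
abbreviation "\<mu> \<equiv> arc_end \<gamma>"

lemma length_clan: "length \<gamma> = n"
  using is_clan n by (simp add: is_clan_def)

lemma card_number: "Num a \<in> set \<gamma> \<Longrightarrow> card {i. i < n \<and> \<gamma> ! i = Num a} = 2"
  using is_clan unfolding is_clan_def count_list_eq_card length_clan by blast

text \<open>
  No number occurs three times, hence every position belongs to at most one arc.
\<close>

lemma three_equal_numbers: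
  assumes "i < n" "j < n" "k < n" "\<gamma> ! i = Num a" "\<gamma> ! j = Num a" "\<gamma> ! k = Num a"
    "i \<noteq> j" "j \<noteq> k" "i \<noteq> k"
  shows False
proof -
  have "Num a \<in> set \<gamma>" using assms length_clan by (metis nth_mem)
  then have "card {i. i < n \<and> \<gamma> ! i = Num a} = 2" by (rule card_number)
  moreover have "card {i, j, k} \<le> card {i. i < n \<and> \<gamma> ! i = Num a}"
    using assms by (intro card_mono) auto
  ultimately show False using assms by simp
qed

lemma mates_bounds: "mates \<gamma> s t \<Longrightarrow> s < t" "mates \<gamma> s t \<Longrightarrow> t < n"
  by (auto simp: mates_def length_clan)

lemma mates_start_less: "mates \<gamma> s t \<Longrightarrow> s < n"
  using mates_bounds less_trans by blast

lemma mates_unique_end: "mates \<gamma> s t \<Longrightarrow> mates \<gamma> s t' \<Longrightarrow> t = t'"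
  using three_equal_numbers[of s t t'] by (fastforce simp: mates_def length_clan)

lemma mates_unique_start: "mates \<gamma> s t \<Longrightarrow> mates \<gamma> s' t \<Longrightarrow> s = s'"
  using three_equal_numbers[of s s' t] by (fastforce simp: mates_def length_clan)

lemma mates_no_chain: "mates \<gamma> s t \<Longrightarrow> mates \<gamma> t u \<Longrightarrow> False"
  using three_equal_numbers[of s t u] by (fastforce simp: mates_def length_clan)

lemma number_in_arc:
  assumes "i < n" "\<gamma> ! i = Num a"
  shows "i \<in> Fst \<or> i \<in> Snd"
proof -
  have "Num a \<in> set \<gamma>" using assms length_clan by (metis nth_mem)
  then have "card {i. i < n \<and> \<gamma> ! i = Num a} = 2" by (rule card_number)
  moreover have "card {i. i < n \<and> \<gamma> ! i = Num a} \<le> card {i}" if "{i. i < n \<and> \<gamma> ! i = Num a} \<subseteq> {i}"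
    using that by (intro card_mono) auto
  ultimately have "\<not> {i. i < n \<and> \<gamma> ! i = Num a} \<subseteq> {i}" by auto
  then obtain j where j: "j < n" "\<gamma> ! j = Num a" "j \<noteq> i" by auto
  then have "mates \<gamma> i j \<or> mates \<gamma> j i" using assms by (auto simp: mates_def length_clan)
  then show ?thesis by (auto simp: clan_first_def clan_second_def)
qed

lemma arc_end_mates: "s \<in> Fst \<Longrightarrow> mates \<gamma> s (\<mu> s)"
proof -
  assume "s \<in> Fst"
  then obtain t where t: "mates \<gamma> s t" by (auto simp: clan_first_def)
  then have "(THE t. mates \<gamma> s t) = t" using mates_unique_end by blast
  then show ?thesis using t by (auto simp: arc_end_def)
qed

lemma arc_end_eq: "mates \<gamma> s t \<Longrightarrow> \<mu> s = t"
  using arc_end_mates mates_unique_end by (auto simp: clan_first_def)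

lemma arc_end_not_first: "j \<notin> Fst \<Longrightarrow> \<mu> j = j"
  by (auto simp: arc_end_def clan_first_def)

lemma position_cases:
  assumes "i < n"
  obtains "i \<in> Pls" | "i \<in> Mns" | "i \<in> Fst" | "i \<in> Snd"
  using number_in_arc[OF assms] assms length_clan by (cases "\<gamma> ! i") (auto simp: clan_sign_def)

lemma positions_less:
  "i \<in> Pls \<Longrightarrow> i < n" "i \<in> Mns \<Longrightarrow> i < n" "i \<in> Fst \<Longrightarrow> i < n" "i \<in> Snd \<Longrightarrow> i < n"
  using mates_bounds(2) mates_start_less
  by (auto simp: clan_sign_def clan_first_def clan_second_def length_clan)

lemma positions_disjoint:
  "Pls \<inter> Mns = {}" "Pls \<inter> Fst = {}" "Pls \<inter> Snd = {}" "Mns \<inter> Fst = {}" "Mns \<inter> Snd = {}" "Fst \<inter> Snd = {}"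
  using mates_no_chain by (auto simp: clan_sign_def clan_first_def clan_second_def mates_def)

lemma positions_union: "Pls \<union> Mns \<union> Fst \<union> Snd = {..<n}"
  using positions_less by (auto elim: position_cases)

lemma finite_positions: "finite Pls" "finite Mns" "finite Fst" "finite Snd"
  using positions_union finite_subset[of _ "{..<n}"] by blast+

lemma gplus_eq: "gplus \<gamma> = Pls \<union> Snd"
  using mates_bounds by (auto simp: gplus_def clan_sign_def clan_second_def length_clan)

lemma gplus_tilde_eq: "gplus_tilde \<gamma> = Pls \<union> Fst"
  using positions_less(3) by (auto simp: gplus_tilde_def clan_sign_def clan_first_def length_clan)

text \<open>
  The positions of the last \<open>q\<close> values of \<open>v\<close>. They govern the intersections with the span of
  the last \<open>q\<close> basis vectors.
\<close>

abbreviation "T \<equiv> Mns \<union> Snd"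

lemma T_eq: "T = {i. i < n \<and> i \<notin> gplus_tilde \<gamma>}"
  unfolding gplus_tilde_eq using positions_union positions_disjoint by (auto simp: set_eq_iff)

lemma bij_arc_end: "bij_betw \<mu> Fst Snd"
proof (rule bij_betw_imageI)
  show "inj_on \<mu> Fst"
    using arc_end_mates mates_unique_start by (intro inj_onI) metis
  show "\<mu> ` Fst = Snd"
    using arc_end_mates arc_end_eq by (force simp: clan_first_def clan_second_def)
qed

lemma card_pairs:
  "card {(s, t). mates \<gamma> s t \<and> P s t} = card {s \<in> Fst. P s (\<mu> s)}"
proof (rule bij_betw_same_card)
  show "bij_betw fst {(s, t). mates \<gamma> s t \<and> P s t} {s \<in> Fst. P s (\<mu> s)}"
    by (rule bij_betw_byWitness[where f' = "\<lambda>s. (s, \<mu> s)"])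
      (use arc_end_mates arc_end_eq in \<open>auto simp: clan_first_def\<close>)
qed

lemma card_arcs_closed: "card {s \<in> Fst. \<mu> s < i} = card {t \<in> Snd. t < i}"
proof (rule bij_betw_same_card)
  show "bij_betw \<mu> {s \<in> Fst. \<mu> s < i} {t \<in> Snd. t < i}"
    using bij_arc_end unfolding bij_betw_def by (auto simp: inj_on_def)
qed

lemma count_take: "i \<le> n \<Longrightarrow> count_list (take i \<gamma>) c = card {j \<in> clan_sign \<gamma> c. j < i}"
proof -
  assume i: "i \<le> n"
  have "{j. j < length (take i \<gamma>) \<and> take i \<gamma> ! j = c} = {j \<in> clan_sign \<gamma> c. j < i}"
    using i length_clan by (auto simp: clan_sign_def)
  then show ?thesis by (simp add: count_list_eq_card)
qed

lemma card_Un_less: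
  assumes "finite A" "finite B" "A \<inter> B = {}"
  shows "card {j \<in> A \<union> B. j < i} = card {j \<in> A. j < i} + card {j \<in> B. j < (i::nat)}"
proof -
  have "{j \<in> A \<union> B. j < i} = {j \<in> A. j < i} \<union> {j \<in> B. j < i}" by auto
  then show ?thesis using assms by (simp add: card_Un_disjoint disjoint_iff)
qed

lemma clan_plus_eq: "i \<le> n \<Longrightarrow> clan_plus \<gamma> i = card {j \<in> gplus \<gamma>. j < i}"
  unfolding gplus_eq clan_plus_def
  using count_take[of i Plus] card_pairs[of "\<lambda>s t. t < i"] card_arcs_closed[of i]
    card_Un_less[OF finite_positions(1,4) positions_disjoint(3), of i] by simp

lemma clan_minus_eq: "i \<le> n \<Longrightarrow> clan_minus \<gamma> i = card {j \<in> T. j < i}"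
  unfolding clan_minus_def
  using count_take[of i Minus] card_pairs[of "\<lambda>s t. t < i"] card_arcs_closed[of i]
    card_Un_less[OF finite_positions(2,4) positions_disjoint(5), of i] by simp

lemma clan_cross_eq: "clan_cross \<gamma> i j = card {s \<in> Fst. s < i \<and> j \<le> \<mu> s}"
  unfolding clan_cross_def using card_pairs[of "\<lambda>s t. s < i \<and> j \<le> t"] by simp

lemma card_positions_less:
  assumes "i \<le> n"
  shows "card {j \<in> gplus \<gamma>. j < i} + card {j \<in> Mns \<union> Fst. j < i} = i"
    and "card {j \<in> T. j < i} + card {j \<in> gplus_tilde \<gamma>. j < i} = i"
proof -
  have split: "card {j \<in> A. j < i} + card {j \<in> B. j < i} = i"
    if "A \<union> B = {..<n}" "A \<inter> B = {}" for A B
  proof -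
    have "finite (A \<union> B)" using that(1) by simp
    moreover have "{j \<in> A \<union> B. j < i} = {..<i}" unfolding that(1) using assms by auto
    ultimately show ?thesis using card_Un_less[of A B i] that(2) by simp
  qed
  show "card {j \<in> gplus \<gamma>. j < i} + card {j \<in> Mns \<union> Fst. j < i} = i"
    unfolding gplus_eq using positions_disjoint
    by (intro split) (unfold positions_union[symmetric], blast+)
  show "card {j \<in> T. j < i} + card {j \<in> gplus_tilde \<gamma>. j < i} = i"
    unfolding gplus_tilde_eq using positions_disjoint
    by (intro split) (unfold positions_union[symmetric], blast+)
qed

text \<open>
  Every arc contributes one element to each of the two sets, so that their sizes add up to
  \<open>p + q\<close> and differ by the difference of the numbers of signs.
\<close>

lemma card_signs: "card (gplus \<gamma>) = p" "card T = q"
proof -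
  have full: "{j \<in> A. j < n} = A" if "A \<subseteq> {..<n}" for A using that by auto
  have sub: "Pls \<subseteq> {..<n}" "Mns \<subseteq> {..<n}" "Fst \<subseteq> {..<n}" "Snd \<subseteq> {..<n}" using positions_union by auto
  have "card Fst = card Snd" using bij_betw_same_card[OF bij_arc_end] .
  moreover have "card (gplus \<gamma>) = card Pls + card Snd" "card (Mns \<union> Fst) = card Mns + card Fst"
    "card T = card Mns + card Snd"
    unfolding gplus_eq using finite_positions positions_disjoint by (auto intro: card_Un_disjoint)
  moreover have "card (gplus \<gamma>) + card (Mns \<union> Fst) = n"
    using card_positions_less(1)[of n] full[of "gplus \<gamma>"] full[of "Mns \<union> Fst"] sub by (simp add: gplus_eq)
  moreover have "int (card Pls) - int (card Mns) = int p - int q"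
    using is_clan unfolding is_clan_def count_list_eq_card clan_sign_def by blast
  ultimately show "card (gplus \<gamma>) = p" "card T = q" using n by linarith+
qed

lemma gplus_sub: "gplus \<gamma> \<subseteq> {..<n}" and T_sub: "T \<subseteq> {..<n}"
  unfolding gplus_eq using positions_union by auto

lemma clan_u_eq: "clan_u p q \<gamma> = coset_max n p (gplus \<gamma>)"
  by (rule ext) (simp add: clan_u_def coset_max_def n)

text \<open>
  Reversing the values of \<open>v\<close> makes both of its increasing runs decreasing: the result is
  the maximal coset representative of the complementary set of positions.
\<close>

lemma clan_v_less: "i < n \<Longrightarrow> clan_v p q \<gamma> i < n"
  and clan_v_eq: "i < n \<Longrightarrow> coset_max n q T i = n - 1 - clan_v p q \<gamma> i"
  and clan_v_low: "i < n \<Longrightarrow> clan_v p q \<gamma> i < p \<longleftrightarrow> i \<in> gplus_tilde \<gamma>"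
proof -
  assume i: "i < n"
  have iff: "j \<in> T \<longleftrightarrow> j \<notin> gplus_tilde \<gamma>" if "j \<le> i" for j
    unfolding T_eq using that i by simp
  have e1: "{j. j \<notin> gplus_tilde \<gamma> \<and> j < i} = {j \<in> T. j < i}"
    and e2: "{j \<in> gplus_tilde \<gamma>. j < i} = {j. j \<notin> T \<and> j < i}"
    using iff less_imp_le by blast+
  have "clan_v p q \<gamma> i < n \<and> coset_max n q T i = n - 1 - clan_v p q \<gamma> i \<and>
    (clan_v p q \<gamma> i < p \<longleftrightarrow> i \<in> gplus_tilde \<gamma>)"
  proof (cases "i \<in> T")
    case True
    moreover have "i \<notin> gplus_tilde \<gamma>" using True iff by blast
    moreover have "card {j \<in> T. j < i} < q" using card_S_less[OF T_sub card_signs(2) True] .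
    ultimately show ?thesis
      unfolding clan_v_def coset_max_def e1 n[symmetric] using i n by simp
  next
    case False
    moreover have "i \<in> gplus_tilde \<gamma>" using False iff by blast
    moreover have "card {j. j \<notin> T \<and> j < i} < n - q"
      using card_not_S_less[OF T_sub card_signs(2) i False] .
    ultimately show ?thesis
      unfolding clan_v_def coset_max_def e2 n[symmetric] using i n by simp
  qed
  then show "clan_v p q \<gamma> i < n" "coset_max n q T i = n - 1 - clan_v p q \<gamma> i"
    "clan_v p q \<gamma> i < p \<longleftrightarrow> i \<in> gplus_tilde \<gamma>"
    by blast+
qed

lemma bij_clan_v: "bij_betw (clan_v p q \<gamma>) {..<n} {..<n}"
proof -
  have "inj_on (clan_v p q \<gamma>) {..<n}"
  proof (rule inj_onI)
    fix i j assume *: "i \<in> {..<n}" "j \<in> {..<n}" "clan_v p q \<gamma> i = clan_v p q \<gamma> j"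
    then have "coset_max n q T i = coset_max n q T j" using clan_v_eq by simp
    then show "i = j"
      using bij_betw_imp_inj_on[OF bij_coset_max[OF T_sub card_signs(2)]] * by (auto simp: inj_on_def)
  qed
  moreover have "clan_v p q \<gamma> ` {..<n} \<subseteq> {..<n}" using clan_v_less by auto
  ultimately show ?thesis unfolding bij_betw_def using endo_inj_surj[of "{..<n}"] by blast
qed

text \<open>
  Both permutations have small values at the plus signs; the other small values of \<open>v\<close> sit at the
  starts of arcs and those of \<open>u\<close> at their ends, hence later.
\<close>

lemma clan_v_le_u: "bruhat_le n (clan_v p q \<gamma>) (clan_u p q \<gamma>)"
  unfolding clan_u_eq
proof (rule bruhat_le_coset_max[OF gplus_sub card_signs(1) bij_clan_v])
  show "clan_v p q \<gamma> i = i" if "n \<le> i" for i using that n by (simp add: clan_v_def)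
  show "card {j \<in> gplus \<gamma>. j < i} \<le> card {k. k < i \<and> clan_v p q \<gamma> k < p}" if i: "i \<le> n" for i
  proof -
    have "{k. k < i \<and> clan_v p q \<gamma> k < p} = {j \<in> Pls \<union> Fst. j < i}"
      using clan_v_low i unfolding gplus_tilde_eq by auto
    moreover have "card {t \<in> Snd. t < i} \<le> card {s \<in> Fst. s < i}"
      unfolding card_arcs_closed[symmetric]
      using finite_positions mates_bounds(1)[OF arc_end_mates] by (intro card_mono) (auto intro: less_trans)
    ultimately show ?thesis
      unfolding gplus_eq using card_Un_less[OF finite_positions(1,4) positions_disjoint(3), of i]
        card_Un_less[OF finite_positions(1,3) positions_disjoint(2), of i] by simp
  qed
qed

lemma richardson_eq:
  "richardson n (clan_u p q \<gamma>) (clan_v p q \<gamma>) = {F \<in> flags n. \<forall>i\<le>n.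
     clan_plus \<gamma> i \<le> cdim n (F i \<inter> E_first n p) \<and> clan_minus \<gamma> i \<le> cdim n (F i \<inter> E_last n q)}"
  unfolding richardson_def clan_u_eq schubert_coset_max[OF gplus_sub card_signs(1)]
  using opp_schubert_coset_max[OF T_sub card_signs(2), of "clan_v p q \<gamma>"] clan_v_less clan_v_eq
  by (auto simp: clan_plus_eq clan_minus_eq)

end

section \<open>The orbit of a clan\<close>

text \<open>
  The projection maps the part \<open>(F m \<inter> E) \<oplus> (F m \<inter> E')\<close> of \<open>F m\<close> into \<open>F m\<close>, so only the vectors
  that complete a basis of that part to a basis of \<open>F m\<close> can enlarge the sum.
\<close>

lemma cdim_proj_sum_le:
  assumes F: "F \<in> flags n" and ij: "i \<le> m" "m \<le> j" "j \<le> n" and p: "p \<le> n"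
  shows "cdim n (proj_sum n p (F i) (F j)) + cdim n (F m \<inter> E_first n p)
    + cdim n (F m \<inter> E_last n (n - p)) \<le> j + m"
proof -
  let ?A = "F m \<inter> E_first n p" and ?C = "F m \<inter> E_last n (n - p)" and ?\<pi> = "proj_first n p"
  have mn: "m \<le> n" and i: "i \<le> n" using ij by auto
  note Fi = flags_subspace[OF F i] and Fm = flags_subspace[OF F mn] and Fj = flags_subspace[OF F ij(3)]
  have A: "csubspace n ?A" and C: "csubspace n ?C"
    using csubspace_Int[OF Fm] csubspace_E_first csubspace_E_last by auto
  have carr: "F i \<subseteq> carrier_vec n" "F m \<subseteq> carrier_vec n" "F j \<subseteq> carrier_vec n"
    using csubspace_carrier[OF Fi] csubspace_carrier[OF Fm] csubspace_carrier[OF Fj] by auto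
  have AC: "?A \<union> ?C \<subseteq> carrier_vec n" using carr by auto
  have "cdim n (?A \<inter> ?C) \<le> cdim n (E_first n p \<inter> E_last n (n - p))"
    using csubspace_Int[OF A C] csubspace_Int[OF csubspace_E_first csubspace_E_last] by (intro cdim_mono) auto
  then have H: "cdim n (cspan n (?A \<union> ?C)) = cdim n ?A + cdim n ?C"
    using cdim_sum_Int[OF A C] by (simp add: cdim_first_Int_last)
  obtain B where B: "B \<subseteq> ?A \<union> ?C" "finite B" "cindep n B" "cspan n B = cspan n (?A \<union> ?C)"
      "card B = cdim n (cspan n (?A \<union> ?C))"
    using cbasis_in[OF AC] .
  have BF: "B \<subseteq> F m" using B(1) by auto
  obtain D where D: "B \<subseteq> D" "D \<subseteq> F m" "finite D" "cindep n D" "cspan n D = cspan n (F m)"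
      "card D = cdim n (cspan n (F m))"
    using cbasis_between[OF carr(2) BF B(3)] .
  have DF: "cspan n D = F m" "card D = m"
    using D(5,6) cspan_csubspace[OF Fm] flags_cdim[OF F mn] by auto
  let ?\<Delta> = "D - B"
  have DC: "D \<subseteq> carrier_vec n" using D(2) carr by auto
  have \<pi>C: "?\<pi> ` X \<subseteq> carrier_vec n" for X by (auto simp: proj_first_def)
  have FjC: "F j \<union> ?\<pi> ` ?\<Delta> \<subseteq> carrier_vec n" using carr \<pi>C[of ?\<Delta>] by auto
  have sub: "F j \<union> ?\<pi> ` ?\<Delta> \<subseteq> cspan n (F j \<union> ?\<pi> ` ?\<Delta>)" using FjC by (rule cspan_superset)
  have Fmj: "F m \<subseteq> F j" using flags_mono[OF F ij(2,3)] .
  have "?\<pi> b \<in> F j" if "b \<in> B" for b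
  proof -
    from that B(1) consider "b \<in> ?A" | "b \<in> ?C" by auto
    then show ?thesis
    proof cases
      case 1
      then have "?\<pi> b = b" by (intro eq_vecI) (auto simp: proj_first_def E_first_eq)
      then show ?thesis using 1 Fmj by auto
    next
      case 2
      then have "?\<pi> b = 0\<^sub>v n" using p by (intro eq_vecI) (auto simp: proj_first_def E_last_eq)
      then show ?thesis using csubspace_zero[OF Fj] by simp
    qed
  qed
  then have "?\<pi> ` D \<subseteq> cspan n (F j \<union> ?\<pi> ` ?\<Delta>)" using sub by auto
  then have "cspan n (?\<pi> ` D) \<subseteq> cspan n (F j \<union> ?\<pi> ` ?\<Delta>)"
    by (rule cspan_minimal[OF csubspace_cspan[OF FjC]])
  then have "?\<pi> ` F m \<subseteq> cspan n (F j \<union> ?\<pi> ` ?\<Delta>)" using cspan_proj_first[OF DC] DF(1) by simp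
  then have "?\<pi> ` F i \<union> F j \<subseteq> cspan n (F j \<union> ?\<pi> ` ?\<Delta>)"
    using flags_mono[OF F ij(1) mn] sub by auto
  then have "proj_sum n p (F i) (F j) \<subseteq> cspan n (F j \<union> ?\<pi> ` ?\<Delta>)"
    unfolding proj_sum_eq_cspan[OF Fi Fj] by (rule cspan_minimal[OF csubspace_cspan[OF FjC]])
  moreover have "csubspace n (proj_sum n p (F i) (F j))"
    unfolding proj_sum_eq_cspan[OF Fi Fj] using carr \<pi>C by (intro csubspace_cspan) auto
  ultimately have "cdim n (proj_sum n p (F i) (F j)) \<le> cdim n (cspan n (F j \<union> ?\<pi> ` ?\<Delta>))"
    using csubspace_cspan[OF FjC] by (intro cdim_mono)
  also have "\<dots> \<le> cdim n (cspan n (F j)) + card (?\<pi> ` ?\<Delta>)"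
    using D(3) by (intro cdim_cspan_Un_le carr \<pi>C) auto
  also have "\<dots> \<le> j + card ?\<Delta>"
    using cspan_csubspace[OF Fj] flags_cdim[OF F ij(3)] card_image_le[of ?\<Delta> ?\<pi>] D(3) by simp
  finally show ?thesis
    using card_Diff_subset[OF B(2) D(1)] card_mono[OF D(3,1)] DF(2) B(5) H by linarith
qed

context clan
begin

lemma inj_on_arc_end:
  assumes "A \<inter> Fst = {}" "A \<inter> Snd = {}"
  shows "inj_on \<mu> (A \<union> Fst)" "\<mu> ` (A \<union> Fst) = A \<union> Snd"
proof -
  have A: "\<mu> j = j" if "j \<in> A" for j using assms(1) that arc_end_not_first by auto
  have F: "inj_on \<mu> Fst" "\<mu> ` Fst = Snd" using bij_arc_end by (auto simp: bij_betw_def)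
  have "inj_on \<mu> A" using A by (simp add: inj_on_def)
  moreover have "\<mu> ` A = A" using A by force
  ultimately show "inj_on \<mu> (A \<union> Fst)" "\<mu> ` (A \<union> Fst) = A \<union> Snd"
    using F assms by (auto simp: inj_on_Un image_Un)
qed

text \<open>
  An explicit flag with generic behaviour. Its columns are unit vectors of the first kind (index
  below \<open>p\<close>) at plus signs, of the second kind at minus signs and at ends of arcs, and differences
  of the two at the starts of arcs. So an arc contributes to the flag a vector in neither
  coordinate subspace at its start, and its two components only at its end. The \<open>d k\<close>
  record when each unit vector enters the flag.
\<close>

lemma standard_flag:
  obtains d g where "g \<in> GL n" "\<forall>k<n. d k \<le> n" "\<forall>k<n. unit_vec n k \<in> flag_of n g (d k)"
    "\<forall>i\<le>n. card {k \<in> {..<p}. d k \<le> i} = clan_plus \<gamma> i"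
    "\<forall>i\<le>n. card {k \<in> {p..<n}. d k \<le> i} = clan_minus \<gamma> i"
    "\<forall>i\<le>n. cdim n (flag_of n g i \<inter> E_first n p) \<le> clan_plus \<gamma> i"
    "\<forall>i\<le>n. cdim n (flag_of n g i \<inter> E_last n q) \<le> clan_minus \<gamma> i"
    "\<forall>j\<le>n. \<forall>i\<le>j. j + clan_cross \<gamma> i j \<le> cdim n (proj_sum n p (flag_of n g i) (flag_of n g j))"
proof -
  have fin: "finite (gplus \<gamma>)" "finite T" using finite_positions by (auto simp: gplus_eq)
  obtain e1 where e1: "bij_betw e1 {..<p} (gplus \<gamma>)"
    using finite_same_card_bij[of "{..<p}" "gplus \<gamma>"] fin card_signs by auto
  obtain e2 where e2: "bij_betw e2 {p..<n} T"
    using finite_same_card_bij[of "{p..<n}" T] fin card_signs n by auto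
  \<comment> \<open>The unit vectors attached to the positions: \<open>a\<close> and \<open>b\<close> number the positions with an
  associated unit vector of the first and of the second kind.\<close>
  define a where "a = inv_into {..<p} e1"
  define b where "b = inv_into {p..<n} e2"
  have ba: "bij_betw a (gplus \<gamma>) {..<p}" and bb: "bij_betw b T {p..<n}"
    unfolding a_def b_def using bij_betw_inv_into[OF e1] bij_betw_inv_into[OF e2] by auto
  have ae: "a (e1 k) = k" if "k < p" for k using bij_betw_inv_into_left[OF e1] that by (simp add: a_def)
  have be: "b (e2 k) = k" if "p \<le> k" "k < n" for k using bij_betw_inv_into_left[OF e2] that by (simp add: b_def)
  have a: "a j < p" if "j \<in> gplus \<gamma>" for j using ba that by (auto dest: bij_betwE)
  have b: "p \<le> b j" "b j < n" if "j \<in> T" for j using bb that by (auto dest: bij_betwE)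
  have e1n: "e1 k \<in> gplus \<gamma>" "e1 k < n" if "k < p" for k
    using e1 that gplus_sub by (auto dest: bij_betwE)
  have e2n: "e2 k \<in> T" "e2 k < n" if "p \<le> k" "k < n" for k
    using bij_betwE[OF e2] that T_sub by (auto simp: subset_iff)
  have \<mu>Fst: "\<mu> s \<in> Snd" if "s \<in> Fst" for s using bij_arc_end that by (auto dest: bij_betwE)
  let ?e = "unit_vec n :: nat \<Rightarrow> complex vec"
  define x where "x j = (if j \<in> Pls then ?e (a j) else if j \<in> Fst then ?e (a (\<mu> j)) - ?e (b (\<mu> j)) else ?e (b j))" for j
  have xC: "x j \<in> carrier_vec n" for j by (simp add: x_def)
  have xP: "x j = ?e (a j)" if "j \<in> Pls" for j using that by (simp add: x_def)
  have xT: "x j = ?e (b j)" if "j \<in> T" for j using that positions_disjoint by (auto simp: x_def)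
  have xF: "x j = ?e (a (\<mu> j)) - ?e (b (\<mu> j))" if "j \<in> Fst" for j
    using that positions_disjoint by (auto simp: x_def)
  have xXC: "x ` K \<subseteq> carrier_vec n" for K using xC by auto
  have xs: "csubspace n (cspan n (x ` K))" for K using csubspace_cspan[OF xXC] .
  have xin: "x j \<in> cspan n (x ` K)" if "j \<in> K" for j K using cspan_superset[OF xXC, of K] that by auto
  have unit_b: "?e (b j) \<in> cspan n (x ` {..<i})" if "j \<in> T" "j < i" for i j
    using xin[of j "{..<i}"] xT that by simp
  have unit_a: "?e (a j) \<in> cspan n (x ` {..<i})" if j: "j \<in> gplus \<gamma>" "j < i" for i j
  proof (cases "j \<in> Pls")
    case True
    then show ?thesis using xin[of j "{..<i}"] xP j by simp
  next
    case False
    then have js: "j \<in> Snd" using j by (simp add: gplus_eq)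
    then obtain s where s: "mates \<gamma> s j" by (auto simp: clan_second_def)
    then have sF: "s \<in> Fst" "\<mu> s = j" "s < j"
      using arc_end_eq mates_bounds by (auto simp: clan_first_def)
    have "?e (a j) = x s + x j"
      using xF[OF sF(1)] xT[of j] js sF by (intro eq_vecI) auto
    moreover have "x s + x j \<in> cspan n (x ` {..<i})"
      using xin[of s "{..<i}"] xin[of j "{..<i}"] sF(3) j(2) by (intro csubspace_add[OF xs]) auto
    ultimately show ?thesis by simp
  qed
  define d where "d k = Suc (if k < p then e1 k else e2 k)" for k
  have unit_d: "?e k \<in> cspan n (x ` {..<d k})" if "k < n" for k
  proof (cases "k < p")
    case True
    then show ?thesis using unit_a[OF e1n(1)[OF True], of "d k"] ae by (simp add: d_def)
  next
    case False
    then show ?thesis using unit_b[OF e2n(1), of k "d k"] be that by (simp add: d_def)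
  qed
  have dn: "d k \<le> n" if "k < n" for k using e1n(2) e2n(2) that by (auto simp: d_def Suc_le_eq)
  have "cspan n (x ` {..<n}) = carrier_vec n"
  proof (rule csubspace_eq_carrier_if_units[OF xs])
    fix k assume k: "k < n"
    have "cspan n (x ` {..<d k}) \<subseteq> cspan n (x ` {..<n})" using dn[OF k] by (intro cspan_mono) auto
    then show "?e k \<in> cspan n (x ` {..<n})" using unit_d[OF k] by auto
  qed
  then obtain g where g: "g \<in> GL n" "\<And>k. k < n \<Longrightarrow> col g k = x k"
    using GL_of_spanning_columns[of n x] xC by blast
  have fl: "flag_of n g i = cspan n (x ` {..<i})" if "i \<le> n" for i
  proof -
    have "col g ` {..<i} = x ` {..<i}" using g(2) that by (intro image_cong) auto
    then show ?thesis using flag_of_eq[OF GL_carrier[OF g(1)] that] by simp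
  qed
  have Fs: "csubspace n (flag_of n g i)" if "i \<le> n" for i using csubspace_flag_of[OF GL_carrier[OF g(1)] that] .
  have xfl: "x j \<in> flag_of n g i" if "j < i" "i \<le> n" for i j using fl that xin by simp
  have pn: "p \<le> n" and qn: "q \<le> n" and np: "n - p = q" using n by auto
  have disj: "Mns \<inter> Fst = {}" "Mns \<inter> Snd = {}" "Pls \<inter> Fst = {}" "Pls \<inter> Snd = {}"
    using positions_disjoint by auto
  \<comment> \<open>The sum of a member of the flag and a coordinate subspace also contains the unit vectors
  of the other kind at the signs of the other kind and, as differences, at starts of arcs.\<close>
  have meet: "cdim n (flag_of n g i \<inter> E) + (card K + card {j \<in> B \<union> Fst. j < i}) \<le> i + cdim n E"
    if i: "i \<le> n" and E: "csubspace n E"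
      and K: "K \<subseteq> {..<n}" "\<And>k. k \<in> K \<Longrightarrow> ?e k \<in> E"
      and B: "B \<inter> Fst = {}" "B \<inter> Snd = {}"
      and f: "inj_on f (B \<union> Snd)" "f ` (B \<union> Snd) \<subseteq> {..<n} - K"
      and fB: "\<And>j. j \<in> B \<Longrightarrow> ?e (f j) = x j"
      and fF: "\<And>W s. csubspace n W \<Longrightarrow> E \<subseteq> W \<Longrightarrow> s \<in> Fst \<Longrightarrow> x s \<in> W \<Longrightarrow> ?e (f (\<mu> s)) \<in> W"
    for i E K B f
  proof -
    let ?F = "flag_of n g i" and ?J = "{j \<in> B \<union> Fst. j < i}"
    let ?W = "cspan n (?F \<union> E)" and ?f = "\<lambda>j. f (\<mu> j)"
    have C: "?F \<union> E \<subseteq> carrier_vec n" using csubspace_carrier[OF Fs[OF i]] csubspace_carrier[OF E] by auto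
    have W: "csubspace n ?W" "?F \<union> E \<subseteq> ?W" using csubspace_cspan[OF C] cspan_superset[OF C] by auto
    note \<mu> = inj_on_arc_end[OF B]
    have im: "?f ` ?J \<subseteq> {..<n} - K" using \<mu>(2) f(2) by blast
    have "inj_on (f \<circ> \<mu>) (B \<union> Fst)" using \<mu> f(1) by (intro comp_inj_on) simp_all
    then have inj: "inj_on ?f ?J" by (auto simp: inj_on_def)
    have "cdim n (?F \<inter> E) + card (K \<union> ?f ` ?J) \<le> cdim n ?F + cdim n E"
    proof (rule cdim_Int_le_if_units_in_sum[OF Fs[OF i] E])
      show "K \<union> ?f ` ?J \<subseteq> {..<n}" using K(1) im by auto
      fix k assume "k \<in> K \<union> ?f ` ?J"
      then consider "k \<in> K" | j where "j \<in> ?J" "k = ?f j" by auto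
      then show "?e k \<in> ?W"
      proof cases
        case 1
        then show ?thesis using K(2) W(2) by auto
      next
        case (2 j)
        have xj: "x j \<in> ?W" using xfl[of j i] 2 i W(2) by auto
        show ?thesis
        proof (cases "j \<in> Fst")
          case True
          then show ?thesis using fF[OF W(1) _ True xj] W(2) 2 by simp
        next
          case False
          then show ?thesis using 2 fB[of j] arc_end_not_first[OF False] xj by auto
        qed
      qed
    qed
    moreover have "card (K \<union> ?f ` ?J) = card K + card (?f ` ?J)"
      using im finite_subset[OF K(1)] by (intro card_Un_disjoint) auto
    ultimately show ?thesis using card_image[OF inj] cdim_flag_of[OF g(1) i] by simp
  qed
  have "card {k \<in> {..<p}. d k \<le> i} = clan_plus \<gamma> i" if "i \<le> n" for i
  proof -
    have "{k \<in> {..<p}. d k \<le> i} = {k \<in> {..<p}. Suc (e1 k) \<le> i}" by (auto simp: d_def)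
    then show ?thesis using card_bound_via_bij[OF e1] clan_plus_eq[OF that] by simp
  qed
  moreover have "card {k \<in> {p..<n}. d k \<le> i} = clan_minus \<gamma> i" if "i \<le> n" for i
  proof -
    have "{k \<in> {p..<n}. d k \<le> i} = {k \<in> {p..<n}. Suc (e2 k) \<le> i}" by (auto simp: d_def)
    then show ?thesis using card_bound_via_bij[OF e2] clan_minus_eq[OF that] by simp
  qed
  moreover have "cdim n (flag_of n g i \<inter> E_first n p) \<le> clan_plus \<gamma> i" if i: "i \<le> n" for i
  proof -
    have "cdim n (flag_of n g i \<inter> E_first n p) + (card {..<p} + card {j \<in> Mns \<union> Fst. j < i})
        \<le> i + cdim n (E_first n p)"
    proof (rule meet[OF i csubspace_E_first _ _ disj(1,2)])
      show "?e k \<in> E_first n p" if "k \<in> {..<p}" for k using that pn by (auto simp: E_first_eq)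
      show "?e (b (\<mu> s)) \<in> W" if "csubspace n W" "E_first n p \<subseteq> W" "s \<in> Fst" "x s \<in> W" for W s
      proof -
        have "a (\<mu> s) < p" using a \<mu>Fst[OF that(3)] by (simp add: gplus_eq)
        then have "?e (a (\<mu> s)) \<in> W" using that(2) pn by (auto simp: E_first_eq)
        moreover have "?e (b (\<mu> s)) = ?e (a (\<mu> s)) - x s" using xF[OF that(3)] by (intro eq_vecI) auto
        ultimately show ?thesis using csubspace_diff[OF that(1) _ that(4)] by simp
      qed
    qed (use bb pn xT in \<open>auto simp: bij_betw_def\<close>)
    then show ?thesis using card_positions_less(1)[OF i] clan_plus_eq[OF i] cdim_E_first[OF pn] by simp
  qed
  moreover have "cdim n (flag_of n g i \<inter> E_last n q) \<le> clan_minus \<gamma> i" if i: "i \<le> n" for i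
  proof -
    have "cdim n (flag_of n g i \<inter> E_last n q) + (card {p..<n} + card {j \<in> Pls \<union> Fst. j < i})
        \<le> i + cdim n (E_last n q)"
    proof (rule meet[OF i csubspace_E_last _ _ disj(3,4)])
      show "?e k \<in> E_last n q" if "k \<in> {p..<n}" for k using that n by (auto simp: E_last_eq)
      show "?e (a (\<mu> s)) \<in> W" if "csubspace n W" "E_last n q \<subseteq> W" "s \<in> Fst" "x s \<in> W" for W s
      proof -
        have "p \<le> b (\<mu> s)" "b (\<mu> s) < n" using b \<mu>Fst[OF that(3)] by auto
        then have "?e (b (\<mu> s)) \<in> W" using that(2) n by (auto simp: E_last_eq)
        moreover have "?e (a (\<mu> s)) = ?e (b (\<mu> s)) + x s" using xF[OF that(3)] by (intro eq_vecI) auto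
        ultimately show ?thesis using csubspace_add[OF that(1) _ that(4)] by simp
      qed
      show "a ` (Pls \<union> Snd) \<subseteq> {..<n} - {p..<n}" using ba pn by (auto simp: bij_betw_def gplus_eq)
      show "inj_on a (Pls \<union> Snd)" using ba by (simp add: bij_betw_def gplus_eq)
    qed (use xP in auto)
    then show ?thesis
      using card_positions_less(2)[OF i] clan_minus_eq[OF i] gplus_tilde_eq cdim_E_last[OF qn] np by simp
  qed
  moreover have "j + clan_cross \<gamma> i j \<le> cdim n (proj_sum n p (flag_of n g i) (flag_of n g j))"
    if j: "j \<le> n" and ij: "i \<le> j" for i j
  proof -
    have i: "i \<le> n" using ij j by simp
    let ?W = "proj_first n p ` flag_of n g i \<union> flag_of n g j"
    let ?S = "{s \<in> Fst. s < i \<and> j \<le> \<mu> s}"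
    \<comment> \<open>For an arc over both \<open>i\<close> and \<open>j\<close>, the column at its end is already in the sum, because it
    is the difference of the projected and the original column at its start. So the columns
    at the remaining positions from \<open>j\<close> on complete the sum to the whole space.\<close>
    let ?R = "{j..<n} - \<mu> ` ?S"
    have WC: "?W \<subseteq> carrier_vec n" using csubspace_carrier[OF Fs[OF j]] by (auto simp: proj_first_def)
    have C: "?W \<union> x ` ?R \<subseteq> carrier_vec n" using WC xXC by auto
    note s = csubspace_cspan[OF C] and sup = cspan_superset[OF C]
    have "x l \<in> cspan n (?W \<union> x ` ?R)" if l: "l < n" for l
    proof -
      consider "l < j" | "l \<in> ?R" | t where "t \<in> ?S" "l = \<mu> t" using l by force
      then show ?thesis
      proof cases
        case 1
        then show ?thesis using xfl[OF 1 j] sup by auto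
      next
        case 2
        then show ?thesis using sup by auto
      next
        case (3 t)
        have tS: "\<mu> t \<in> Snd" using 3 \<mu>Fst by auto
        have "a (\<mu> t) < p" "p \<le> b (\<mu> t)" using a b tS by (auto simp: gplus_eq)
        then have \<pi>: "proj_first n p (x t) = ?e (a (\<mu> t))"
          using xF[of t] 3 by (intro eq_vecI) (auto simp: proj_first_def unit_vec_def)
        have "x l = proj_first n p (x t) - x t"
          unfolding \<pi> using xF[of t] xT[of l] tS 3 by (intro eq_vecI) auto
        moreover have "x t \<in> flag_of n g i" "x t \<in> flag_of n g j" using xfl[of t] 3 i j ij by auto
        ultimately show ?thesis using sup by (auto intro!: csubspace_diff[OF s])
      qed
    qed
    then have "cspan n (x ` {..<n}) \<subseteq> cspan n (?W \<union> x ` ?R)" by (intro cspan_minimal[OF s]) auto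
    then have "carrier_vec n \<subseteq> cspan n (?W \<union> x ` ?R)"
      using \<open>cspan n (x ` {..<n}) = carrier_vec n\<close> by simp
    then have "n \<le> cdim n (cspan n (?W \<union> x ` ?R))"
      using cdim_mono[OF csubspace_carrier_vec s] cdim_carrier_vec by simp
    also have "\<dots> \<le> cdim n (cspan n ?W) + card (x ` ?R)" using WC xXC by (intro cdim_cspan_Un_le) auto
    also have "card (x ` ?R) \<le> card ?R" by (intro card_image_le) simp
    also have "cspan n ?W = proj_sum n p (flag_of n g i) (flag_of n g j)"
      using proj_sum_eq_cspan[OF Fs[OF i] Fs[OF j]] by simp
    finally have "n \<le> cdim n (proj_sum n p (flag_of n g i) (flag_of n g j)) + card ?R" by simp
    moreover have "card ?R + clan_cross \<gamma> i j = n - j"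
    proof -
      have "\<mu> ` ?S \<subseteq> {j..<n}" using \<mu>Fst positions_less(4) by auto
      moreover have "card (\<mu> ` ?S) = card ?S"
        using bij_arc_end by (intro card_image) (auto simp: bij_betw_def inj_on_def)
      ultimately show ?thesis
        using card_Diff_subset[of "\<mu> ` ?S" "{j..<n}"] card_mono[of "{j..<n}" "\<mu> ` ?S"] finite_subset
        by (simp add: clan_cross_eq)
    qed
    ultimately show ?thesis using j by linarith
  qed
  moreover have "\<forall>k<n. unit_vec n k \<in> flag_of n g (d k)" using unit_d fl dn by simp
  ultimately show ?thesis using that[of g d] g(1) dn by blast
qed

text \<open>
  The bound \<open>cdim_proj_sum_le\<close> at a position \<open>m\<close> between \<open>i\<close> and \<open>j\<close> exceeds \<open>j\<close> by the number of
  arcs over \<open>m\<close>, so \<open>m\<close> is needed such that every arc over \<open>m\<close> is an arc over both \<open>i\<close> and \<open>j\<close>.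
  Take for \<open>m\<close> the first start, from \<open>i\<close> on, of an arc that extends to \<open>j\<close> or beyond, if there is
  one. Since arcs do not cross, an arc over \<open>m\<close> encloses that arc; so it extends beyond \<open>j\<close>
  too, and it starts before \<open>i\<close> by the choice of \<open>m\<close>. If there is no such start, take \<open>m = j\<close>.
\<close>

lemma cdim_proj_sum_le_cross:
  assumes av: "avoids_1212 \<gamma>" and F: "F \<in> flags n"
    and ge: "\<And>i. i \<le> n \<Longrightarrow> clan_plus \<gamma> i \<le> cdim n (F i \<inter> E_first n p)"
      "\<And>i. i \<le> n \<Longrightarrow> clan_minus \<gamma> i \<le> cdim n (F i \<inter> E_last n q)"
    and ij: "i \<le> j" "j \<le> n"
  shows "cdim n (proj_sum n p (F i) (F j)) \<le> j + clan_cross \<gamma> i j"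
proof -
  have "\<exists>m. i \<le> m \<and> m \<le> j \<and> {s \<in> Fst. s < m \<and> m \<le> \<mu> s} \<subseteq> {s \<in> Fst. s < i \<and> j \<le> \<mu> s}"
  proof (cases "\<exists>s\<in>Fst. i \<le> s \<and> s < j \<and> j \<le> \<mu> s")
    case False
    then show ?thesis using ij by (intro exI[of _ j]) (auto simp: not_le)
  next
    case True
    define m where "m = (LEAST s. s \<in> Fst \<and> i \<le> s \<and> s < j \<and> j \<le> \<mu> s)"
    have m: "m \<in> Fst" "i \<le> m" "m < j" "j \<le> \<mu> m"
      using LeastI_ex[of "\<lambda>s. s \<in> Fst \<and> i \<le> s \<and> s < j \<and> j \<le> \<mu> s"] True by (auto simp: m_def)
    have min: "\<not> (s \<in> Fst \<and> i \<le> s \<and> s < j \<and> j \<le> \<mu> s)" if "s < m" for s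
      using not_less_Least[of s "\<lambda>s. s \<in> Fst \<and> i \<le> s \<and> s < j \<and> j \<le> \<mu> s"] that by (simp add: m_def)
    have "s < i \<and> j \<le> \<mu> s" if s: "s \<in> Fst" "s < m" "m \<le> \<mu> s" for s
    proof -
      have ms: "mates \<gamma> s (\<mu> s)" and mm: "mates \<gamma> m (\<mu> m)" using arc_end_mates s m by auto
      have "\<mu> s \<noteq> m" using mates_no_chain ms mm by metis
      then have lt: "m < \<mu> s" using s by simp
      have ne: "\<mu> s \<noteq> \<mu> m" using mates_unique_start ms mm s(2) by (metis less_irrefl)
      have "\<mu> m \<le> \<mu> s"
      proof (rule ccontr)
        assume "\<not> ?thesis"
        then have lt2: "\<mu> s < \<mu> m" by simp
        obtain c c' where c: "\<gamma> ! s = Num c" "\<gamma> ! \<mu> s = Num c" "\<gamma> ! m = Num c'" "\<gamma> ! \<mu> m = Num c'"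
          using ms mm by (auto simp: mates_def)
        have "c \<noteq> c'"
          using three_equal_numbers[of s m "\<mu> s" c] c s lt mates_start_less[OF ms] mates_start_less[OF mm]
            mates_bounds[OF ms] by auto
        then show False
          using av c s(2) lt lt2 mates_bounds(2)[OF mm] length_clan unfolding avoids_1212_def by blast
      qed
      then have "j \<le> \<mu> s" using m(4) by simp
      then show ?thesis using min[OF s(2)] s m by auto
    qed
    then show ?thesis using m by (intro exI[of _ m]) auto
  qed
  then obtain m where m: "i \<le> m" "m \<le> j"
    "{s \<in> Fst. s < m \<and> m \<le> \<mu> s} \<subseteq> {s \<in> Fst. s < i \<and> j \<le> \<mu> s}" by blast
  have mn: "m \<le> n" using m ij by simp
  have "card {s \<in> Fst. s < m} = card {s \<in> Fst. \<mu> s < m} + card {s \<in> Fst. s < m \<and> m \<le> \<mu> s}"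
  proof -
    have "{s \<in> Fst. s < m} = {s \<in> Fst. \<mu> s < m} \<union> {s \<in> Fst. s < m \<and> m \<le> \<mu> s}"
      using mates_bounds(1)[OF arc_end_mates] by (auto intro: less_trans)
    moreover have "{s \<in> Fst. \<mu> s < m} \<inter> {s \<in> Fst. s < m \<and> m \<le> \<mu> s} = {}" by auto
    ultimately show ?thesis using finite_positions(3) by (simp add: card_Un_disjoint)
  qed
  moreover have "card {s \<in> Fst. s < m \<and> m \<le> \<mu> s} \<le> clan_cross \<gamma> i j"
    unfolding clan_cross_eq using m(3) finite_positions(3) by (intro card_mono) auto
  moreover have "card {j \<in> Mns \<union> Fst. j < m} = card {j \<in> Mns. j < m} + card {s \<in> Fst. s < m}"
    using card_Un_less[OF finite_positions(2,3) positions_disjoint(4)] .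
  moreover have "card {j \<in> T. j < m} = card {j \<in> Mns. j < m} + card {s \<in> Fst. \<mu> s < m}"
    using card_Un_less[OF finite_positions(2,4) positions_disjoint(5), of m] card_arcs_closed[of m] by simp
  ultimately have "m \<le> clan_plus \<gamma> m + clan_minus \<gamma> m + clan_cross \<gamma> i j"
    using card_positions_less(1)[OF mn] clan_plus_eq[OF mn] clan_minus_eq[OF mn] by linarith
  then show ?thesis
    using cdim_proj_sum_le[OF F m(1,2) ij(2), of p] ge[OF mn] n by simp
qed

lemma clan_orbit_eq:
  "clan_orbit p q \<gamma> = {F \<in> flags n.
     (\<forall>i\<in>{1..n}. cdim n (F i \<inter> E_first n p) = clan_plus \<gamma> i \<and>
        cdim n (F i \<inter> E_last n q) = clan_minus \<gamma> i) \<and>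
     (\<forall>i\<in>{1..n}. \<forall>j\<in>{i<..n}. cdim n (proj_sum n p (F i) (F j)) = j + clan_cross \<gamma> i j)}"
  unfolding clan_orbit_def Let_def n by auto

text \<open>
  The flags of the Richardson variety that lie outside the closed set \<open>Z\<close> of those that are too
  special in one of the conditions belong to the orbit.
\<close>

theorem closure_of_clan_orbit:
  assumes av: "avoids_1212 \<gamma>"
  shows "zariski_flags n closure_of clan_orbit p q \<gamma> =
    richardson n (clan_u p q \<gamma>) (clan_v p q \<gamma>)" (is "_ = ?R")
proof (rule antisym)
  have pn: "p \<le> n" and np: "n - p = q" using n by auto
  have "closedin (zariski_flags n) ?R"
    unfolding richardson_def schubert_def opp_schubert_def by (intro closedin_Int closedin_closure_of)
  moreover have "clan_orbit p q \<gamma> \<subseteq> ?R"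
  proof
    fix F assume F: "F \<in> clan_orbit p q \<gamma>"
    have "clan_plus \<gamma> i \<le> cdim n (F i \<inter> E_first n p) \<and> clan_minus \<gamma> i \<le> cdim n (F i \<inter> E_last n q)"
      if "i \<le> n" for i
    proof (cases "i = 0")
      case True
      then show ?thesis by (simp add: clan_plus_def clan_minus_def)
    next
      case False
      then have "i \<in> {1..n}" using that by simp
      then show ?thesis using F unfolding clan_orbit_eq by auto
    qed
    then show "F \<in> ?R" using F unfolding richardson_eq clan_orbit_eq by auto
  qed
  ultimately show "zariski_flags n closure_of clan_orbit p q \<gamma> \<subseteq> ?R" by (intro closure_of_minimal)
  obtain d g where g: "g \<in> GL n" "\<forall>k<n. d k \<le> n" "\<forall>k<n. unit_vec n k \<in> flag_of n g (d k)"
    "\<forall>i\<le>n. card {k \<in> {..<p}. d k \<le> i} = clan_plus \<gamma> i"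
    "\<forall>i\<le>n. card {k \<in> {p..<n}. d k \<le> i} = clan_minus \<gamma> i"
    "\<forall>i\<le>n. cdim n (flag_of n g i \<inter> E_first n p) \<le> clan_plus \<gamma> i"
    "\<forall>i\<le>n. cdim n (flag_of n g i \<inter> E_last n q) \<le> clan_minus \<gamma> i"
    "\<forall>j\<le>n. \<forall>i\<le>j. j + clan_cross \<gamma> i j \<le> cdim n (proj_sum n p (flag_of n g i) (flag_of n g j))"
    using standard_flag .
  have R: "?R = incidence n p d"
    unfolding richardson_eq incidence_def np using g(4,5) by auto
  let ?Z1 = "\<lambda>i. {F \<in> flags n. Suc (clan_plus \<gamma> i) \<le> cdim n (F i \<inter> E_first n p)}"
  let ?Z2 = "\<lambda>i. {F \<in> flags n. Suc (clan_minus \<gamma> i) \<le> cdim n (F i \<inter> E_last n q)}"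
  let ?Z3 = "\<lambda>i j. {F \<in> flags n. cdim n (proj_sum n p (F i) (F j)) \<le> j + clan_cross \<gamma> i j - 1}"
  define Z where "Z = (\<Union>i\<in>{1..n}. ?Z1 i) \<union> (\<Union>i\<in>{1..n}. ?Z2 i) \<union> (\<Union>i\<in>{1..n}. \<Union>j\<in>{i<..n}. ?Z3 i j)"
  have closed: "closedin (zariski_flags n) Z"
    unfolding Z_def
    by (intro closedin_Un closedin_Union)
      (auto intro!: closedin_Union closedin_flags_cdim_Int_ge closedin_flags_cdim_proj_sum_le
        csubspace_E_first csubspace_E_last)
  have gZ: "flag_of n g \<notin> Z"
  proof
    assume "flag_of n g \<in> Z"
    then consider i where "i \<in> {1..n}" "flag_of n g \<in> ?Z1 i" | i where "i \<in> {1..n}" "flag_of n g \<in> ?Z2 i"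
      | i j where "i \<in> {1..n}" "j \<in> {i<..n}" "flag_of n g \<in> ?Z3 i j"
      unfolding Z_def by blast
    then show False
    proof cases
      case 1
      then show ?thesis using g(6)[rule_format, of i] by simp
    next
      case 2
      then show ?thesis using g(7)[rule_format, of i] by simp
    next
      case (3 i j)
      then have "cdim n (proj_sum n p (flag_of n g i) (flag_of n g j)) \<le> j + clan_cross \<gamma> i j - 1"
        "0 < j" "i \<le> j" "j \<le> n" by auto
      then show ?thesis using g(8)[rule_format, of j i] by linarith
    qed
  qed
  have "incidence n p d - Z \<subseteq> clan_orbit p q \<gamma>"
  proof
    fix F assume "F \<in> incidence n p d - Z"
    then have FR: "F \<in> ?R" and FZ: "F \<notin> Z" using R by auto
    then have Ff: "F \<in> flags n"
      and ge: "\<And>i. i \<le> n \<Longrightarrow> clan_plus \<gamma> i \<le> cdim n (F i \<inter> E_first n p)"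
        "\<And>i. i \<le> n \<Longrightarrow> clan_minus \<gamma> i \<le> cdim n (F i \<inter> E_last n q)"
      unfolding richardson_eq by auto
    have "cdim n (F i \<inter> E_first n p) = clan_plus \<gamma> i" "cdim n (F i \<inter> E_last n q) = clan_minus \<gamma> i"
      if i: "i \<in> {1..n}" for i
    proof -
      have "F \<notin> ?Z1 i" "F \<notin> ?Z2 i" using FZ i unfolding Z_def by blast+
      then show "cdim n (F i \<inter> E_first n p) = clan_plus \<gamma> i" "cdim n (F i \<inter> E_last n q) = clan_minus \<gamma> i"
        using Ff ge[of i] i by auto
    qed
    moreover have "cdim n (proj_sum n p (F i) (F j)) = j + clan_cross \<gamma> i j"
      if ij: "i \<in> {1..n}" "j \<in> {i<..n}" for i j
    proof -
      have "F \<notin> ?Z3 i j" using FZ ij unfolding Z_def by blast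
      then have "\<not> cdim n (proj_sum n p (F i) (F j)) \<le> j + clan_cross \<gamma> i j - 1" using Ff by simp
      moreover have "cdim n (proj_sum n p (F i) (F j)) \<le> j + clan_cross \<gamma> i j"
        using ij by (intro cdim_proj_sum_le_cross[OF av Ff ge]) auto
      ultimately show ?thesis by linarith
    qed
    ultimately show "F \<in> clan_orbit p q \<gamma>" unfolding clan_orbit_eq using Ff by blast
  qed
  then have "zariski_flags n closure_of (incidence n p d - Z) \<subseteq> zariski_flags n closure_of clan_orbit p q \<gamma>"
    by (rule closure_of_mono)
  moreover have "incidence n p d \<subseteq> zariski_flags n closure_of (incidence n p d - Z)"
    using g(3) by (intro incidence_subset_closure[OF pn g(2,1) _ closed gZ]) auto
  ultimately show "?R \<subseteq> zariski_flags n closure_of clan_orbit p q \<gamma>" using R by simp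
qed

end

theorem theorem6p4:
  fixes p q :: nat and \<gamma> :: "clan_symbol list"
  assumes "p > 0" and "q > 0"
    and "is_clan p q \<gamma>" and "avoids_1212 \<gamma>"
  shows "bruhat_le (p + q) (clan_v p q \<gamma>) (clan_u p q \<gamma>) \<and>
    zariski_flags (p + q) closure_of clan_orbit p q \<gamma> =
      richardson (p + q) (clan_u p q \<gamma>) (clan_v p q \<gamma>)"
proof -
  interpret clan p q "p + q" \<gamma> using assms(3) by unfold_locales simp_all
  show ?thesis using clan_v_le_u closure_of_clan_orbit[OF assms(4)] by blast
qed

end
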